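(* There is an algorithm (the "all-in-one" pricing) that solves the pricing problem of a commodity $k$, as defined in the context, i.e. returns a path-sequence of minimum cost, in worst-case time $O(|T|^2|E|\ln|E|)$.
   Context: **Setting.** The time steps are $1,\dots,|T|$. $V$ is a finite set of nodes and, for each time step $t$, $E_t$ is the finite set of arcs allowed at time step $t$ (all contained in a common arc set on $V$). A commodity $k$ has demand $d^k\ge 0$ and, at each time step $t$, an origin $O^k_t\in V$ and a destination $D^k_t\in V$. A path is valid for $k$ at time step $t$ if it goes from $O^k_t$ to $D^k_t$ and uses only arcs of $E_t$. It is assumed that a valid path exists at every time step. For every $t$ and $e\in E_t$ a number $u_{et}\le 0$ is given (the dual value of the capacity constraint of arc $e$ at time step $t$). The penalty for one path change is $\alpha> 0$. No initial path before time step $1$ is considered. **Pricing problem of commodity $k$.** A path-sequence is a tuple $s=(p_1,\dots,p_{|T|})$ where $p_t$ is a valid path for $k$ at time step $t$. Its number of path changes is $n_s=|\{t\in\{2,\dots,|T|\}: p_t\ne p_{t-1}\}|$. The problem is to find a path-sequence minimizing the cost $$\alpha\, n_s-d^k\sum_{t=1}^{|T|}\sum_{e\in p_t}u_{et}.$$ **Complexity conventions.** $|E|=\max_t|E_t|$. Running times count elementary operations, with arithmetic operations and comparisons on real numbers at unit cost. It is assumed that $|E|\ge 2$ and $|V|=O(|E|)$, so that one run of Dijkstra's algorithm takes $O(|E|\ln|E|)$ time. *)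

theory Defs
  imports Complex_Main "Graph_Theory.Arc_Walk"
begin

section \<open>The pricing problem of one commodity\<close>

text \<open>
  Nodes and arcs are named by natural numbers, so that a program can handle them. The time
  steps are \<open>1, \<dots>, horizon\<close>; the values of the time-indexed fields elsewhere are irrelevant,
  and \<open>dual P t e\<close> (the number \<open>u\<^sub>e\<^sub>t\<close>) only matters for \<open>e \<in> arcs_at P t\<close>.
\<close>

record pricing =
  net :: "(nat, nat) pre_digraph"
  horizon :: nat
  arcs_at :: "nat \<Rightarrow> nat set"
  origin :: "nat \<Rightarrow> nat"
  destination :: "nat \<Rightarrow> nat"
  demand :: real
  dual :: "nat \<Rightarrow> nat \<Rightarrow> real"
  penalty :: real

definition net_at :: "pricing \<Rightarrow> nat \<Rightarrow> (nat, nat) pre_digraph" where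
  "net_at P t = (net P)\<lparr>arcs := arcs_at P t\<rparr>"

text \<open>
  A path is a start node together with a sequence of arcs. The start node only matters for
  equality of paths: the trivial paths at two different nodes are different paths.
\<close>

type_synonym path = "nat \<times> nat list"

definition valid_path :: "pricing \<Rightarrow> nat \<Rightarrow> path \<Rightarrow> bool" where
  "valid_path P t p \<longleftrightarrow>
     fst p = origin P t \<and> pre_digraph.apath (net_at P t) (fst p) (snd p) (destination P t)"

definition valid_pricing :: "pricing \<Rightarrow> bool" where
  "valid_pricing P \<longleftrightarrow>
     fin_digraph (net P) \<and> 1 \<le> horizon P \<and> 0 \<le> demand P \<and> 0 < penalty P \<and>
     (\<forall>t\<in>{1..horizon P}.
        arcs_at P t \<subseteq> arcs (net P) \<and>
        origin P t \<in> verts (net P) \<and> destination P t \<in> verts (net P) \<and>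
        (\<exists>p. valid_path P t p) \<and>
        (\<forall>e\<in>arcs_at P t. dual P t e \<le> 0))"

definition path_sequence :: "pricing \<Rightarrow> (nat \<Rightarrow> path) \<Rightarrow> bool" where
  "path_sequence P \<sigma> \<longleftrightarrow> (\<forall>t\<in>{1..horizon P}. valid_path P t (\<sigma> t))"

definition path_changes :: "pricing \<Rightarrow> (nat \<Rightarrow> path) \<Rightarrow> nat" where
  "path_changes P \<sigma> = card {t \<in> {2..horizon P}. \<sigma> t \<noteq> \<sigma> (t - 1)}"

definition sequence_cost :: "pricing \<Rightarrow> (nat \<Rightarrow> path) \<Rightarrow> real" where
  "sequence_cost P \<sigma> =
     penalty P * real (path_changes P \<sigma>) -
     demand P * (\<Sum>t = 1..horizon P. \<Sum>e\<in>set (snd (\<sigma> t)). dual P t e)"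

definition optimal_sequence :: "pricing \<Rightarrow> (nat \<Rightarrow> path) \<Rightarrow> bool" where
  "optimal_sequence P \<sigma> \<longleftrightarrow>
     path_sequence P \<sigma> \<and>
     (\<forall>\<sigma>'. path_sequence P \<sigma>' \<longrightarrow> sequence_cost P \<sigma> \<le> sequence_cost P \<sigma>')"

definition num_arcs :: "pricing \<Rightarrow> nat" where
  "num_arcs P = Max ((\<lambda>t. card (arcs_at P t)) ` {1..horizon P})"


section \<open>A random access machine with real arithmetic\<close>

text \<open>
  The memory consists of named arrays of natural numbers and named arrays of real numbers;
  a scalar variable is cell 0 of an array. Reals can be added, subtracted, multiplied, divided
  and compared, but not converted to naturals. Only integers occur as real constants, since
  an arbitrary real constant could carry an infinite amount of advice.
  Naturals, which serve as addresses, have addition, truncated subtraction and comparison;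
  multiplication is left out because at unit cost it makes such a machine unreasonably strong.
\<close>

datatype nexp =
    NConst nat
  | NRead string nexp
  | NAdd nexp nexp
  | NSub nexp nexp

datatype rexp =
    RConst int
  | RRead string nexp
  | RAdd rexp rexp
  | RSub rexp rexp
  | RMul rexp rexp
  | RDiv rexp rexp

datatype bexp =
    NLess nexp nexp
  | RLess rexp rexp
  | BNot bexp
  | BAnd bexp bexp

datatype com =
    Skip
  | NWrite string nexp nexp
  | RWrite string nexp rexp
  | Then com com
  | Cond bexp com com
  | Loop bexp com

record memory =
  nmem :: "string \<Rightarrow> nat \<Rightarrow> nat"
  rmem :: "string \<Rightarrow> nat \<Rightarrow> real"

fun nval :: "nexp \<Rightarrow> memory \<Rightarrow> nat" where
  "nval (NConst n) m = n"
| "nval (NRead x i) m = nmem m x (nval i m)"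
| "nval (NAdd a b) m = nval a m + nval b m"
| "nval (NSub a b) m = nval a m - nval b m"

fun rval :: "rexp \<Rightarrow> memory \<Rightarrow> real" where
  "rval (RConst c) m = of_int c"
| "rval (RRead x i) m = rmem m x (nval i m)"
| "rval (RAdd a b) m = rval a m + rval b m"
| "rval (RSub a b) m = rval a m - rval b m"
| "rval (RMul a b) m = rval a m * rval b m"
| "rval (RDiv a b) m = rval a m / rval b m"

fun bval :: "bexp \<Rightarrow> memory \<Rightarrow> bool" where
  "bval (NLess a b) m \<longleftrightarrow> nval a m < nval b m"
| "bval (RLess a b) m \<longleftrightarrow> rval a m < rval b m"
| "bval (BNot b) m \<longleftrightarrow> \<not> bval b m"
| "bval (BAnd b c) m \<longleftrightarrow> bval b m \<and> bval c m"

text \<open>Evaluating an expression costs one unit for each of its nodes.\<close>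

fun ncost :: "nexp \<Rightarrow> nat" where
  "ncost (NConst n) = 1"
| "ncost (NRead x i) = 1 + ncost i"
| "ncost (NAdd a b) = 1 + ncost a + ncost b"
| "ncost (NSub a b) = 1 + ncost a + ncost b"

fun rcost :: "rexp \<Rightarrow> nat" where
  "rcost (RConst c) = 1"
| "rcost (RRead x i) = 1 + ncost i"
| "rcost (RAdd a b) = 1 + rcost a + rcost b"
| "rcost (RSub a b) = 1 + rcost a + rcost b"
| "rcost (RMul a b) = 1 + rcost a + rcost b"
| "rcost (RDiv a b) = 1 + rcost a + rcost b"

fun bcost :: "bexp \<Rightarrow> nat" where
  "bcost (NLess a b) = 1 + ncost a + ncost b"
| "bcost (RLess a b) = 1 + rcost a + rcost b"
| "bcost (BNot b) = 1 + bcost b"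
| "bcost (BAnd b c) = 1 + bcost b + bcost c"

definition nwrite :: "string \<Rightarrow> nat \<Rightarrow> nat \<Rightarrow> memory \<Rightarrow> memory" where
  "nwrite x i n m = m\<lparr>nmem := (nmem m)(x := (nmem m x)(i := n))\<rparr>"

definition rwrite :: "string \<Rightarrow> nat \<Rightarrow> real \<Rightarrow> memory \<Rightarrow> memory" where
  "rwrite x i r m = m\<lparr>rmem := (rmem m)(x := (rmem m x)(i := r))\<rparr>"

text \<open>\<open>exec c m n m'\<close>: started in memory \<open>m\<close>, program \<open>c\<close> halts in \<open>m'\<close> after \<open>n\<close> operations.\<close>

inductive exec :: "com \<Rightarrow> memory \<Rightarrow> nat \<Rightarrow> memory \<Rightarrow> bool" where
  Skip: "exec Skip m 1 m"
| NWrite: "exec (NWrite x i a) m (1 + ncost i + ncost a) (nwrite x (nval i m) (nval a m) m)"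
| RWrite: "exec (RWrite x i a) m (1 + ncost i + rcost a) (rwrite x (nval i m) (rval a m) m)"
| Then: "exec c1 m n1 m1 \<Longrightarrow> exec c2 m1 n2 m2 \<Longrightarrow> exec (Then c1 c2) m (n1 + n2) m2"
| CondTrue: "bval b m \<Longrightarrow> exec c1 m n m' \<Longrightarrow> exec (Cond b c1 c2) m (1 + bcost b + n) m'"
| CondFalse: "\<not> bval b m \<Longrightarrow> exec c2 m n m' \<Longrightarrow> exec (Cond b c1 c2) m (1 + bcost b + n) m'"
| LoopFalse: "\<not> bval b m \<Longrightarrow> exec (Loop b c) m (1 + bcost b) m"
| LoopTrue: "bval b m \<Longrightarrow> exec c m n1 m1 \<Longrightarrow> exec (Loop b c) m1 n2 m2 \<Longrightarrow>
    exec (Loop b c) m (1 + bcost b + n1 + n2) m2"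

inductive_cases SkipE: "exec Skip m n m'"
inductive_cases NWriteE: "exec (NWrite x i a) m n m'"
inductive_cases RWriteE: "exec (RWrite x i a) m n m'"
inductive_cases ThenE: "exec (Then c1 c2) m n m'"
inductive_cases CondE: "exec (Cond b c1 c2) m n m'"
inductive_cases LoopE: "exec (Loop b c) m n m'"

lemma exec_deterministic:
  "exec c m n m' \<Longrightarrow> exec c m k m'' \<Longrightarrow> n = k \<and> m' = m''"
proof (induction arbitrary: k m'' rule: exec.induct)
  case (Skip m)
  then show ?case by (rule SkipE) simp
next
  case (NWrite x i a m)
  then show ?case by (rule NWriteE) simp
next
  case (RWrite x i a m)
  then show ?case by (rule RWriteE) simp
next
  case (Then c1 m n1 m1 c2 n2 m2)
  from Then.prems show ?case
    by (rule ThenE) (auto dest: Then.IH)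
next
  case (CondTrue b m c1 n m' c2)
  from CondTrue.prems show ?case
    by (rule CondE) (use CondTrue.hyps in \<open>auto dest: CondTrue.IH\<close>)
next
  case (CondFalse b m c2 n m' c1)
  from CondFalse.prems show ?case
    by (rule CondE) (use CondFalse.hyps in \<open>auto dest: CondFalse.IH\<close>)
next
  case (LoopFalse b m c)
  from LoopFalse.prems show ?case
    by (rule LoopE) (use LoopFalse.hyps in simp_all)
next
  case (LoopTrue b m c n1 m1 n2 m2)
  from LoopTrue.prems obtain k1 m1' k2 where k: "k = 1 + bcost b + k1 + k2"
    and body: "exec c m k1 m1'" and rest: "exec (Loop b c) m1' k2 m''"
    by (rule LoopE) (use LoopTrue.hyps in simp_all)
  from LoopTrue.IH(1)[OF body] have "n1 = k1" "m1 = m1'" by simp_all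
  moreover from this rest have "n2 = k2 \<and> m2 = m''" by (intro LoopTrue.IH(2)) simp
  ultimately show ?case using k by simp
qed


section \<open>Input and output of a pricing program\<close>

text \<open>
  A family of lists indexed by time steps is stored in one array, the list of time step \<open>t\<close>
  occupying the cells from \<open>ptr t\<close> up to, but excluding, \<open>ptr (t + 1)\<close>.
\<close>

definition segment :: "(nat \<Rightarrow> 'a) \<Rightarrow> (nat \<Rightarrow> nat) \<Rightarrow> nat \<Rightarrow> 'a list" where
  "segment a ptr t = map a [ptr t..<ptr (Suc t)]"

definition encodes :: "pricing \<Rightarrow> memory \<Rightarrow> bool" where
  "encodes P m \<longleftrightarrow>
     nmem m ''horizon'' 0 = horizon P \<and>
     nmem m ''num_nodes'' 0 = card (verts (net P)) \<and>
     bij_betw (nmem m ''node'') {..<card (verts (net P))} (verts (net P)) \<and>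
     (\<forall>e\<in>arcs (net P). nmem m ''tail'' e = tail (net P) e \<and> nmem m ''head'' e = head (net P) e) \<and>
     (\<forall>t\<in>{1..horizon P}.
        nmem m ''origin'' t = origin P t \<and> nmem m ''destination'' t = destination P t) \<and>
     nmem m ''ptr'' 1 = 0 \<and>
     (\<forall>t\<in>{1..horizon P}.
        nmem m ''ptr'' t \<le> nmem m ''ptr'' (Suc t) \<and>
        distinct (segment (nmem m ''arc'') (nmem m ''ptr'') t) \<and>
        set (segment (nmem m ''arc'') (nmem m ''ptr'') t) = arcs_at P t \<and>
        segment (rmem m ''dual'') (nmem m ''ptr'') t =
          map (dual P t) (segment (nmem m ''arc'') (nmem m ''ptr'') t)) \<and>
     rmem m ''demand'' 0 = demand P \<and>
     rmem m ''penalty'' 0 = penalty P \<and>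
     (\<forall>x. x \<notin> {''horizon'', ''num_nodes'', ''node'', ''tail'', ''head'', ''origin'',
            ''destination'', ''ptr'', ''arc''} \<longrightarrow> nmem m x = (\<lambda>_. 0)) \<and>
     (\<forall>x. x \<notin> {''dual'', ''demand'', ''penalty''} \<longrightarrow> rmem m x = (\<lambda>_. 0))"

definition returned :: "memory \<Rightarrow> nat \<Rightarrow> path" where
  "returned m t = (nmem m ''out_start'' t, segment (nmem m ''out_arc'') (nmem m ''out_ptr'') t)"

end

theory Submission
  imports Defs
begin

text \<open>
  The program is a dynamic program over the time steps at which the path changes. A path-sequence is
  a concatenation of intervals on each of which one path is kept, so with \<open>g (T + 1) = 0\<close> and
  
    \<open>g i = min\<close> over \<open>j \<ge> i\<close> of (penalty + cost of the best path valid throughout \<open>{i..j}\<close> + \<open>g (j + 1)\<close>)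
  
  the minimum cost is \<open>g 1\<close> minus one penalty, because no change is charged before the first interval.
  Two consecutive intervals may use the same path; then the recursion overestimates the cost of the
  sequence that it describes, which does no harm to a minimum (\<open>dp_lower_bound\<close>, \<open>dp_optimal\<close>).
  
  The best path for an interval is a shortest path between fixed end points in the network of the arcs
  common to all its time steps, where an arc weighs the sum of \<open>- demand * dual\<close> over the interval.
  These weights are nonnegative, so Dijkstra's algorithm finds it, and simple paths suffice
  (\<open>valid_on_interval\<close>, \<open>dijkstra_final\<close>). For a fixed \<open>i\<close> the intervals are extended one time step
  at a time: whether an arc is still common, and its weight, are updated by scanning the arcs of the
  new time step only (\<open>run_scan_arcs\<close>).
  
  There are at most \<open>T\<^sup>2\<close> intervals. One run of Dijkstra's algorithm settles each node once and relaxes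
  each arc once, and each of these steps repairs a tournament tree of logarithmic depth, which takes
  time \<open>O((|V| + |E|) ln |V|)\<close> (\<open>run_replay\<close>, \<open>run_dijkstra\<close>). Everything else, including the copying
  of paths, takes \<open>O(|V| + |E|)\<close> per interval. As \<open>|V| = O(|E|)\<close>, the bound follows.
  
  Programs are verified with a total correctness judgement that includes a bound on the number of
  operations; loops are charged to a potential of a ghost state (\<open>run_Loop\<close>).
\<close>

section \<open>Total correctness with a time bound\<close>

text \<open>
  The numeric constants in the time bounds below are rounded up freely; only the order of growth
  matters.
\<close>

definition run :: "com \<Rightarrow> memory \<Rightarrow> nat \<Rightarrow> (memory \<Rightarrow> bool) \<Rightarrow> bool" where
  "run c m k Q \<longleftrightarrow> (\<exists>n m'. exec c m n m' \<and> n \<le> k \<and> Q m')"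

lemma run_mono:
  assumes "run c m k Q" "k \<le> k'" "\<And>m'. Q m' \<Longrightarrow> Q' m'"
  shows "run c m k' Q'"
  using assms unfolding run_def by (meson le_trans)

lemma run_Skip: "1 \<le> k \<Longrightarrow> Q m \<Longrightarrow> run Skip m k Q"
  unfolding run_def using exec.Skip by blast

lemma run_NWrite:
  "1 + ncost i + ncost a \<le> k \<Longrightarrow> Q (nwrite x (nval i m) (nval a m) m) \<Longrightarrow> run (NWrite x i a) m k Q"
  unfolding run_def using exec.NWrite by blast

lemma run_RWrite:
  "1 + ncost i + rcost a \<le> k \<Longrightarrow> Q (rwrite x (nval i m) (rval a m) m) \<Longrightarrow> run (RWrite x i a) m k Q"
  unfolding run_def using exec.RWrite by blast

lemma run_Then:
  assumes "run c1 m k1 (\<lambda>m1. run c2 m1 k2 Q)" "k1 + k2 \<le> k"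
  shows "run (Then c1 c2) m k Q"
  using assms unfolding run_def by (meson add_mono exec.Then le_trans)

text \<open>
  Charging a write exactly lets the remaining budget of a chain of writes be computed instead of
  guessed.
\<close>

lemma run_NWrite_Then:
  assumes "1 + ncost i + ncost a \<le> k"
    and "run c (nwrite x (nval i m) (nval a m) m) (k - (1 + ncost i + ncost a)) Q"
  shows "run (Then (NWrite x i a) c) m k Q"
  by (rule run_Then[OF run_NWrite[OF order_refl]]) (use assms in auto)

lemma run_RWrite_Then:
  assumes "1 + ncost i + rcost a \<le> k"
    and "run c (rwrite x (nval i m) (rval a m) m) (k - (1 + ncost i + rcost a)) Q"
  shows "run (Then (RWrite x i a) c) m k Q"
  by (rule run_Then[OF run_RWrite[OF order_refl]]) (use assms in auto)

lemma run_Cond: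
  assumes "bval b m \<Longrightarrow> run c1 m k Q" "\<not> bval b m \<Longrightarrow> run c2 m k Q" "1 + bcost b + k \<le> k'"
  shows "run (Cond b c1 c2) m k' Q"
proof (cases "bval b m")
  case True
  then obtain n m' where "exec c1 m n m'" "n \<le> k" "Q m'"
    using assms(1) unfolding run_def by blast
  with True assms(3) show ?thesis
    unfolding run_def by (intro exI[of _ "1 + bcost b + n"] exI[of _ m']) (simp add: exec.CondTrue[simplified])
next
  case False
  then obtain n m' where "exec c2 m n m'" "n \<le> k" "Q m'"
    using assms(2) unfolding run_def by blast
  with False assms(3) show ?thesis
    unfolding run_def by (intro exI[of _ "1 + bcost b + n"] exI[of _ m']) (simp add: exec.CondFalse[simplified])
qed

subsection \<open>Frames\<close>

fun nmod :: "com \<Rightarrow> string set" where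
  "nmod Skip = {}"
| "nmod (NWrite x i a) = {x}"
| "nmod (RWrite x i a) = {}"
| "nmod (Then c1 c2) = nmod c1 \<union> nmod c2"
| "nmod (Cond b c1 c2) = nmod c1 \<union> nmod c2"
| "nmod (Loop b c) = nmod c"

fun rmod :: "com \<Rightarrow> string set" where
  "rmod Skip = {}"
| "rmod (NWrite x i a) = {}"
| "rmod (RWrite x i a) = {x}"
| "rmod (Then c1 c2) = rmod c1 \<union> rmod c2"
| "rmod (Cond b c1 c2) = rmod c1 \<union> rmod c2"
| "rmod (Loop b c) = rmod c"

definition frame :: "com \<Rightarrow> memory \<Rightarrow> memory \<Rightarrow> bool" where
  "frame c m m' \<longleftrightarrow> (\<forall>x. x \<notin> nmod c \<longrightarrow> nmem m' x = nmem m x) \<and> (\<forall>x. x \<notin> rmod c \<longrightarrow> rmem m' x = rmem m x)"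

lemma mem_simps [simp]:
  "nmem (nwrite x i n m) y = (if y = x then (nmem m x)(i := n) else nmem m y)"
  "rmem (nwrite x i n m) y = rmem m y"
  "nmem (rwrite x i r m) y = nmem m y"
  "rmem (rwrite x i r m) y = (if y = x then (rmem m x)(i := r) else rmem m y)"
  by (auto simp: nwrite_def rwrite_def)

text \<open>
  Which arrays a program can change is visible in its text. Loop invariants therefore only mention the
  arrays that the loop writes to; everything else is carried along by the frame.
\<close>

lemma exec_frame: "exec c m n m' \<Longrightarrow> frame c m m'"
  unfolding frame_def by (induction rule: exec.induct) auto

lemma frame_refl: "frame c m m"
  by (simp add: frame_def)

lemma frame_trans:
  "frame c m m' \<Longrightarrow> frame c' m' m'' \<Longrightarrow> nmod c' \<subseteq> nmod c \<Longrightarrow> rmod c' \<subseteq> rmod c \<Longrightarrow> frame c m m''"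
  unfolding frame_def by (metis subsetD)

lemma run_frame:
  assumes "run c m k Q" "\<And>m'. Q m' \<Longrightarrow> frame c m m' \<Longrightarrow> Q' m'"
  shows "run c m k Q'"
  using assms unfolding run_def by (meson exec_frame)

lemma frameD:
  "frame c m m' \<Longrightarrow> x \<notin> nmod c \<Longrightarrow> nmem m' x = nmem m x"
  "frame c m m' \<Longrightarrow> x \<notin> rmod c \<Longrightarrow> rmem m' x = rmem m x"
  by (auto simp: frame_def)

lemma run_seq:
  assumes "run c1 m k1 Q1" "\<And>m1. Q1 m1 \<Longrightarrow> frame c1 m m1 \<Longrightarrow> run c2 m1 k2 Q" "k1 + k2 \<le> k"
  shows "run (Then c1 c2) m k Q"
  by (rule run_Then[OF run_frame[OF assms(1)] assms(3)]) (rule assms(2))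

subsection \<open>Loops\<close>

text \<open>
  The ghost state \<open>g\<close> carries the potential \<open>\<phi> g\<close>, from which each round pays for itself. A round
  costs at least one unit, so the potential also is the termination measure. Rounds of very
  different length, as in the amortized analysis of Dijkstra's algorithm, are covered because
  the budget \<open>k\<close> of a round may depend on the state.
\<close>

lemma run_Loop:
  assumes init: "I g m"
    and step: "\<And>g m'. I g m' \<Longrightarrow> frame c m m' \<Longrightarrow> bval b m' \<Longrightarrow>
      \<exists>k. run c m' k (\<lambda>m''. \<exists>g'. I g' m'' \<and> \<phi> g' + k + 1 + bcost b \<le> \<phi> g)"
    and exit: "\<And>g m'. I g m' \<Longrightarrow> frame c m m' \<Longrightarrow> \<not> bval b m' \<Longrightarrow> Q m'"
    and K: "\<phi> g + 1 + bcost b \<le> K"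
  shows "run (Loop b c) m K Q"
proof -
  have "run (Loop b c) m1 (\<phi> g + 1 + bcost b) Q" if "I g m1" "frame c m m1" for g m1
    using that
  proof (induction "\<phi> g" arbitrary: g m1 rule: less_induct)
    case less
    show ?case
    proof (cases "bval b m1")
      case False
      then have "exec (Loop b c) m1 (1 + bcost b) m1" by (rule exec.LoopFalse)
      then show ?thesis
        unfolding run_def using exit[OF less.prems False]
        by (intro exI[of _ "1 + bcost b"] exI[of _ m1]) auto
    next
      case True
      from step[OF less.prems True] obtain k n m' g' where 1: "exec c m1 n m'" "n \<le> k" "I g' m'"
        "\<phi> g' + k + 1 + bcost b \<le> \<phi> g" unfolding run_def by blast
      have "run (Loop b c) m' (\<phi> g' + 1 + bcost b) Q"
        by (rule less.hyps) (use 1 less.prems frame_trans[OF _ exec_frame] in auto)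
      then obtain n2 m2 where 2: "exec (Loop b c) m' n2 m2" "n2 \<le> \<phi> g' + 1 + bcost b" "Q m2"
        unfolding run_def by blast
      have "exec (Loop b c) m1 (1 + bcost b + n + n2) m2"
        by (rule exec.LoopTrue[OF True 1(1) 2(1)])
      moreover have "1 + bcost b + n + n2 \<le> \<phi> g + 1 + bcost b" using 1 2 by simp
      ultimately show ?thesis unfolding run_def using 2 by blast
    qed
  qed
  from this[OF init frame_refl] show ?thesis by (rule run_mono) (rule K)
qed

text \<open>
  For rounds whose next ghost state is known before they are executed.
\<close>

lemma run_round:
  "run c m k (I g') \<Longrightarrow> \<phi> g' + k + 1 + bcost b \<le> \<phi> g \<Longrightarrow>
    \<exists>k. run c m k (\<lambda>m'. \<exists>g'. I g' m' \<and> \<phi> g' + k + 1 + bcost b \<le> \<phi> g)"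
  by (blast intro: run_mono)

subsection \<open>Counting loops\<close>

abbreviation scalar :: "string \<Rightarrow> nexp" where
  "scalar x \<equiv> NRead x (NConst 0)"

definition For :: "string \<Rightarrow> nexp \<Rightarrow> nexp \<Rightarrow> com \<Rightarrow> com" where
  "For x lo hi c =
     Then (NWrite x (NConst 0) lo)
       (Loop (NLess (scalar x) hi) (Then c (NWrite x (NConst 0) (NAdd (scalar x) (NConst 1)))))"

lemma nmod_For [simp]: "nmod (For x lo hi c) = insert x (nmod c)"
  and rmod_For [simp]: "rmod (For x lo hi c) = rmod c"
  by (auto simp: For_def)

lemma run_For:
  assumes init: "I (nval lo m) (nwrite x 0 (nval lo m) m)"
    and le: "nval lo m \<le> h"
    and hi: "\<And>i m'. I i m' \<Longrightarrow> frame (For x lo hi c) m m' \<Longrightarrow> nval hi m' = h"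
    and x: "x \<notin> nmod c"
    and step: "\<And>i m'. nval lo m \<le> i \<Longrightarrow> i < h \<Longrightarrow> nmem m' x 0 = i \<Longrightarrow> I i m' \<Longrightarrow>
      frame (For x lo hi c) m m' \<Longrightarrow> run c m' k (\<lambda>m''. I (Suc i) (nwrite x 0 (Suc i) m''))"
    and exit: "\<And>m'. I h m' \<Longrightarrow> frame (For x lo hi c) m m' \<Longrightarrow> Q m'"
    and K: "(h - nval lo m) * (k + 10 + ncost hi) + 6 + ncost lo + ncost hi \<le> K"
  shows "run (For x lo hi c) m K Q"
proof -
  let ?a = "nval lo m" and ?B = "NLess (scalar x) hi"
  let ?c = "Then c (NWrite x (NConst 0) (NAdd (scalar x) (NConst 1)))"
  let ?\<phi> = "\<lambda>i. (h - i) * (k + 10 + ncost hi)"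
  let ?m = "nwrite x 0 ?a m"
  have fr: "frame (For x lo hi c) m m'" if "frame ?c ?m m'" for m'
    using that by (auto simp: frame_def For_def)
  let ?J = "\<lambda>i m. ?a \<le> i \<and> i \<le> h \<and> nmem m x 0 = i \<and> I i m"
  have "run (Loop ?B ?c) (nwrite x 0 ?a m) (?\<phi> ?a + 1 + bcost ?B) Q"
  proof (rule run_Loop[where I = ?J and \<phi> = ?\<phi> and g = ?a])
    show "?J ?a (nwrite x 0 ?a m)" using init le by simp
  next
    fix i m' assume J: "?J i m'" and f: "frame ?c ?m m'" and b: "\<not> bval ?B m'"
    then have "i = h" using hi[OF _ fr] by auto
    with J show "Q m'" using exit fr[OF f] by blast
  next
    fix i m'
    assume J: "?J i m'" and f: "frame ?c ?m m'" and b: "bval ?B m'"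
    then have ih: "i < h" using hi[OF _ fr] by auto
    have *: "run c m' k (\<lambda>m''. nmem m'' x 0 = i \<and> I (Suc i) (nwrite x 0 (Suc i) m''))"
      by (rule run_frame[OF step]) (use J ih x fr[OF f] in \<open>auto simp: frameD\<close>)
    have "run ?c m' (k + 6) (\<lambda>m''. ?J (Suc i) m'')"
    proof (rule run_Then[where ?k1.0 = k and ?k2.0 = 6])
      show "run c m' k (\<lambda>m1. run (NWrite x (NConst 0) (NAdd (scalar x) (NConst 1))) m1 6 (?J (Suc i)))"
        by (rule run_mono[OF *]) (use J ih in \<open>auto intro!: run_NWrite\<close>)
    qed simp
    moreover have "?\<phi> (Suc i) + (k + 6) + 1 + bcost ?B \<le> ?\<phi> i"
    proof -
      have "h - i = Suc (h - Suc i)" using ih by simp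
      then show ?thesis by (simp del: mult_Suc_right)
    qed
    ultimately show "\<exists>k'. run ?c m' k' (\<lambda>m'. \<exists>g'. ?J g' m' \<and> ?\<phi> g' + k' + 1 + bcost ?B \<le> ?\<phi> i)"
      by (intro exI[of _ "k + 6"]) (auto elim!: run_mono)
  qed simp
  then show ?thesis
    unfolding For_def
    by (intro run_NWrite_Then) (use K in \<open>auto elim!: run_mono\<close>)
qed

section \<open>Tournament trees\<close>

text \<open>
  The priority queue is a tournament among all nodes, active or not. Its matches are numbered
  \<open>1, \<dots>, n - 1\<close>, the players sit at \<open>n, \<dots>, 2 n - 1\<close>, and the winner of position \<open>x\<close> proceeds to the
  match \<open>x div 2\<close>. This works for every \<open>n\<close>, because halving a positive number repeatedly always ends
  at 1. A change of one priority is repaired by replaying the matches above one leaf, and both raising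
  and lowering a priority are the same operation.
\<close>

definition ancestors :: "nat \<Rightarrow> nat set" where
  "ancestors x = {x div 2 ^ k | k. 0 < k}"

lemma ancestors_rec: "z \<in> ancestors x \<longleftrightarrow> z = x div 2 \<or> z \<in> ancestors (x div 2)"
proof
  assume "z \<in> ancestors x"
  then obtain k where "z = x div 2 ^ Suc k" unfolding ancestors_def by (auto dest: gr0_implies_Suc)
  then have z: "z = x div 2 div 2 ^ k" by (simp add: div_mult2_eq)
  show "z = x div 2 \<or> z \<in> ancestors (x div 2)"
  proof (cases "k = 0")
    case False
    with z show ?thesis unfolding ancestors_def by blast
  qed (simp add: z)
next
  have "x div 2 div 2 ^ k = x div 2 ^ Suc k" for k by (simp add: div_mult2_eq)
  then have "x div 2 div 2 ^ k \<in> ancestors x" for k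
    unfolding ancestors_def by blast
  from this[of 0] this show "z = x div 2 \<or> z \<in> ancestors (x div 2) \<Longrightarrow> z \<in> ancestors x"
    unfolding ancestors_def[of "x div 2"] by auto
qed

lemma ancestors_child:
  assumes "x div 2 = z" "x = y \<or> x \<in> ancestors y"
  shows "z \<in> ancestors y"
  using assms(2)
proof
  assume "x \<in> ancestors y"
  then obtain k where k: "x = y div 2 ^ k" "0 < k" unfolding ancestors_def by blast
  have "y div 2 ^ Suc k = y div 2 ^ k div 2" by (simp only: power_Suc2 div_mult2_eq)
  with k assms(1) show ?thesis unfolding ancestors_def by (intro CollectI exI[of _ "Suc k"]) simp
qed (use assms(1) ancestors_rec in blast)

text \<open>
  The players at the leaves never change; a player leaves the competition by getting priority 0.
\<close>

definition leaves :: "nat set \<Rightarrow> (nat \<Rightarrow> nat) \<Rightarrow> (nat \<Rightarrow> nat) \<Rightarrow> bool" where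
  "leaves V leaf win \<longleftrightarrow>
     (\<forall>v\<in>V. leaf v \<in> {card V..<card V + card V} \<and> win (leaf v) = v) \<and>
     (\<forall>x\<in>{card V..<card V + card V}. win x \<in> V \<and> leaf (win x) = x)"

definition played :: "(nat \<Rightarrow> nat) \<Rightarrow> (nat \<Rightarrow> real) \<Rightarrow> nat \<Rightarrow> bool" where
  "played win pr x \<longleftrightarrow>
     (win x = win (x + x) \<or> win x = win (x + x + 1)) \<and>
     pr (win (x + x)) \<le> pr (win x) \<and> pr (win (x + x + 1)) \<le> pr (win x)"

definition tournament :: "nat set \<Rightarrow> (nat \<Rightarrow> nat) \<Rightarrow> (nat \<Rightarrow> nat) \<Rightarrow> (nat \<Rightarrow> real) \<Rightarrow> bool" where
  "tournament V leaf win pr \<longleftrightarrow> leaves V leaf win \<and> (\<forall>x\<in>{1..<card V}. played win pr x)"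

lemma leaves_upd: "leaves V leaf win \<Longrightarrow> x < card V \<Longrightarrow> leaves V leaf (win(x := w))"
  unfolding leaves_def by auto

text \<open>
  Whoever wins a match has come up from its own leaf. This localizes the effect of a priority change.
\<close>

lemma tournament_winner:
  assumes "tournament V leaf win pr" "x \<in> {1..<card V + card V}"
  shows "win x \<in> V \<and> (x = leaf (win x) \<or> x \<in> ancestors (leaf (win x)))"
  using assms(2)
proof (induction "card V + card V - x" arbitrary: x rule: less_induct)
  case less
  show ?case
  proof (cases "x < card V")
    case False
    then show ?thesis using less.prems assms(1) unfolding tournament_def leaves_def by simp
  next
    case True
    then have "played win pr x"
      using less.prems assms(1) unfolding tournament_def by simp
    then obtain y where y: "win x = win y" "y = x + x \<or> y = x + x + 1"
      unfolding played_def by blast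
    then have "y div 2 = x" by auto
    moreover have "win y \<in> V \<and> (y = leaf (win y) \<or> y \<in> ancestors (leaf (win y)))"
      by (rule less.hyps) (use y True less.prems in auto)
    ultimately show ?thesis using y(1) ancestors_child by metis
  qed
qed

lemma champion:
  assumes "tournament V leaf win pr" "v \<in> V"
  shows "pr v \<le> pr (win 1)" "win 1 \<in> V"
proof -
  have *: "pr (win x) \<le> pr (win 1)" if "x \<in> {1..<card V + card V}" for x
    using that
  proof (induction x rule: less_induct)
    case (less x)
    show ?case
    proof (cases "x = 1")
      case False
      have "x div 2 \<in> {1..<card V}" "x = x div 2 + x div 2 \<or> x = x div 2 + x div 2 + 1" "x div 2 < x"
        using False less.prems by auto
      then obtain y where y: "y \<in> {1..<card V}" "x = y + y \<or> x = y + y + 1" "y < x" by blast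
      then have "played win pr y" using assms(1) unfolding tournament_def by blast
      with y(2) have "pr (win x) \<le> pr (win y)" unfolding played_def by auto
      also have "\<dots> \<le> pr (win 1)" by (rule less.IH) (use y in auto)
      finally show ?thesis .
    qed simp
  qed
  have v: "leaf v \<in> {card V..<card V + card V}" "win (leaf v) = v"
    using assms unfolding tournament_def leaves_def by auto
  then show "pr v \<le> pr (win 1)" using *[of "leaf v"]
    by (cases "card V = 0") auto
  show "win 1 \<in> V" by (rule tournament_winner[THEN conjunct1, OF assms(1)]) (use v in auto)
qed

text \<open>
  Only matches on the way from the leaf of \<open>v\<close> to the root can involve \<open>v\<close>, so these are the
  only matches that a change of the priority of \<open>v\<close> can spoil.
\<close>

lemma played_except_ancestors:
  assumes "tournament V leaf win pr" "x \<in> {1..<card V}" "x \<notin> ancestors (leaf v)"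
  shows "played win (pr(v := r)) x"
proof -
  have sub: "win y \<noteq> v" if "y = x + x \<or> y = x + x + 1" for y
  proof -
    have "y div 2 = x" "y \<in> {1..<card V + card V}" using that assms(2) by auto
    then show ?thesis
      using tournament_winner[OF assms(1), of y] assms(3) ancestors_child[of y x "leaf v"] by metis
  qed
  have x: "played win pr x" using assms(1,2) unfolding tournament_def by blast
  then have "win x \<noteq> v" using sub unfolding played_def by metis
  with x show ?thesis using sub[of "x + x"] sub[of "x + x + 1"] unfolding played_def by simp
qed

text \<open>
  The machine cannot divide, so the numbers of the parents are tabulated.
\<close>

definition halves :: "nat set \<Rightarrow> (nat \<Rightarrow> nat) \<Rightarrow> bool" where
  "halves V half \<longleftrightarrow> (\<forall>x<card V + card V. half x = x div 2)"

abbreviation (input) left_child :: nexp where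
  "left_child \<equiv> NAdd (scalar ''x'') (scalar ''x'')"

abbreviation (input) right_child :: nexp where
  "right_child \<equiv> NAdd (NAdd (scalar ''x'') (scalar ''x'')) (NConst 1)"

definition replay_match :: com where
  "replay_match =
     Then (NWrite ''x'' (NConst 0) (NRead ''half'' (scalar ''x'')))
       (Cond (RLess (RRead ''pr'' (NRead ''win'' left_child)) (RRead ''pr'' (NRead ''win'' right_child)))
         (NWrite ''win'' (scalar ''x'') (NRead ''win'' right_child))
         (NWrite ''win'' (scalar ''x'') (NRead ''win'' left_child)))"

definition replay :: "nexp \<Rightarrow> com" where
  "replay v =
     Then (NWrite ''x'' (NConst 0) (NRead ''leaf'' v))
       (Loop (NLess (NConst 1) (scalar ''x'')) replay_match)"

lemma mod_replay [simp]: "nmod (replay v) = {''x'', ''win''}" "rmod (replay v) = {}"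
  by (auto simp: replay_def replay_match_def)

lemma play_match:
  assumes "w = win (x + x) \<or> w = win (x + x + 1)"
    and "pr (win (x + x)) \<le> pr w" "pr (win (x + x + 1)) \<le> pr w" "1 \<le> x"
    and "z \<noteq> x \<Longrightarrow> played win pr z" "z \<notin> ancestors x"
  shows "played (win(x := w)) pr z"
proof (cases "z = x")
  case True
  have "x + x \<noteq> x" "x + x + 1 \<noteq> x" using assms(4) by simp_all
  then show ?thesis using assms(1-3) True unfolding played_def by simp
next
  case False
  have "z \<in> ancestors (z + z)" "z \<in> ancestors (z + z + 1)"
    by (subst ancestors_rec, simp)+
  then have "z + z \<noteq> x" "z + z + 1 \<noteq> x" using assms(6) by blast+
  with False assms(5) show ?thesis unfolding played_def by simp
qed

text \<open>
  An index below \<open>2 ^ L\<close> is halved fewer than \<open>L\<close> times until it is 1. In between, every match except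
  those above the current position has been played correctly.
\<close>

lemma run_replay:
  fixes V m
  defines "pr \<equiv> rmem m ''pr''"
  assumes leaves: "leaves V (nmem m ''leaf'') (nmem m ''win'')"
    and half: "halves V (nmem m ''half'')"
    and v: "nval v m \<in> V" and L: "card V + card V \<le> 2 ^ L"
    and except: "\<And>x. x \<in> {1..<card V} \<Longrightarrow> x \<notin> ancestors (nmem m ''leaf'' (nval v m)) \<Longrightarrow>
      played (nmem m ''win'') pr x"
    and K: "40 * L + ncost v + 10 \<le> K"
  shows "run (replay v) m K (\<lambda>m'. tournament V (nmem m ''leaf'') (nmem m' ''win'') pr)"
proof -
  let ?leaf = "nmem m ''leaf''" and ?half = "nmem m ''half''"
  let ?m = "nwrite ''x'' 0 (?leaf (nval v m)) m"
  define I where "I = (\<lambda>k (m'::memory). nmem m' ''half'' = ?half \<and> rmem m' ''pr'' = pr \<and>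
    leaves V ?leaf (nmem m' ''win'') \<and>
    nmem m' ''x'' 0 \<in> {1..<card V + card V} \<and> nmem m' ''x'' 0 < 2 ^ k \<and>
    (\<forall>z\<in>{1..<card V}. z \<notin> ancestors (nmem m' ''x'' 0) \<longrightarrow> played (nmem m' ''win'') pr z))"
  have leafv: "?leaf (nval v m) \<in> {card V..<card V + card V}" "card V \<noteq> 0"
    using leaves v unfolding leaves_def by auto
  have "run (Loop (NLess (NConst 1) (scalar ''x'')) replay_match)
      ?m (40 * L + 5)
      (\<lambda>m'. tournament V ?leaf (nmem m' ''win'') pr)"
  proof (rule run_Loop[where I = I and g = L and \<phi> = "\<lambda>k. 40 * k"])
    show "I L ?m"
    proof -
      let ?l = "?leaf (nval v m)"
      have "?l \<in> {1..<card V + card V}" "?l < 2 ^ L" using leafv L by auto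
      then show ?thesis
        unfolding I_def using leaves except by (simp add: pr_def)
    qed
  next
    fix k m' assume I: "I k m'" and "frame replay_match ?m m'" and "\<not> bval (NLess (NConst 1) (scalar ''x'')) m'"
    then have "nmem m' ''x'' 0 = 1" unfolding I_def by simp
    moreover have "z \<notin> ancestors 1" if "1 \<le> z" for z :: nat
    proof
      assume "z \<in> ancestors 1"
      then obtain k where k: "z = 1 div 2 ^ k" "0 < k" unfolding ancestors_def by blast
      have "(1::nat) < 2 ^ k" using k(2) by (intro one_less_power) simp_all
      with that k(1) show False by simp
    qed
    ultimately show "tournament V ?leaf (nmem m' ''win'') pr"
      using I unfolding I_def tournament_def by simp
  next
    fix k m'
    assume I: "I k m'" and "frame replay_match ?m m'" and b: "bval (NLess (NConst 1) (scalar ''x'')) m'"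
    let ?x = "nmem m' ''x'' 0" let ?y = "?x div 2" let ?win = "nmem m' ''win''"
    have x: "?x < card V + card V" "?x < 2 ^ k" "1 < ?x" using I b by (simp_all add: I_def)
    then have y: "?y \<in> {1..<card V}" by auto
    obtain k' where k: "k = Suc k'" using x by (cases k) auto
    have yk: "?y < 2 ^ k'" using x k by (simp add: less_mult_imp_div_less mult.commute)
    have h: "nmem m' ''half'' ?x = ?y" using I half x unfolding halves_def I_def by simp
    have played: "played ?win pr z" if "z \<in> {1..<card V}" "z \<noteq> ?y" "z \<notin> ancestors ?y" for z
      using I that ancestors_rec[of z ?x] unfolding I_def by blast
    let ?l = "pr (?win (?y + ?y))" and ?r = "pr (?win (?y + ?y + 1))"
    have step: "I k' (nwrite ''win'' ?y w (nwrite ''x'' 0 ?y m'))"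
      if w: "w = ?win (?y + ?y) \<or> w = ?win (?y + ?y + 1)" "?l \<le> pr w" "?r \<le> pr w" for w
    proof -
      have "played (?win(?y := w)) pr z" if "z \<in> {1..<card V}" "z \<notin> ancestors ?y" for z
        by (rule play_match[OF w]) (use y that played in auto)
      moreover have "leaves V ?leaf (?win(?y := w))"
        by (rule leaves_upd) (use I y in \<open>auto simp: I_def\<close>)
      ultimately show ?thesis using I y yk x unfolding I_def by simp
    qed
    have pr: "rmem m' ''pr'' = pr" using I by (simp add: I_def)
    have "run replay_match m' 34 (I k')"
      unfolding replay_match_def
      using h pr step[of "?win (?y + ?y)"] step[of "?win (?y + ?y + 1)"]
      by (intro run_NWrite_Then run_Cond[where k = 11] run_NWrite) simp_all
    then show "\<exists>c. run replay_match m' c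
        (\<lambda>m''. \<exists>k'. I k' m'' \<and> 40 * k' + c + 1 + bcost (NLess (NConst 1) (scalar ''x'')) \<le> 40 * k)"
      by (rule run_round) (use k in auto)
  qed simp
  then show ?thesis unfolding replay_def
    by (intro run_NWrite_Then) (use K in \<open>auto elim!: run_mono\<close>)
qed

section \<open>Dijkstra's algorithm\<close>

subsection \<open>The invariant\<close>

locale shortest_paths = fin_digraph H for H :: "(nat, nat) pre_digraph" +
  fixes w :: "nat \<Rightarrow> real" and target :: nat
  assumes weight_nonneg: "e \<in> arcs H \<Longrightarrow> 0 \<le> w e"
    and target_vert: "target \<in> verts H"
begin

abbreviation length_of :: "nat list \<Rightarrow> real" where
  "length_of es \<equiv> sum_list (map w es)"

text \<open>
  \<open>S\<close> is the set of settled nodes, \<open>R\<close> that of the reached ones, and \<open>todo\<close> are the arcs into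
  settled nodes that have not been relaxed yet. Settled nodes carry a simple path along the \<open>nx\<close>
  arcs; it stays inside \<open>S\<close>, so that a newly settled node can be put in front of it.
\<close>

definition dijkstra_inv ::
    "nat set \<Rightarrow> nat set \<Rightarrow> nat set \<Rightarrow> (nat \<Rightarrow> real) \<Rightarrow> (nat \<Rightarrow> nat) \<Rightarrow> bool" where
  "dijkstra_inv S R todo d nx \<longleftrightarrow>
     S \<subseteq> R \<and> R \<subseteq> verts H \<and> target \<in> R \<and> d target = 0 \<and> (\<forall>v\<in>R. 0 \<le> d v) \<and>
     (\<forall>v\<in>R - {target}. nx v \<in> arcs H \<and> tail H (nx v) = v \<and> head H (nx v) \<in> S \<and>
        d v = w (nx v) + d (head H (nx v))) \<and>
     (\<forall>v\<in>S. \<exists>es. apath v es target \<and> set (awalk_verts v es) \<subseteq> S \<and>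
        (\<forall>e\<in>set es. nx (tail H e) = e) \<and> length_of es = d v) \<and>
     (\<forall>e\<in>arcs H. head H e \<in> S \<and> e \<notin> todo \<longrightarrow>
        tail H e \<in> R \<and> d (tail H e) \<le> w e + d (head H e)) \<and>
     (\<forall>v\<in>S. \<forall>u\<in>R - S. d v \<le> d u)"

lemma dijkstra_invD:
  assumes "dijkstra_inv S R todo d nx"
  shows "S \<subseteq> R" "R \<subseteq> verts H" "target \<in> R" "d target = 0"
    and "v \<in> R \<Longrightarrow> 0 \<le> d v"
    and "v \<in> R \<Longrightarrow> v \<noteq> target \<Longrightarrow> nx v \<in> arcs H \<and> tail H (nx v) = v \<and> head H (nx v) \<in> S \<and>
        d v = w (nx v) + d (head H (nx v))"
    and "v \<in> S \<Longrightarrow> \<exists>es. apath v es target \<and> set (awalk_verts v es) \<subseteq> S \<and>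
        (\<forall>e\<in>set es. nx (tail H e) = e) \<and> length_of es = d v"
    and "e \<in> arcs H \<Longrightarrow> head H e \<in> S \<Longrightarrow> e \<notin> todo \<Longrightarrow>
        tail H e \<in> R \<and> d (tail H e) \<le> w e + d (head H e)"
    and "v \<in> S \<Longrightarrow> u \<in> R \<Longrightarrow> u \<notin> S \<Longrightarrow> d v \<le> d u"
  using assms unfolding dijkstra_inv_def by simp_all

lemma dijkstra_start:
  "d target = 0 \<Longrightarrow> dijkstra_inv {} {target} {} d nx"
  using target_vert by (auto simp: dijkstra_inv_def)

lemma dijkstra_settle:
  assumes inv: "dijkstra_inv S R {} d nx" and v: "v \<in> R" "v \<notin> S"
    and min: "\<And>u. u \<in> R \<Longrightarrow> u \<notin> S \<Longrightarrow> d v \<le> d u"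
  shows "dijkstra_inv (insert v S) R {e \<in> arcs H. head H e = v} d nx"
proof -
  note I = dijkstra_invD[OF inv]
  have new: "\<exists>es. apath v es target \<and> set (awalk_verts v es) \<subseteq> insert v S \<and>
    (\<forall>e\<in>set es. nx (tail H e) = e) \<and> length_of es = d v"
  proof (cases "v = target")
    case True
    then show ?thesis using I(4) by (intro exI[of _ "[]"]) (simp add: apath_Nil_iff target_vert)
  next
    case False
    let ?e = "nx v" let ?u = "head H ?e"
    have e: "?e \<in> arcs H" "tail H ?e = v" "?u \<in> S" "d v = w ?e + d ?u"
      using I(6)[OF v(1) False] by simp_all
    obtain es where es: "apath ?u es target" "set (awalk_verts ?u es) \<subseteq> S"
      "\<forall>e\<in>set es. nx (tail H e) = e" "length_of es = d ?u" using I(7)[OF e(3)] by blast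
    have "v \<notin> set (awalk_verts ?u es)" using es(2) v(2) by blast
    then have "apath v (?e # es) target"
      unfolding apath_Cons_iff using e es(1) by simp
    then show ?thesis using e es by (intro exI[of _ "?e # es"]) auto
  qed
  have old: "\<exists>es. apath u es target \<and> set (awalk_verts u es) \<subseteq> insert v S \<and>
    (\<forall>e\<in>set es. nx (tail H e) = e) \<and> length_of es = d u" if "u \<in> S" for u
    using I(7)[OF that] by blast
  show ?thesis
    unfolding dijkstra_inv_def
  proof (intro conjI ballI impI)
    fix u u' assume "u \<in> insert v S" "u' \<in> R - insert v S"
    then show "d u \<le> d u'" using I(9)[of u u'] min[of u'] by auto
  next
    fix u assume "u \<in> insert v S"
    then show "\<exists>es. apath u es target \<and> set (awalk_verts u es) \<subseteq> insert v S \<and>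
      (\<forall>e\<in>set es. nx (tail H e) = e) \<and> length_of es = d u"
      using new old by blast
  qed (use I v in auto)
qed

lemma dijkstra_relax_skip:
  assumes "dijkstra_inv S R todo d nx" "tail H e \<in> R" "d (tail H e) \<le> d (head H e) + w e"
  shows "dijkstra_inv S R (todo - {e}) d nx"
  using assms unfolding dijkstra_inv_def by (simp add: add.commute) blast

text \<open>
  The head of the arc has the largest distance among the settled nodes. As weights are nonnegative, an
  arc that improves its tail therefore has an unsettled tail, and neither the settled paths nor the
  constraints of the arcs into settled nodes can break.
\<close>

lemma dijkstra_relax:
  assumes inv: "dijkstra_inv S R todo d nx" and e: "e \<in> arcs H" "head H e \<in> S"
    and max: "\<And>u. u \<in> S \<Longrightarrow> d u \<le> d (head H e)"
    and less: "tail H e \<in> R \<Longrightarrow> d (head H e) + w e < d (tail H e)"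
  shows "tail H e \<notin> S"
    and "dijkstra_inv S (insert (tail H e) R) (todo - {e})
      (d(tail H e := d (head H e) + w e)) (nx(tail H e := e))"
proof -
  note I = dijkstra_invD[OF inv]
  let ?u = "tail H e" and ?nd = "d (head H e) + w e"
  have "0 \<le> d (head H e)" using I(1,5) e(2) by blast
  then have nd: "d (head H e) \<le> ?nd" "0 \<le> ?nd" using weight_nonneg[OF e(1)] by simp_all
  show u: "?u \<notin> S"
  proof
    assume "?u \<in> S"
    with max less I(1) have "d ?u \<le> d (head H e)" "?nd < d ?u" by blast+
    with nd show False by simp
  qed
  have ut: "?u \<noteq> target" using less nd I(3,4) by auto
  show "dijkstra_inv S (insert ?u R) (todo - {e}) (d(?u := ?nd)) (nx(?u := e))"
    unfolding dijkstra_inv_def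
  proof (intro conjI ballI impI)
    fix v assume v: "v \<in> insert ?u R - {target}"
    have "(nx(?u := e)) v \<in> arcs H \<and> tail H ((nx(?u := e)) v) = v \<and> head H ((nx(?u := e)) v) \<in> S \<and>
      (d(?u := ?nd)) v = w ((nx(?u := e)) v) + (d(?u := ?nd)) (head H ((nx(?u := e)) v))"
    proof (cases "v = ?u")
      case True
      have "head H e \<noteq> ?u" using e(2) u by metis
      with True e show ?thesis by simp
    next
      case False
      then have v': "v \<in> R" "v \<noteq> target" using v by simp_all
      have "head H (nx v) \<noteq> ?u" using I(6)[OF v'] u by metis
      with False I(6)[OF v'] show ?thesis by simp
    qed
    then show "(nx(?u := e)) v \<in> arcs H" "tail H ((nx(?u := e)) v) = v" "head H ((nx(?u := e)) v) \<in> S"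
      "(d(?u := ?nd)) v = w ((nx(?u := e)) v) + (d(?u := ?nd)) (head H ((nx(?u := e)) v))"
      by - (elim conjE, assumption)+
  next
    fix v assume v: "v \<in> S"
    obtain es where es: "apath v es target" "set (awalk_verts v es) \<subseteq> S"
      "\<forall>e\<in>set es. nx (tail H e) = e" "length_of es = d v" using I(7)[OF v] by blast
    have "tail H f \<noteq> ?u" if "f \<in> set es" for f
      using subsetD[OF es(2) awalk_verts_arc1[OF that]] u by metis
    then have "\<forall>f\<in>set es. (nx(?u := e)) (tail H f) = f" using es(3) by simp
    moreover have "v \<noteq> ?u" using u v by metis
    ultimately show "\<exists>es. apath v es target \<and> set (awalk_verts v es) \<subseteq> S \<and>
        (\<forall>f\<in>set es. (nx(?u := e)) (tail H f) = f) \<and> length_of es = (d(?u := ?nd)) v"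
      using es by (intro exI[of _ es]) simp
  next
    fix f assume f: "f \<in> arcs H" "head H f \<in> S \<and> f \<notin> todo - {e}"
    have hd: "(d(?u := ?nd)) (head H e) = d (head H e)" "(d(?u := ?nd)) (head H f) = d (head H f)"
      using u f e by (metis fun_upd_other)+
    have "tail H f \<in> insert ?u R \<and> (d(?u := ?nd)) (tail H f) \<le> w f + d (head H f)"
    proof (cases "f = e")
      case False
      then have f': "tail H f \<in> R" "d (tail H f) \<le> w f + d (head H f)" using I(8)[of f] f by simp_all
      show ?thesis
      proof (cases "tail H f = ?u")
        case True
        with f' less show ?thesis by simp
      qed (use f' in simp)
    qed simp
    with hd show "tail H f \<in> insert ?u R" "(d(?u := ?nd)) (tail H f) \<le> w f + (d(?u := ?nd)) (head H f)"
      by simp_all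
  next
    fix v v' assume "v \<in> S" "v' \<in> insert ?u R - S"
    then show "(d(?u := ?nd)) v \<le> (d(?u := ?nd)) v'"
      using I(9)[of v v'] max[of v] nd u by auto
  next
    fix v assume "v \<in> insert ?u R"
    then show "0 \<le> (d(?u := ?nd)) v" using nd I(5)[of v] by auto
  qed (use I ut e in auto)
qed

text \<open>
  Once every reached node is settled, all arcs into reached nodes have been relaxed, so the distances
  are a feasible potential, which bounds the length of every walk to the target from below.
\<close>

lemma dijkstra_final:
  assumes inv: "dijkstra_inv S S {} d nx" and "awalk v es target"
  shows "v \<in> S \<and> d v \<le> length_of es"
  using assms(2)
proof (induction es arbitrary: v)
  case Nil
  then show ?case using inv by (auto simp: awalk_Nil_iff dijkstra_inv_def)
next
  case (Cons e es)
  then have "e \<in> arcs H" "v = tail H e" "head H e \<in> S" "d (head H e) \<le> length_of es"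
    by (auto simp: awalk_Cons_iff)
  moreover from this have "tail H e \<in> S" "d (tail H e) \<le> w e + d (head H e)"
    using inv unfolding dijkstra_inv_def by auto
  ultimately show ?case by simp
qed

end

subsection \<open>The program\<close>

text \<open>
  The arcs into a node form a linked list. Arc \<open>e\<close> is represented by \<open>Suc e\<close>, and 0 ends the list.
\<close>

fun chain :: "(nat \<Rightarrow> nat) \<Rightarrow> nat \<Rightarrow> nat list \<Rightarrow> bool" where
  "chain f p [] \<longleftrightarrow> p = 0"
| "chain f p (e # es) \<longleftrightarrow> p = Suc e \<and> chain f (f e) es"

lemma chain_upd: "e \<notin> set es \<Longrightarrow> chain (f(e := p)) q es \<longleftrightarrow> chain f q es"
  by (induction es arbitrary: q) auto

text \<open>
  Distances are measured towards the node \<open>D\<close>, along the arcs into the settled nodes. The shortest path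
  can then be read off from its start to its end.
\<close>

definition improve :: com where
  "improve =
     Then (RWrite ''dist'' (scalar ''u'') (RRead ''nd'' (NConst 0)))
    (Then (RWrite ''bp'' (scalar ''u'') (RRead ''np'' (NConst 0)))
    (Then (RWrite ''pr'' (scalar ''u'') (RRead ''np'' (NConst 0)))
    (Then (NWrite ''succ'' (scalar ''u'') (scalar ''e''))
          (replay (scalar ''u'')))))"

definition relax :: com where
  "relax =
     Then (NWrite ''e'' (NConst 0) (NSub (scalar ''p'') (NConst 1)))
    (Then (NWrite ''u'' (NConst 0) (NRead ''tail'' (scalar ''e'')))
    (Then (NWrite ''p'' (NConst 0) (NRead ''next'' (scalar ''e'')))
    (Then (RWrite ''nd'' (NConst 0) (RAdd (RRead ''dist'' (scalar ''v'')) (RRead ''w'' (scalar ''e''))))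
    (Then (RWrite ''np'' (NConst 0) (RDiv (RConst 1) (RAdd (RConst 1) (RRead ''nd'' (NConst 0)))))
    (Cond (RLess (RRead ''bp'' (scalar ''u'')) (RRead ''np'' (NConst 0))) improve Skip)))))"

definition settle :: com where
  "settle =
     Then (NWrite ''v'' (NConst 0) (NRead ''win'' (NConst 1)))
    (Then (RWrite ''pr'' (scalar ''v'') (RConst 0))
    (Then (replay (scalar ''v''))
    (Then (NWrite ''p'' (NConst 0) (NRead ''first'' (scalar ''v'')))
    (Loop (NLess (NConst 0) (scalar ''p'')) relax))))"

definition dijkstra :: com where
  "dijkstra =
     Then (RWrite ''dist'' (scalar ''D'') (RConst 0))
    (Then (RWrite ''bp'' (scalar ''D'') (RConst 1))
    (Then (RWrite ''pr'' (scalar ''D'') (RConst 1))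
    (Then (replay (scalar ''D''))
    (Loop (RLess (RConst 0) (RRead ''pr'' (NRead ''win'' (NConst 1)))) settle))))"

lemma mod_relax [simp]:
  "nmod relax = {''e'', ''u'', ''p'', ''succ'', ''x'', ''win''}"
  "rmod relax = {''nd'', ''np'', ''dist'', ''bp'', ''pr''}"
  by (auto simp: relax_def improve_def)

lemma mod_settle [simp]:
  "nmod settle = {''v'', ''e'', ''u'', ''p'', ''succ'', ''x'', ''win''}"
  "rmod settle = {''nd'', ''np'', ''dist'', ''bp'', ''pr''}"
  by (auto simp: settle_def)

lemma mod_dijkstra [simp]:
  "nmod dijkstra = {''v'', ''e'', ''u'', ''p'', ''succ'', ''x'', ''win''}"
  "rmod dijkstra = {''nd'', ''np'', ''dist'', ''bp'', ''pr''}"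
  by (auto simp: dijkstra_def)

lemma run_replay_update:
  assumes "tournament V (nmem m ''leaf'') (nmem m ''win'') pr" "rmem m ''pr'' = pr(nval v m := r)"
    and "halves V (nmem m ''half'')" "nval v m \<in> V" "card V + card V \<le> 2 ^ L"
    and "40 * L + ncost v + 10 \<le> K"
  shows "run (replay v) m K (\<lambda>m'. tournament V (nmem m ''leaf'') (nmem m' ''win'') (rmem m ''pr''))"
proof (rule run_replay)
  fix x assume "x \<in> {1..<card V}" "x \<notin> ancestors (nmem m ''leaf'' (nval v m))"
  from played_except_ancestors[OF assms(1) this]
  show "played (nmem m ''win'') (rmem m ''pr'') x" unfolding assms(2) .
qed (use assms in \<open>auto simp: tournament_def\<close>)

lemma reciprocal_less: "0 \<le> a \<Longrightarrow> 0 \<le> b \<Longrightarrow> 1 / (1 + a) < 1 / (1 + b) \<longleftrightarrow> b < (a::real)"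
  by (simp add: field_simps)

lemma reciprocal_le: "0 \<le> a \<Longrightarrow> 0 \<le> b \<Longrightarrow> 1 / (1 + a) \<le> 1 / (1 + b) \<longleftrightarrow> b \<le> (a::real)"
  by (simp add: field_simps)

context shortest_paths
begin

text \<open>
  A node at distance \<open>d\<close> has priority \<open>1 / (1 + d)\<close>. So the nearest node has the largest priority, and
  0, which is below all of these, serves for nodes without a distance: in \<open>bp\<close> for the unreached ones,
  in \<open>pr\<close> for the settled ones as well. A single comparison with \<open>bp\<close> thus covers a first visit, an
  improvement and the absence of an improvement.
\<close>

definition labels :: "nat set \<Rightarrow> nat set \<Rightarrow> memory \<Rightarrow> bool" where
  "labels S R m \<longleftrightarrow> (\<forall>v\<in>verts H.
     rmem m ''bp'' v = (if v \<in> R then 1 / (1 + rmem m ''dist'' v) else 0) \<and>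
     rmem m ''pr'' v = (if v \<in> R \<and> v \<notin> S then 1 / (1 + rmem m ''dist'' v) else 0))"

definition dijkstra_state :: "nat set \<Rightarrow> nat set \<Rightarrow> nat set \<Rightarrow> memory \<Rightarrow> bool" where
  "dijkstra_state S R todo m \<longleftrightarrow>
     dijkstra_inv S R todo (rmem m ''dist'') (nmem m ''succ'') \<and> labels S R m \<and>
     tournament (verts H) (nmem m ''leaf'') (nmem m ''win'') (rmem m ''pr'')"

definition network :: "memory \<Rightarrow> bool" where
  "network m \<longleftrightarrow>
     halves (verts H) (nmem m ''half'') \<and>
     (\<forall>e\<in>arcs H. nmem m ''tail'' e = tail H e \<and> rmem m ''w'' e = w e) \<and>
     (\<forall>v\<in>verts H. \<exists>es. chain (nmem m ''next'') (nmem m ''first'' v) es \<and> distinct es \<and>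
        set es = {e \<in> arcs H. head H e = v})"

lemma network_cong:
  assumes "network m" "nmem m' ''half'' = nmem m ''half''" "nmem m' ''tail'' = nmem m ''tail''"
    "nmem m' ''next'' = nmem m ''next''" "nmem m' ''first'' = nmem m ''first''"
    "rmem m' ''w'' = rmem m ''w''"
  shows "network m'"
  using assms unfolding network_def by simp

lemma run_relax:
  assumes net: "network m" and L: "card (verts H) + card (verts H) \<le> 2 ^ L"
    and state: "dijkstra_state S R todo m" and p: "nmem m ''p'' 0 = Suc e" and e: "e \<in> arcs H"
    and v: "nmem m ''v'' 0 = head H e" "head H e \<in> S"
    and max: "\<And>u. u \<in> S \<Longrightarrow> rmem m ''dist'' u \<le> rmem m ''dist'' (head H e)"
  shows "run relax m (40 * L + 100) (\<lambda>m'. (\<exists>R'. dijkstra_state S R' (todo - {e}) m') \<and>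
    nmem m' ''p'' 0 = nmem m ''next'' e \<and> (\<forall>u\<in>S. rmem m' ''dist'' u = rmem m ''dist'' u))"
proof -
  let ?d = "rmem m ''dist''" and ?u = "tail H e" and ?leaf = "nmem m ''leaf''"
  let ?nd = "?d (head H e) + w e"
  let ?m1 = "rwrite ''np'' 0 (1 / (1 + ?nd)) (rwrite ''nd'' 0 ?nd
    (nwrite ''p'' 0 (nmem m ''next'' e) (nwrite ''u'' 0 ?u (nwrite ''e'' 0 e m))))"
  let ?Q = "\<lambda>m'. (\<exists>R'. dijkstra_state S R' (todo - {e}) m') \<and>
    nmem m' ''p'' 0 = nmem m ''next'' e \<and> (\<forall>u\<in>S. rmem m' ''dist'' u = ?d u)"
  have inv: "dijkstra_inv S R todo ?d (nmem m ''succ'')" and lab: "labels S R m"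
    and tour: "tournament (verts H) ?leaf (nmem m ''win'') (rmem m ''pr'')"
    using state by (simp_all add: dijkstra_state_def)
  note I = dijkstra_invD[OF inv]
  have ew: "nmem m ''tail'' e = ?u" "rmem m ''w'' e = w e" using net e by (simp_all add: network_def)
  have half: "halves (verts H) (nmem m ''half'')" using net by (simp add: network_def)
  have u: "?u \<in> verts H" using e by simp
  have "0 \<le> ?d (head H e)" using I(1,5) v(2) by blast
  then have nd: "0 \<le> ?nd" using weight_nonneg[OF e] by simp
  have bp: "rmem m ''bp'' ?u = (if ?u \<in> R then 1 / (1 + ?d ?u) else 0)"
    using lab u by (simp add: labels_def)
  have test: "rmem m ''bp'' ?u < 1 / (1 + ?nd) \<longleftrightarrow> (?u \<in> R \<longrightarrow> ?nd < ?d ?u)"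
    using reciprocal_less[OF I(5) nd, of ?u] nd unfolding bp by simp
  have improve: "run improve ?m1 (40 * L + 50) ?Q" if less: "?u \<in> R \<Longrightarrow> ?nd < ?d ?u"
  proof -
    have uS: "?u \<notin> S" and inv': "dijkstra_inv S (insert ?u R) (todo - {e})
      (?d(?u := ?nd)) ((nmem m ''succ'')(?u := e))"
      using dijkstra_relax[OF inv e v(2) max less] by simp_all
    let ?m2 = "nwrite ''succ'' ?u e (rwrite ''pr'' ?u (1 / (1 + ?nd)) (rwrite ''bp'' ?u (1 / (1 + ?nd))
      (rwrite ''dist'' ?u ?nd ?m1)))"
    have "run (replay (scalar ''u'')) ?m2 (40 * L + 20)
        (\<lambda>m'. tournament (verts H) ?leaf (nmem m' ''win'') (rmem ?m2 ''pr''))"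
      using run_replay_update[where m = ?m2 and V = "verts H" and pr = "rmem m ''pr''" and v = "scalar ''u''"
          and r = "1 / (1 + ?nd)"] tour u half L by simp
    then have "run (replay (scalar ''u'')) ?m2 (40 * L + 20) ?Q"
    proof (rule run_frame)
      fix m' assume t: "tournament (verts H) ?leaf (nmem m' ''win'') (rmem ?m2 ''pr'')"
        and fr: "frame (replay (scalar ''u'')) ?m2 m'"
      have "labels S (insert ?u R) m'"
        using lab uS unfolding labels_def by (simp add: frameD[OF fr])
      then have "dijkstra_state S (insert ?u R) (todo - {e}) m'"
        using inv' t unfolding dijkstra_state_def by (simp add: frameD[OF fr])
      moreover have "\<forall>u\<in>S. rmem m' ''dist'' u = ?d u" using uS by (auto simp: frameD[OF fr])
      ultimately show "?Q m'" by (auto simp: frameD[OF fr])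
    qed
    then show ?thesis
      unfolding improve_def by (intro run_RWrite_Then run_NWrite_Then) (simp_all add: run_mono)
  qed
  have skip: "?Q ?m1" if "?u \<in> R" "\<not> ?nd < ?d ?u"
  proof -
    have "dijkstra_inv S R (todo - {e}) ?d (nmem m ''succ'')"
      by (rule dijkstra_relax_skip[OF inv that(1)]) (use that(2) in simp)
    then show ?thesis using lab tour
      by (auto simp: dijkstra_state_def labels_def intro!: exI[of _ R])
  qed
  have "run (Cond (RLess (RRead ''bp'' (scalar ''u'')) (RRead ''np'' (NConst 0))) improve Skip) ?m1 (40 * L + 60) ?Q"
    using improve skip test
    by (intro run_Cond[where k = "40 * L + 50"] run_Skip) auto
  then show ?thesis
    unfolding relax_def
    by (intro run_RWrite_Then run_NWrite_Then) (simp_all add: p v(1) ew run_mono)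
qed

lemma champion_active:
  assumes state: "dijkstra_state S R todo m"
  shows "0 < rmem m ''pr'' (nmem m ''win'' 1) \<Longrightarrow> nmem m ''win'' 1 \<in> R \<and> nmem m ''win'' 1 \<notin> S \<and>
      (\<forall>u\<in>R - S. rmem m ''dist'' (nmem m ''win'' 1) \<le> rmem m ''dist'' u)"
    and "\<not> 0 < rmem m ''pr'' (nmem m ''win'' 1) \<Longrightarrow> R = S"
proof -
  let ?d = "rmem m ''dist''" and ?pr = "rmem m ''pr''" and ?v = "nmem m ''win'' 1"
  have inv: "dijkstra_inv S R todo ?d (nmem m ''succ'')" and lab: "labels S R m"
    and tour: "tournament (verts H) (nmem m ''leaf'') (nmem m ''win'') ?pr"
    using state by (simp_all add: dijkstra_state_def)
  note I = dijkstra_invD[OF inv]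
  have win: "?v \<in> verts H" using champion(2)[OF tour target_vert] .
  have pr: "?pr u = (if u \<in> R \<and> u \<notin> S then 1 / (1 + ?d u) else 0)" if "u \<in> verts H" for u
    using lab that by (simp add: labels_def)
  have le: "?pr u \<le> ?pr ?v" if "u \<in> R" for u
    using champion(1)[OF tour, of u] I(2) that by blast
  {
    assume "0 < ?pr ?v"
    then have v: "?v \<in> R" "?v \<notin> S" using pr[OF win] by (auto split: if_splits)
    have "?d ?v \<le> ?d u" if u: "u \<in> R - S" for u
    proof -
      have "u \<in> verts H" using I(2) u by blast
      then have "1 / (1 + ?d u) \<le> 1 / (1 + ?d ?v)" using le[of u] pr[of u] pr[OF win] v u by simp
      then show ?thesis using reciprocal_le[OF I(5) I(5)] u v by simp
    qed
    with v show "?v \<in> R \<and> ?v \<notin> S \<and> (\<forall>u\<in>R - S. ?d ?v \<le> ?d u)" by simp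
  }
  {
    assume neg: "\<not> 0 < ?pr ?v"
    have "u \<in> S" if u: "u \<in> R" for u
    proof (rule ccontr)
      assume "u \<notin> S"
      moreover have "u \<in> verts H" using I(2) u by blast
      ultimately have "?pr u = 1 / (1 + ?d u)" using pr u by simp
      moreover have "0 < 1 / (1 + ?d u)" using I(5)[OF u] by simp
      ultimately show False using le[OF u] neg by simp
    qed
    then show "R = S" using I(1) by blast
  }
qed

text \<open>
  The ghost state of the loop is the list of arcs into the new node that are still to be relaxed.
\<close>

lemma run_settle:
  assumes net: "network m" and L: "card (verts H) + card (verts H) \<le> 2 ^ L"
    and state: "dijkstra_state S R {} m" and active: "0 < rmem m ''pr'' (nmem m ''win'' 1)"
  shows "run settle m (40 * L + 60 + card {e \<in> arcs H. head H e = nmem m ''win'' 1} * (40 * L + 110))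
    (\<lambda>m'. \<exists>R'. dijkstra_state (insert (nmem m ''win'' 1) S) R' {} m')"
proof -
  let ?d = "rmem m ''dist''" and ?v = "nmem m ''win'' 1" and ?leaf = "nmem m ''leaf''"
  let ?S = "insert ?v S" and ?A = "{e \<in> arcs H. head H e = nmem m ''win'' 1}"
  have v: "?v \<in> R" "?v \<notin> S" "\<And>u. u \<in> R \<Longrightarrow> u \<notin> S \<Longrightarrow> ?d ?v \<le> ?d u"
    using champion_active(1)[OF state active] by auto
  have inv: "dijkstra_inv S R {} ?d (nmem m ''succ'')" and lab: "labels S R m"
    and tour: "tournament (verts H) ?leaf (nmem m ''win'') (rmem m ''pr'')"
    using state by (simp_all add: dijkstra_state_def)
  note I = dijkstra_invD[OF inv]
  have vV: "?v \<in> verts H" using I(2) v(1) by blast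
  have half: "halves (verts H) (nmem m ''half'')" using net by (simp add: network_def)
  have inv': "dijkstra_inv ?S R ?A ?d (nmem m ''succ'')"
    by (rule dijkstra_settle[OF inv v])
  have maxS: "?d u \<le> ?d ?v" if "u \<in> ?S" for u using I(9)[of u ?v] v that by auto
  let ?m1 = "rwrite ''pr'' ?v 0 (nwrite ''v'' 0 ?v m)"
  obtain es0 where es0: "chain (nmem m ''next'') (nmem m ''first'' ?v) es0" "distinct es0" "set es0 = ?A"
    using net vV unfolding network_def by blast
  have "run (replay (scalar ''v'')) ?m1 (40 * L + 20)
      (\<lambda>m'. tournament (verts H) ?leaf (nmem m' ''win'') (rmem ?m1 ''pr''))"
    using run_replay_update[where m = ?m1 and V = "verts H" and pr = "rmem m ''pr''" and v = "scalar ''v''"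
        and r = 0] tour vV half L by simp
  then have "run (Then (replay (scalar ''v''))
    (Then (NWrite ''p'' (NConst 0) (NRead ''first'' (scalar ''v'')))
    (Loop (NLess (NConst 0) (scalar ''p'')) relax))) ?m1 (40 * L + 20 + (20 + card ?A * (40 * L + 110)))
    (\<lambda>m'. \<exists>R'. dijkstra_state ?S R' {} m')"
  proof (rule run_seq[OF _ _ order_refl])
    fix m1 assume t: "tournament (verts H) ?leaf (nmem m1 ''win'') (rmem ?m1 ''pr'')"
      and fr: "frame (replay (scalar ''v'')) ?m1 m1"
    let ?m2 = "nwrite ''p'' 0 (nmem m ''first'' ?v) m1"
    let ?I = "\<lambda>es m'. chain (nmem m ''next'') (nmem m' ''p'' 0) es \<and> distinct es \<and> set es \<subseteq> ?A \<and>
      (\<exists>R'. dijkstra_state ?S R' (set es) m') \<and> (\<forall>u\<in>?S. rmem m' ''dist'' u = ?d u)"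
    have net1: "network ?m2" by (rule network_cong[OF net]) (simp_all add: frameD[OF fr])
    have "labels ?S R m1"
      using lab unfolding labels_def by (auto simp: frameD[OF fr])
    then have st: "dijkstra_state ?S R ?A m1"
      using inv' t unfolding dijkstra_state_def by (simp add: frameD[OF fr])
    have "run (Loop (NLess (NConst 0) (scalar ''p'')) relax) ?m2 (card ?A * (40 * L + 110) + 5)
      (\<lambda>m'. \<exists>R'. dijkstra_state ?S R' {} m')"
    proof (rule run_Loop[where I = ?I and g = es0 and \<phi> = "\<lambda>es. length es * (40 * L + 110)"])
      show "?I es0 ?m2"
        using es0 st by (auto simp: frameD[OF fr] dijkstra_state_def labels_def)
      show "length es0 * (40 * L + 110) + 1 + bcost (NLess (NConst 0) (scalar ''p'')) \<le> card ?A * (40 * L + 110) + 5"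
        using distinct_card[OF es0(2)] es0(3) by simp
    next
      fix es m' assume "?I es m'" and "\<not> bval (NLess (NConst 0) (scalar ''p'')) m'"
      then show "\<exists>R'. dijkstra_state ?S R' {} m'" by (cases es) auto
    next
      fix es m' assume J: "?I es m'" and b: "bval (NLess (NConst 0) (scalar ''p'')) m'"
        and fr2: "frame relax ?m2 m'"
      obtain e es' where es: "es = e # es'" using J b by (cases es) auto
      have e: "e \<in> arcs H" "head H e = ?v" using J es by auto
      from J obtain R' where R': "dijkstra_state ?S R' (set es) m'" by blast
      have fix_v: "nmem m' ''v'' 0 = ?v" "nmem m' ''next'' = nmem m ''next''"
        by (simp_all add: frameD[OF fr2] frameD[OF fr])
      have vS: "?v \<in> ?S" by simp
      have dS: "rmem m' ''dist'' u = ?d u" if "u \<in> ?S" for u using J that by blast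
      have "network m'" by (rule network_cong[OF net1]) (simp_all add: frameD[OF fr2])
      then have "run relax m' (40 * L + 100) (\<lambda>m''. (\<exists>R'. dijkstra_state ?S R' (set es - {e}) m'') \<and>
        nmem m'' ''p'' 0 = nmem m' ''next'' e \<and> (\<forall>u\<in>?S. rmem m'' ''dist'' u = rmem m' ''dist'' u))"
      proof (rule run_relax[OF _ L R' _ e(1)])
        show "nmem m' ''p'' 0 = Suc e" using J es by simp
        show "nmem m' ''v'' 0 = head H e" "head H e \<in> ?S" using fix_v e by simp_all
        show "rmem m' ''dist'' u \<le> rmem m' ''dist'' (head H e)" if "u \<in> ?S" for u
          using maxS[OF that] dS[OF that] dS[OF vS] e(2) by simp
      qed
      then have "run relax m' (40 * L + 100) (?I es')"
      proof (rule run_mono)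
        fix m'' assume *: "(\<exists>R'. dijkstra_state ?S R' (set es - {e}) m'') \<and>
          nmem m'' ''p'' 0 = nmem m' ''next'' e \<and> (\<forall>u\<in>?S. rmem m'' ''dist'' u = rmem m' ''dist'' u)"
        have "set es - {e} = set es'" using J es by auto
        then have "\<exists>R'. dijkstra_state ?S R' (set es') m''" using * by simp
        moreover have "chain (nmem m ''next'') (nmem m'' ''p'' 0) es'" using * J es fix_v(2) by simp
        moreover have "rmem m'' ''dist'' u = ?d u" if "u \<in> ?S" for u
          using *[THEN conjunct2, THEN conjunct2, rule_format, OF that] dS[OF that] by (rule trans)
        moreover have "distinct es'" "set es' \<subseteq> ?A" using J es by simp_all
        ultimately show "?I es' m''" by blast
      qed simp
      then show "\<exists>k. run relax m' k (\<lambda>m''. \<exists>es'. ?I es' m'' \<and> length es' * (40 * L + 110) + k + 1 +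
          bcost (NLess (NConst 0) (scalar ''p'')) \<le> length es * (40 * L + 110))"
        by (rule run_round[where I = ?I and g' = es']) (simp add: es)
    qed
    then show "run (Then (NWrite ''p'' (NConst 0) (NRead ''first'' (scalar ''v'')))
      (Loop (NLess (NConst 0) (scalar ''p'')) relax)) m1 (20 + card ?A * (40 * L + 110))
      (\<lambda>m'. \<exists>R'. dijkstra_state ?S R' {} m')"
      by (intro run_NWrite_Then) (auto simp: frameD[OF fr] elim!: run_mono)
  qed
  then show ?thesis
    unfolding settle_def
    by (intro run_RWrite_Then run_NWrite_Then) (auto elim!: run_mono)
qed

text \<open>
  The potential charges each unsettled node for one removal from the queue and each arc into an
  unsettled node for one relaxation. Settling a node releases its own charge and those of its incoming
  arcs, which pays for the round although nodes have different numbers of arcs.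
\<close>

lemma run_dijkstra:
  assumes net: "network m" and L: "card (verts H) + card (verts H) \<le> 2 ^ L"
    and tour: "tournament (verts H) (nmem m ''leaf'') (nmem m ''win'') (rmem m ''pr'')"
    and zero: "\<And>v. v \<in> verts H \<Longrightarrow> rmem m ''bp'' v = 0 \<and> rmem m ''pr'' v = 0"
    and target: "nmem m ''D'' 0 = target"
  shows "run dijkstra m (40 * L + 60 + card (verts H) * (40 * L + 100) + card (arcs H) * (40 * L + 110))
    (\<lambda>m'. (\<exists>S. dijkstra_state S S {} m'))"
proof -
  let ?leaf = "nmem m ''leaf''" and ?V = "verts H"
  let ?out = "\<lambda>S. {e \<in> arcs H. head H e \<notin> S}"
  let ?\<phi> = "\<lambda>S. (card ?V - card S) * (40 * L + 100) + card (?out S) * (40 * L + 110)"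
  let ?m1 = "rwrite ''pr'' target 1 (rwrite ''bp'' target 1 (rwrite ''dist'' target 0 m))"
  let ?b = "RLess (RConst 0) (RRead ''pr'' (NRead ''win'' (NConst 1)))"
  let ?Q = "\<lambda>m'. \<exists>S. dijkstra_state S S {} m'"
  have half: "halves ?V (nmem m ''half'')" using net by (simp add: network_def)
  have "run (replay (scalar ''D'')) ?m1 (40 * L + 20)
      (\<lambda>m'. tournament ?V ?leaf (nmem m' ''win'') (rmem ?m1 ''pr''))"
    using run_replay_update[where m = ?m1 and V = ?V and pr = "rmem m ''pr''" and v = "scalar ''D''"
        and r = 1] tour target target_vert half L by simp
  then have "run (Then (replay (scalar ''D'')) (Loop ?b settle)) ?m1
    (40 * L + 20 + (card ?V * (40 * L + 100) + card (arcs H) * (40 * L + 110) + 20)) ?Q"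
  proof (rule run_seq[OF _ _ order_refl])
    fix m1 assume t: "tournament ?V ?leaf (nmem m1 ''win'') (rmem ?m1 ''pr'')"
      and fr: "frame (replay (scalar ''D'')) ?m1 m1"
    have "labels {} {target} m1"
      using zero unfolding labels_def by (simp add: frameD[OF fr])
    moreover have "dijkstra_inv {} {target} {} (rmem m1 ''dist'') (nmem m1 ''succ'')"
      by (rule dijkstra_start) (simp add: frameD[OF fr])
    ultimately have st: "dijkstra_state {} {target} {} m1"
      using t unfolding dijkstra_state_def by (simp add: frameD[OF fr])
    have net1: "network m1" by (rule network_cong[OF net]) (simp_all add: frameD[OF fr])
    show "run (Loop ?b settle) m1 (card ?V * (40 * L + 100) + card (arcs H) * (40 * L + 110) + 20) ?Q"
    proof (rule run_Loop[where I = "\<lambda>S m. \<exists>R. dijkstra_state S R {} m" and g = "{}" and \<phi> = ?\<phi>])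
      show "\<exists>R. dijkstra_state {} R {} m1" using st by blast
    next
      fix S m' assume "\<exists>R. dijkstra_state S R {} m'" and "\<not> bval ?b m'"
      then obtain R where R: "dijkstra_state S R {} m'" and "\<not> 0 < rmem m' ''pr'' (nmem m' ''win'' 1)" by auto
      then show "?Q m'" using champion_active(2)[OF R] by blast
    next
      fix S m' assume "\<exists>R. dijkstra_state S R {} m'" and "bval ?b m'" and fr2: "frame settle m1 m'"
      then obtain R where R: "dijkstra_state S R {} m'" and act: "0 < rmem m' ''pr'' (nmem m' ''win'' 1)" by auto
      let ?v = "nmem m' ''win'' 1"
      have v: "?v \<in> R" "?v \<notin> S" using champion_active(1)[OF R act] by blast+
      have "dijkstra_inv S R {} (rmem m' ''dist'') (nmem m' ''succ'')"
        using R unfolding dijkstra_state_def by blast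
      note I = dijkstra_invD[OF this]
      have fin: "finite S" using I(1,2) finite_verts by (meson finite_subset)
      have sub: "insert ?v S \<subseteq> ?V" using I(1,2) v(1) by blast
      have "card (insert ?v S) \<le> card ?V" by (rule card_mono[OF _ sub]) simp
      then have cS: "card ?V - card S = Suc (card ?V - card (insert ?v S))"
        using card_insert_disjoint[OF fin v(2)] by simp
      let ?A = "{e \<in> arcs H. head H e = ?v}"
      have "?out S = ?A \<union> ?out (insert ?v S)" "?A \<inter> ?out (insert ?v S) = {}" using v(2) by auto
      then have cA: "card (?out S) = card ?A + card (?out (insert ?v S))"
        by (simp add: card_Un_disjoint)
      have net2: "network m'" by (rule network_cong[OF net1]) (simp_all add: frameD[OF fr2])
      show "\<exists>k. run settle m' k (\<lambda>m''. \<exists>S'. (\<exists>R. dijkstra_state S' R {} m'') \<and> ?\<phi> S' + k + 1 + bcost ?b \<le> ?\<phi> S)"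
        by (rule run_round[where I = "\<lambda>S m. \<exists>R. dijkstra_state S R {} m" and g' = "insert ?v S",
              OF run_settle[OF net2 L R act]])
          (unfold cS cA, simp add: algebra_simps)
    qed simp
  qed
  then show ?thesis
    unfolding dijkstra_def using target
    by (intro run_RWrite_Then) (auto elim!: run_mono)
qed

lemma dijkstra_result:
  assumes "dijkstra_state S S {} m"
  shows "\<And>v. v \<in> verts H \<Longrightarrow> rmem m ''pr'' v = 0"
    and "\<And>v. v \<in> verts H \<Longrightarrow> 0 < rmem m ''bp'' v \<longleftrightarrow> v \<in> S"
    and "tournament (verts H) (nmem m ''leaf'') (nmem m ''win'') (rmem m ''pr'')"
    and "\<And>v. v \<in> S \<Longrightarrow> \<exists>es. apath v es target \<and> (\<forall>e\<in>set es. nmem m ''succ'' (tail H e) = e) \<and>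
      length_of es = rmem m ''dist'' v"
    and "\<And>v es. awalk v es target \<Longrightarrow> v \<in> S \<and> rmem m ''dist'' v \<le> length_of es"
proof -
  have inv: "dijkstra_inv S S {} (rmem m ''dist'') (nmem m ''succ'')" and lab: "labels S S m"
    and tour: "tournament (verts H) (nmem m ''leaf'') (nmem m ''win'') (rmem m ''pr'')"
    using assms by (simp_all add: dijkstra_state_def)
  note I = dijkstra_invD[OF inv]
  show "rmem m ''pr'' v = 0" if "v \<in> verts H" for v using lab that by (simp add: labels_def)
  show "0 < rmem m ''bp'' v \<longleftrightarrow> v \<in> S" if "v \<in> verts H" for v
    using lab that I(5)[of v] by (auto simp: labels_def)
  show "tournament (verts H) (nmem m ''leaf'') (nmem m ''win'') (rmem m ''pr'')" by (rule tour)
  show "\<exists>es. apath v es target \<and> (\<forall>e\<in>set es. nmem m ''succ'' (tail H e) = e) \<and>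
      length_of es = rmem m ''dist'' v" if "v \<in> S" for v using I(7)[OF that] by blast
  show "v \<in> S \<and> rmem m ''dist'' v \<le> length_of es" if "awalk v es target" for v es
    using dijkstra_final[OF inv that] .
qed

end

section \<open>The dynamic program\<close>

definition path_cost :: "pricing \<Rightarrow> nat \<Rightarrow> path \<Rightarrow> real" where
  "path_cost P t p = - (demand P * (\<Sum>e\<in>set (snd p). dual P t e))"

definition changed :: "(nat \<Rightarrow> path) \<Rightarrow> nat \<Rightarrow> real" where
  "changed \<sigma> t = (if \<sigma> t \<noteq> \<sigma> (t - 1) then 1 else 0)"

lemma sequence_cost_sum:
  "sequence_cost P \<sigma> =
     penalty P * (\<Sum>t = 2..horizon P. changed \<sigma> t) + (\<Sum>t = 1..horizon P. path_cost P t (\<sigma> t))"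
proof -
  have "real (path_changes P \<sigma>) = (\<Sum>t = 2..horizon P. changed \<sigma> t)"
    unfolding path_changes_def changed_def
    by (simp add: sum.If_cases Int_def conj_commute)
  then show ?thesis
    unfolding sequence_cost_def path_cost_def by (simp add: sum_negf sum_distrib_left)
qed

lemma optimal_sequence_cong:
  assumes "\<And>t. t \<in> {1..horizon P} \<Longrightarrow> \<sigma> t = \<tau> t"
  shows "optimal_sequence P \<sigma> \<longleftrightarrow> optimal_sequence P \<tau>"
proof -
  have "path_sequence P \<sigma> \<longleftrightarrow> path_sequence P \<tau>"
    unfolding path_sequence_def by (intro ball_cong refl) (simp only: assms)
  moreover have "changed \<sigma> t = changed \<tau> t" if "t \<in> {2..horizon P}" for t
  proof -
    have "t \<in> {1..horizon P}" "t - 1 \<in> {1..horizon P}" using that by auto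
    then show ?thesis unfolding changed_def by (simp only: assms)
  qed
  then have "(\<Sum>t = 2..horizon P. changed \<sigma> t) = (\<Sum>t = 2..horizon P. changed \<tau> t)"
    by (intro sum.cong refl) blast
  moreover have "(\<Sum>t = 1..horizon P. path_cost P t (\<sigma> t)) = (\<Sum>t = 1..horizon P. path_cost P t (\<tau> t))"
    by (intro sum.cong refl) (simp only: assms)
  ultimately have "path_sequence P \<sigma> \<longleftrightarrow> path_sequence P \<tau>"
    and "sequence_cost P \<sigma> = sequence_cost P \<tau>"
    unfolding sequence_cost_sum by simp_all
  then show ?thesis unfolding optimal_sequence_def by simp
qed

text \<open>
  The cost of a sequence from time step \<open>i\<close> on, where the first path is charged like a change. With
  this convention the recursion has the same form at every time step.
\<close>

definition tail_cost :: "pricing \<Rightarrow> (nat \<Rightarrow> path) \<Rightarrow> nat \<Rightarrow> real" where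
  "tail_cost P \<sigma> i =
     penalty P + penalty P * (\<Sum>t = Suc i..horizon P. changed \<sigma> t) + (\<Sum>t = i..horizon P. path_cost P t (\<sigma> t))"

text \<open>
  Cut the sequence at its first change: up to there it uses one path, valid throughout the interval,
  and the rest is bounded by induction. The inner induction moves \<open>j\<close> to the first change.
\<close>

lemma dp_lower_bound:
  assumes last0: "g (Suc (horizon P)) = 0"
    and best: "\<And>i j p. 1 \<le> i \<Longrightarrow> i \<le> j \<Longrightarrow> j \<le> horizon P \<Longrightarrow> (\<And>t. t \<in> {i..j} \<Longrightarrow> valid_path P t p) \<Longrightarrow>
      g i \<le> penalty P + (\<Sum>t = i..j. path_cost P t p) + g (Suc j)"
    and seq: "path_sequence P \<sigma>" and i: "1 \<le> i" "i \<le> horizon P"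
  shows "g i \<le> tail_cost P \<sigma> i"
  using i
proof (induction "horizon P - i" arbitrary: i rule: less_induct)
  case less
  let ?T = "horizon P" and ?c = "\<lambda>t. path_cost P t (\<sigma> t)"
  have "g i \<le> penalty P + penalty P * (\<Sum>t = Suc j..?T. changed \<sigma> t) + (\<Sum>t = i..?T. ?c t)"
    if "i \<le> j" "j \<le> ?T" "\<And>t. t \<in> {i..j} \<Longrightarrow> \<sigma> t = \<sigma> i" for j
    using that
  proof (induction "?T - j" arbitrary: j rule: less_induct)
    case inner: less
    have valid: "valid_path P t (\<sigma> i)" if "t \<in> {i..j}" for t
    proof -
      have "valid_path P t (\<sigma> t)" using seq that less.prems inner.prems(1,2) unfolding path_sequence_def by simp
      then show ?thesis using inner.prems(3)[OF that] by simp
    qed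
    have sum: "(\<Sum>t = i..j. path_cost P t (\<sigma> i)) = (\<Sum>t = i..j. ?c t)"
      by (intro sum.cong refl arg_cong[where f = "path_cost P _"]) (rule inner.prems(3)[symmetric])
    have bnd: "g i \<le> penalty P + (\<Sum>t = i..j. ?c t) + g (Suc j)"
      using best[OF less.prems(1) inner.prems(1,2) valid] sum by simp
    show ?case
    proof (cases "j = ?T")
      case True
      then show ?thesis using bnd last0 by simp
    next
      case False
      then have j: "j < ?T" using inner.prems(2) by simp
      have head: "(\<Sum>t = Suc j..?T. changed \<sigma> t) = changed \<sigma> (Suc j) + (\<Sum>t = Suc (Suc j)..?T. changed \<sigma> t)"
        using j by (simp add: sum.atLeast_Suc_atMost)
      show ?thesis
      proof (cases "\<sigma> (Suc j) = \<sigma> j")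
        case True
        have const: "\<sigma> t = \<sigma> i" if "t \<in> {i..Suc j}" for t
          using that True inner.prems(3)[of t] inner.prems(3)[of j] inner.prems(1)
          by (cases "t = Suc j") simp_all
        have "g i \<le> penalty P + penalty P * (\<Sum>t = Suc (Suc j)..?T. changed \<sigma> t) + (\<Sum>t = i..?T. ?c t)"
          by (rule inner.hyps[OF _ _ _ const]) (use j inner.prems(1,2) in auto)
        moreover have "changed \<sigma> (Suc j) = 0" using True by (simp add: changed_def)
        ultimately show ?thesis using head by simp
      next
        case False
        have "g (Suc j) \<le> tail_cost P \<sigma> (Suc j)"
          by (rule less.hyps) (use j inner.prems(1,2) less.prems in auto)
        moreover have "changed \<sigma> (Suc j) = 1" using False by (simp add: changed_def)
        moreover have "(\<Sum>t = i..?T. ?c t) = (\<Sum>t = i..j. ?c t) + (\<Sum>t = Suc j..?T. ?c t)"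
        proof -
          have "{i..?T} = {i..j} \<union> {Suc j..?T}" "{i..j} \<inter> {Suc j..?T} = {}" using j inner.prems(1,2) by auto
          then show ?thesis by (simp add: sum.union_disjoint)
        qed
        ultimately show ?thesis
          using bnd head unfolding tail_cost_def by (simp add: algebra_simps)
      qed
    qed
  qed
  from this[of i] show ?case using less.prems unfolding tail_cost_def by simp
qed

text \<open>
  \<open>cur t\<close> is the start of the interval that contains \<open>t\<close> when the intervals \<open>{i..last i}\<close> are
  concatenated from time step 1 on. Two consecutive intervals may happen to use the same path, hence
  the constructed sequence costs at most \<open>g 1\<close>.
\<close>

lemma dp_optimal:
  fixes cur last' :: "nat \<Rightarrow> nat"
  assumes T: "1 \<le> horizon P" and \<alpha>: "0 \<le> penalty P" and last0: "g (Suc (horizon P)) = 0"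
    and best: "\<And>i j p. 1 \<le> i \<Longrightarrow> i \<le> j \<Longrightarrow> j \<le> horizon P \<Longrightarrow> (\<And>t. t \<in> {i..j} \<Longrightarrow> valid_path P t p) \<Longrightarrow>
      g i \<le> penalty P + (\<Sum>t = i..j. path_cost P t p) + g (Suc j)"
    and plan: "\<And>i. 1 \<le> i \<Longrightarrow> i \<le> horizon P \<Longrightarrow> i \<le> last' i \<and> last' i \<le> horizon P \<and>
      (\<forall>t\<in>{i..last' i}. valid_path P t (q i)) \<and>
      g i = penalty P + (\<Sum>t = i..last' i. path_cost P t (q i)) + g (Suc (last' i))"
    and cur1: "cur 1 = 1"
    and cur: "\<And>t. 1 \<le> t \<Longrightarrow> t < horizon P \<Longrightarrow> cur (Suc t) = (if last' (cur t) < Suc t then Suc t else cur t)"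
  shows "optimal_sequence P (\<lambda>t. q (cur t))"
proof -
  let ?T = "horizon P" and ?\<rho> = "\<lambda>t. q (cur t)"
  let ?F = "\<lambda>t. penalty P + penalty P * (\<Sum>s = 2..t. changed ?\<rho> s) + (\<Sum>s = 1..t. path_cost P s (?\<rho> s))"
  have *: "1 \<le> cur t \<and> cur t \<le> t \<and> t \<le> last' (cur t) \<and>
      ?F t + (\<Sum>s = Suc t..last' (cur t). path_cost P s (?\<rho> t)) + g (Suc (last' (cur t))) \<le> g 1"
    if "1 \<le> t" "t \<le> ?T" for t
    using that
  proof (induction t rule: dec_induct)
    case base
    have p: "1 \<le> last' 1" "g 1 = penalty P + (\<Sum>t = 1..last' 1. path_cost P t (q 1)) + g (Suc (last' 1))"
      using plan[of 1] T by simp_all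
    have "(\<Sum>t = 1..last' 1. path_cost P t (q 1)) =
        path_cost P 1 (q 1) + (\<Sum>t = Suc 1..last' 1. path_cost P t (q 1))"
      using p(1) by (rule sum.atLeast_Suc_atMost)
    with p cur1 show ?case by simp
  next
    case (step t)
    let ?i = "cur t"
    have IH: "1 \<le> ?i" "?i \<le> t" "t \<le> last' ?i"
      "?F t + (\<Sum>s = Suc t..last' ?i. path_cost P s (?\<rho> t)) + g (Suc (last' ?i)) \<le> g 1"
      using step by simp_all
    have nxt: "cur (Suc t) = (if last' ?i < Suc t then Suc t else ?i)"
      using cur[of t] step by simp
    have F: "?F (Suc t) = ?F t + penalty P * changed ?\<rho> (Suc t) + path_cost P (Suc t) (?\<rho> (Suc t))"
      using step.hyps by (simp add: algebra_simps)
    show ?case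
    proof (cases "last' ?i < Suc t")
      case False
      then have c: "cur (Suc t) = ?i" using nxt by simp
      then have "changed ?\<rho> (Suc t) = 0" by (simp add: changed_def)
      moreover have "(\<Sum>s = Suc t..last' ?i. path_cost P s (?\<rho> t)) =
          path_cost P (Suc t) (?\<rho> t) + (\<Sum>s = Suc (Suc t)..last' ?i. path_cost P s (?\<rho> t))"
        using False by (intro sum.atLeast_Suc_atMost) simp
      ultimately show ?thesis using IH F c False by simp
    next
      case True
      let ?j = "Suc t"
      have c: "cur ?j = ?j" and l: "last' ?i = t" using True nxt IH by simp_all
      have p: "?j \<le> last' ?j" "g ?j = penalty P + (\<Sum>t = ?j..last' ?j. path_cost P t (q ?j)) + g (Suc (last' ?j))"
        using plan[of ?j] step by simp_all
      have "(\<Sum>t = ?j..last' ?j. path_cost P t (q ?j)) =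
        path_cost P ?j (q ?j) + (\<Sum>t = Suc ?j..last' ?j. path_cost P t (q ?j))"
        using p(1) by (rule sum.atLeast_Suc_atMost)
      moreover have "penalty P * changed ?\<rho> ?j \<le> penalty P" using \<alpha> by (simp add: changed_def)
      ultimately show ?thesis using IH(4) F c l p by simp
    qed
  qed
  have valid: "path_sequence P ?\<rho>"
    unfolding path_sequence_def
  proof
    fix t assume t: "t \<in> {1..?T}"
    then have "1 \<le> cur t" "cur t \<le> t" "t \<le> last' (cur t)" using *[of t] by simp_all
    then show "valid_path P t (?\<rho> t)" using plan[of "cur t"] t by simp
  qed
  have "last' (cur ?T) = ?T"
    using *[OF T order_refl] plan[of "cur ?T"] by (intro antisym) simp_all
  then have "?F ?T \<le> g 1" using *[OF T order_refl] last0 by simp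
  then have le: "penalty P + sequence_cost P ?\<rho> \<le> g 1"
    unfolding sequence_cost_sum by simp
  have "sequence_cost P ?\<rho> \<le> sequence_cost P \<sigma>" if "path_sequence P \<sigma>" for \<sigma>
  proof -
    have "g 1 \<le> tail_cost P \<sigma> 1"
      by (rule dp_lower_bound[OF last0 best that order_refl T])
    also have "\<dots> = penalty P + sequence_cost P \<sigma>"
      unfolding tail_cost_def sequence_cost_sum by (simp add: numeral_2_eq_2)
    finally show ?thesis using le by simp
  qed
  with valid show ?thesis unfolding optimal_sequence_def by blast
qed

section \<open>Paths that are valid throughout an interval\<close>

lemma cas_arcs_update: "pre_digraph.cas (G\<lparr>arcs := A\<rparr>) u es v \<longleftrightarrow> pre_digraph.cas G u es v"
  by (induction es arbitrary: u) (simp_all add: pre_digraph.cas.simps)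

lemma awalk_verts_arcs_update: "pre_digraph.awalk_verts (G\<lparr>arcs := A\<rparr>) u es = pre_digraph.awalk_verts G u es"
  by (induction es arbitrary: u) (simp_all add: pre_digraph.awalk_verts.simps)

lemma cas_end_unique: "pre_digraph.cas G u es v \<Longrightarrow> pre_digraph.cas G u es v' \<Longrightarrow> v = v'"
  by (induction es arbitrary: u) (simp_all add: pre_digraph.cas.simps)

lemma apath_arcs_update:
  "pre_digraph.apath (G\<lparr>arcs := A\<rparr>) u es v \<longleftrightarrow>
     u \<in> verts G \<and> set es \<subseteq> A \<and> pre_digraph.cas G u es v \<and> distinct (pre_digraph.awalk_verts G u es)"
  unfolding pre_digraph.apath_def pre_digraph.awalk_def cas_arcs_update awalk_verts_arcs_update by simp

lemma apath_distinct_arcs: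
  assumes "pre_digraph.apath G u es v"
  shows "distinct es"
proof -
  have "distinct (pre_digraph.awalk_verts G u es)" using assms unfolding pre_digraph.apath_def by blast
  then have "distinct (map (tail G) es)"
    unfolding pre_digraph.awalk_verts_conv by (auto split: if_splits)
  then show ?thesis by (simp add: distinct_map)
qed

locale encoded_pricing =
  fixes P :: pricing and m0 :: memory
  assumes valid: "valid_pricing P" and enc: "encodes P m0"
begin

abbreviation V :: "nat set" where "V \<equiv> verts (net P)"
abbreviation T :: nat where "T \<equiv> horizon P"

lemma fin_net: "fin_digraph (net P)"
  using valid unfolding valid_pricing_def by blast

lemma T_pos: "1 \<le> T" and demand_nonneg: "0 \<le> demand P" and penalty_pos: "0 < penalty P"
  using valid unfolding valid_pricing_def by simp_all

lemma at_step:
  assumes "t \<in> {1..T}"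
  shows "arcs_at P t \<subseteq> arcs (net P)" "origin P t \<in> V" "destination P t \<in> V"
    "\<exists>p. valid_path P t p" "\<And>e. e \<in> arcs_at P t \<Longrightarrow> dual P t e \<le> 0"
  using valid assms unfolding valid_pricing_def by simp_all

lemma finite_V: "finite V" and finite_arcs: "finite (arcs (net P))"
  using fin_net by (simp_all add: fin_digraph.finite_verts fin_digraph.finite_arcs)

lemma finite_arcs_at: "t \<in> {1..T} \<Longrightarrow> finite (arcs_at P t)"
  using at_step(1) finite_arcs finite_subset by blast

lemma V_nonempty: "1 \<le> card V"
  using at_step(2)[of 1] T_pos finite_V by (metis atLeastAtMost_iff card_0_eq empty_iff le_refl less_one not_le)

lemma card_arcs_at: "t \<in> {1..T} \<Longrightarrow> card (arcs_at P t) \<le> num_arcs P"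
  unfolding num_arcs_def by (intro Max_ge) simp_all

definition common_arcs :: "nat \<Rightarrow> nat \<Rightarrow> nat set" where
  "common_arcs i j = {e \<in> arcs (net P). \<forall>t\<in>{i..j}. e \<in> arcs_at P t}"

definition interval_net :: "nat \<Rightarrow> nat \<Rightarrow> (nat, nat) pre_digraph" where
  "interval_net i j = (net P)\<lparr>arcs := common_arcs i j\<rparr>"

definition weight :: "nat \<Rightarrow> nat \<Rightarrow> nat \<Rightarrow> real" where
  "weight i j e = (\<Sum>t = i..j. - (demand P * dual P t e))"

lemma interval_net_simps [simp]:
  "verts (interval_net i j) = V" "arcs (interval_net i j) = common_arcs i j"
  "tail (interval_net i j) = tail (net P)" "head (interval_net i j) = head (net P)"
  by (simp_all add: interval_net_def)

lemma common_arcs_sub: "common_arcs i j \<subseteq> arcs (net P)" "i \<le> j \<Longrightarrow> common_arcs i j \<subseteq> arcs_at P j"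
  unfolding common_arcs_def by auto

lemma card_common_arcs:
  assumes "1 \<le> i" "i \<le> j" "j \<le> T"
  shows "card (common_arcs i j) \<le> num_arcs P"
proof -
  have j: "j \<in> {1..T}" using assms by simp
  have "card (common_arcs i j) \<le> card (arcs_at P j)"
    by (rule card_mono[OF finite_arcs_at[OF j] common_arcs_sub(2)[OF assms(2)]])
  then show ?thesis using card_arcs_at[OF j] by (rule le_trans)
qed

lemma interval_shortest_paths:
  assumes "1 \<le> i" "i \<le> j" "j \<le> T" "v \<in> V"
  shows "shortest_paths (interval_net i j) (weight i j) v"
proof -
  interpret N: fin_digraph "net P" by (rule fin_net)
  show ?thesis
  proof
    show "e \<in> arcs (interval_net i j) \<Longrightarrow> tail (interval_net i j) e \<in> verts (interval_net i j)" for e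
      using subsetD[OF common_arcs_sub(1)] by simp
    show "e \<in> arcs (interval_net i j) \<Longrightarrow> head (interval_net i j) e \<in> verts (interval_net i j)" for e
      using subsetD[OF common_arcs_sub(1)] by simp
    show "finite (verts (interval_net i j))" using finite_V by simp
    show "finite (arcs (interval_net i j))" using finite_subset[OF common_arcs_sub(1) finite_arcs] by simp
    show "v \<in> verts (interval_net i j)" using assms(4) by simp
    fix e assume "e \<in> arcs (interval_net i j)"
    then have e: "\<forall>t\<in>{i..j}. e \<in> arcs_at P t" by (simp add: common_arcs_def)
    have "0 \<le> - (demand P * dual P t e)" if t: "t \<in> {i..j}" for t
    proof -
      have "dual P t e \<le> 0" by (rule at_step(5)[of t]) (use e t assms in auto)
      from mult_nonneg_nonpos[OF demand_nonneg this] show ?thesis by simp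
    qed
    then show "0 \<le> weight i j e" unfolding weight_def by (intro sum_nonneg)
  qed
qed

text \<open>
  A walk determines its end. So a path that is valid throughout an interval exists only if origin and
  destination stay the same, and then it is just a path in the network of the common arcs.
\<close>

lemma valid_on_interval:
  assumes "1 \<le> i" "i \<le> j" "j \<le> T"
  shows "(\<forall>t\<in>{i..j}. valid_path P t (u, es)) \<longleftrightarrow>
    (\<forall>t\<in>{i..j}. origin P t = origin P i \<and> destination P t = destination P i) \<and>
    u = origin P i \<and> pre_digraph.apath (interval_net i j) (origin P i) es (destination P i)"
  (is "?L \<longleftrightarrow> ?R")
proof -
  have vp: "valid_path P t (u, es) \<longleftrightarrow> u = origin P t \<and> u \<in> V \<and> set es \<subseteq> arcs_at P t \<and>
      pre_digraph.cas (net P) u es (destination P t) \<and> distinct (pre_digraph.awalk_verts (net P) u es)" for t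
    unfolding valid_path_def net_at_def apath_arcs_update fst_conv snd_conv by blast
  have ip: "pre_digraph.apath (interval_net i j) v es w \<longleftrightarrow> v \<in> V \<and> set es \<subseteq> common_arcs i j \<and>
      pre_digraph.cas (net P) v es w \<and> distinct (pre_digraph.awalk_verts (net P) v es)" for v w
    unfolding interval_net_def apath_arcs_update ..
  have i: "i \<in> {i..j}" using assms by simp
  have sub: "set es \<subseteq> common_arcs i j \<longleftrightarrow> (\<forall>t\<in>{i..j}. set es \<subseteq> arcs_at P t)"
  proof
    assume "set es \<subseteq> common_arcs i j"
    then show "\<forall>t\<in>{i..j}. set es \<subseteq> arcs_at P t" unfolding common_arcs_def by blast
  next
    assume *: "\<forall>t\<in>{i..j}. set es \<subseteq> arcs_at P t"
    moreover have "arcs_at P i \<subseteq> arcs (net P)" by (rule at_step(1)) (use assms in simp)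
    ultimately show "set es \<subseteq> common_arcs i j" using i unfolding common_arcs_def by blast
  qed
  show ?thesis
  proof
    assume L: ?L
    have at: "u = origin P t" "pre_digraph.cas (net P) u es (destination P t)" "set es \<subseteq> arcs_at P t"
      if "t \<in> {i..j}" for t
      using L that unfolding vp by blast+
    have "destination P t = destination P i" if "t \<in> {i..j}" for t
      using cas_end_unique[OF at(2)[OF that] at(2)[OF i]] .
    moreover have "origin P t = origin P i" if "t \<in> {i..j}" for t
      using at(1)[OF that] at(1)[OF i] by simp
    moreover have "set es \<subseteq> common_arcs i j" unfolding sub using at(3) by blast
    moreover have "u \<in> V" "distinct (pre_digraph.awalk_verts (net P) u es)" using L i unfolding vp by blast+
    moreover have "u = origin P i" "pre_digraph.cas (net P) u es (destination P i)" using at(1,2)[OF i] .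
    ultimately show ?R unfolding ip by blast
  next
    assume R: ?R
    then have "set es \<subseteq> common_arcs i j" unfolding ip by blast
    then have sub': "set es \<subseteq> arcs_at P t" if "t \<in> {i..j}" for t using that unfolding sub by blast
    show ?L
    proof
      fix t assume t: "t \<in> {i..j}"
      then have "origin P t = origin P i" "destination P t = destination P i" using R by blast+
      then show "valid_path P t (u, es)" using R sub'[OF t] unfolding vp ip by simp
    qed
  qed
qed

lemma path_cost_interval:
  assumes "distinct es"
  shows "(\<Sum>t = i..j. path_cost P t (u, es)) = sum_list (map (weight i j) es)"
proof -
  have "(\<Sum>t = i..j. path_cost P t (u, es)) = (\<Sum>t = i..j. \<Sum>e\<in>set es. - (demand P * dual P t e))"
    unfolding path_cost_def by (simp add: sum_distrib_left sum_negf)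
  also have "\<dots> = (\<Sum>e\<in>set es. weight i j e)"
    unfolding weight_def by (rule sum.swap)
  also have "\<dots> = sum_list (map (weight i j) es)"
    using assms by (simp add: sum_list_distinct_conv_sum_set)
  finally show ?thesis .
qed

end

section \<open>Preparing the instances of Dijkstra's algorithm\<close>

definition setup_node :: com where
  "setup_node =
     Then (NWrite ''win'' (NAdd (scalar ''num_nodes'') (scalar ''k'')) (NRead ''node'' (scalar ''k'')))
    (Then (NWrite ''leaf'' (NRead ''node'' (scalar ''k'')) (NAdd (scalar ''num_nodes'') (scalar ''k'')))
    (Then (NWrite ''half'' (NAdd (scalar ''k'') (scalar ''k'')) (scalar ''k''))
          (NWrite ''half'' (NAdd (NAdd (scalar ''k'') (scalar ''k'')) (NConst 1)) (scalar ''k''))))"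

definition setup_match :: com where
  "setup_match =
     Then (NWrite ''win'' (scalar ''x'') (NRead ''win'' (NAdd (scalar ''x'') (scalar ''x''))))
          (NWrite ''x'' (NConst 0) (NSub (scalar ''x'') (NConst 1)))"

definition setup_tree :: com where
  "setup_tree =
     Then (For ''k'' (NConst 0) (scalar ''num_nodes'') setup_node)
    (Then (NWrite ''x'' (NConst 0) (NSub (scalar ''num_nodes'') (NConst 1)))
          (Loop (NLess (NConst 0) (scalar ''x'')) setup_match))"

definition reset_nodes :: com where
  "reset_nodes = For ''k'' (NConst 0) (scalar ''num_nodes'')
     (Then (RWrite ''bp'' (NRead ''node'' (scalar ''k'')) (RConst 0))
           (NWrite ''first'' (NRead ''node'' (scalar ''k'')) (NConst 0)))"

definition reset_arcs :: com where
  "reset_arcs = For ''q'' (NConst 0) (NRead ''ptr'' (NAdd (scalar ''horizon'') (NConst 1)))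
     (Then (NWrite ''cnt'' (NRead ''arc'' (scalar ''q'')) (NConst 0))
           (RWrite ''w'' (NRead ''arc'' (scalar ''q'')) (RConst 0)))"

definition extend_arc :: com where
  "extend_arc =
     Then (NWrite ''cnt'' (scalar ''e'') (NAdd (NRead ''cnt'' (scalar ''e'')) (NConst 1)))
    (Then (RWrite ''w'' (scalar ''e'') (RSub (RRead ''w'' (scalar ''e''))
            (RMul (RRead ''demand'' (NConst 0)) (RRead ''dual'' (scalar ''q'')))))
    (Then (NWrite ''next'' (scalar ''e'') (NRead ''first'' (NRead ''head'' (scalar ''e''))))
          (NWrite ''first'' (NRead ''head'' (scalar ''e'')) (NAdd (scalar ''e'') (NConst 1)))))"

definition scan_arcs :: com where
  "scan_arcs = For ''q'' (NRead ''ptr'' (scalar ''j'')) (NRead ''ptr'' (NAdd (scalar ''j'') (NConst 1)))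
     (Then (NWrite ''e'' (NConst 0) (NRead ''arc'' (scalar ''q'')))
     (Cond (NLess (NAdd (NRead ''cnt'' (scalar ''e'')) (scalar ''i'')) (scalar ''j'')) Skip extend_arc))"

lemma mod_prepare [simp]:
  "nmod setup_tree = {''k'', ''x'', ''win'', ''leaf'', ''half''}" "rmod setup_tree = {}"
  "nmod reset_nodes = {''k'', ''first''}" "rmod reset_nodes = {''bp''}"
  "nmod reset_arcs = {''q'', ''cnt''}" "rmod reset_arcs = {''w''}"
  "nmod scan_arcs = {''q'', ''e'', ''cnt'', ''next'', ''first''}" "rmod scan_arcs = {''w''}"
  by (auto simp: setup_tree_def setup_node_def setup_match_def reset_nodes_def reset_arcs_def
      scan_arcs_def extend_arc_def)

context encoded_pricing
begin

abbreviation "node \<equiv> nmem m0 ''node''"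
abbreviation "ptr \<equiv> nmem m0 ''ptr''"
abbreviation "arc_at \<equiv> nmem m0 ''arc''"

lemma encoding:
  shows node_bij: "bij_betw node {..<card V} V" and ptr_1: "ptr 1 = 0"
    and "nmem m0 ''horizon'' 0 = T" "nmem m0 ''num_nodes'' 0 = card V"
    and "\<forall>e\<in>arcs (net P). nmem m0 ''tail'' e = tail (net P) e \<and> nmem m0 ''head'' e = head (net P) e"
    and "\<forall>t\<in>{1..T}. nmem m0 ''origin'' t = origin P t \<and> nmem m0 ''destination'' t = destination P t"
    and "rmem m0 ''demand'' 0 = demand P" "rmem m0 ''penalty'' 0 = penalty P"
    and scratch_zero: "\<forall>x. x \<notin> {''horizon'', ''num_nodes'', ''node'', ''tail'', ''head'', ''origin'',
            ''destination'', ''ptr'', ''arc''} \<longrightarrow> nmem m0 x = (\<lambda>_. 0)"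
      "\<forall>x. x \<notin> {''dual'', ''demand'', ''penalty''} \<longrightarrow> rmem m0 x = (\<lambda>_. 0)"
  using enc unfolding encodes_def by - (elim conjE, assumption)+

lemma at_segment:
  assumes "t \<in> {1..T}"
  shows "ptr t \<le> ptr (Suc t)" "inj_on arc_at {ptr t..<ptr (Suc t)}" "arc_at ` {ptr t..<ptr (Suc t)} = arcs_at P t"
    "\<And>q. ptr t \<le> q \<Longrightarrow> q < ptr (Suc t) \<Longrightarrow> rmem m0 ''dual'' q = dual P t (arc_at q)"
    "ptr (Suc t) - ptr t \<le> num_arcs P"
proof -
  have *: "ptr t \<le> ptr (Suc t)" "distinct (segment arc_at ptr t)" "set (segment arc_at ptr t) = arcs_at P t"
    "segment (rmem m0 ''dual'') ptr t = map (dual P t) (segment arc_at ptr t)"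
  proof -
    have "\<forall>t\<in>{1..T}. ptr t \<le> ptr (Suc t) \<and> distinct (segment arc_at ptr t) \<and>
        set (segment arc_at ptr t) = arcs_at P t \<and>
        segment (rmem m0 ''dual'') ptr t = map (dual P t) (segment arc_at ptr t)"
      using enc unfolding encodes_def by (elim conjE) assumption
    from bspec[OF this assms]
    show "ptr t \<le> ptr (Suc t)" "distinct (segment arc_at ptr t)" "set (segment arc_at ptr t) = arcs_at P t"
      "segment (rmem m0 ''dual'') ptr t = map (dual P t) (segment arc_at ptr t)" by simp_all
  qed
  then show "ptr t \<le> ptr (Suc t)" and inj: "inj_on arc_at {ptr t..<ptr (Suc t)}"
    and img: "arc_at ` {ptr t..<ptr (Suc t)} = arcs_at P t"
    and "\<And>q. ptr t \<le> q \<Longrightarrow> q < ptr (Suc t) \<Longrightarrow> rmem m0 ''dual'' q = dual P t (arc_at q)"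
    unfolding segment_def by (simp_all add: distinct_map)
  show "ptr (Suc t) - ptr t \<le> num_arcs P"
    using card_image[OF inj] card_arcs_at[OF assms] unfolding img by simp
qed

lemma ptr_bound: "t \<le> T \<Longrightarrow> ptr (Suc t) \<le> t * num_arcs P"
proof (induction t)
  case 0
  then show ?case using ptr_1 by simp
next
  case (Suc t)
  then have "ptr (Suc (Suc t)) \<le> ptr (Suc t) + num_arcs P" using at_segment(5)[of "Suc t"] by simp
  with Suc show ?case by simp
qed

lemma ptr_mono: "t \<in> {1..T} \<Longrightarrow> ptr (Suc t) \<le> ptr (Suc T)"
proof -
  have "t \<le> s \<Longrightarrow> s \<le> T \<Longrightarrow> ptr (Suc t) \<le> ptr (Suc s)" for s
  proof (induction s rule: dec_induct)
    case (step s)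
    then show ?case using at_segment(1)[of "Suc s"] by simp
  qed simp
  then show "t \<in> {1..T} \<Longrightarrow> ptr (Suc t) \<le> ptr (Suc T)" by simp
qed

definition inputs_kept :: "memory \<Rightarrow> bool" where
  "inputs_kept m \<longleftrightarrow>
     (\<forall>x\<in>{''horizon'', ''num_nodes'', ''node'', ''tail'', ''head'', ''origin'', ''destination'', ''ptr'', ''arc''}.
        nmem m x = nmem m0 x) \<and>
     (\<forall>x\<in>{''dual'', ''demand'', ''penalty''}. rmem m x = rmem m0 x)"

lemma inputs_kept_frame:
  assumes "inputs_kept m" "frame c m m'"
    and "{''horizon'', ''num_nodes'', ''node'', ''tail'', ''head'', ''origin'', ''destination'', ''ptr'', ''arc''} \<inter> nmod c = {}"
    and "{''dual'', ''demand'', ''penalty''} \<inter> rmod c = {}"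
  shows "inputs_kept m'"
  unfolding inputs_kept_def
proof (intro conjI ballI)
  note kept = assms(1)[unfolded inputs_kept_def]
  fix x assume x: "x \<in> {''horizon'', ''num_nodes'', ''node'', ''tail'', ''head'', ''origin'', ''destination'', ''ptr'', ''arc''}"
  show "nmem m' x = nmem m0 x"
    unfolding frameD(1)[OF assms(2) assms(3)[unfolded disjoint_iff, rule_format, OF x]]
    by (rule bspec[OF conjunct1[OF kept] x])
next
  note kept = assms(1)[unfolded inputs_kept_def]
  fix x assume x: "x \<in> {''dual'', ''demand'', ''penalty''}"
  show "rmem m' x = rmem m0 x"
    unfolding frameD(2)[OF assms(2) assms(4)[unfolded disjoint_iff, rule_format, OF x]]
    by (rule bspec[OF conjunct2[OF kept] x])
qed

lemma inputs:
  assumes "inputs_kept m"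
  shows "nmem m ''horizon'' 0 = T" "nmem m ''num_nodes'' 0 = card V" "nmem m ''node'' = node"
    "nmem m ''ptr'' = ptr" "nmem m ''arc'' = arc_at"
    "\<And>e. e \<in> arcs (net P) \<Longrightarrow> nmem m ''tail'' e = tail (net P) e"
    "\<And>e. e \<in> arcs (net P) \<Longrightarrow> nmem m ''head'' e = head (net P) e"
    "\<And>t. t \<in> {1..T} \<Longrightarrow> nmem m ''origin'' t = origin P t"
    "\<And>t. t \<in> {1..T} \<Longrightarrow> nmem m ''destination'' t = destination P t"
    "rmem m ''dual'' = rmem m0 ''dual''" "rmem m ''demand'' 0 = demand P" "rmem m ''penalty'' 0 = penalty P"
proof -
  have "nmem m ''horizon'' = nmem m0 ''horizon''" "nmem m ''num_nodes'' = nmem m0 ''num_nodes''"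
    "nmem m ''node'' = node" "nmem m ''tail'' = nmem m0 ''tail''" "nmem m ''head'' = nmem m0 ''head''"
    "nmem m ''origin'' = nmem m0 ''origin''" "nmem m ''destination'' = nmem m0 ''destination''"
    "nmem m ''ptr'' = ptr" "nmem m ''arc'' = arc_at"
    by (rule bspec[OF conjunct1[OF assms[unfolded inputs_kept_def]]], simp)+
  moreover have "rmem m ''dual'' = rmem m0 ''dual''" "rmem m ''demand'' = rmem m0 ''demand''"
    "rmem m ''penalty'' = rmem m0 ''penalty''"
    by (rule bspec[OF conjunct2[OF assms[unfolded inputs_kept_def]]], simp)+
  ultimately show "nmem m ''horizon'' 0 = T" "nmem m ''num_nodes'' 0 = card V" "nmem m ''node'' = node"
    "nmem m ''ptr'' = ptr" "nmem m ''arc'' = arc_at"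
    "\<And>e. e \<in> arcs (net P) \<Longrightarrow> nmem m ''tail'' e = tail (net P) e"
    "\<And>e. e \<in> arcs (net P) \<Longrightarrow> nmem m ''head'' e = head (net P) e"
    "\<And>t. t \<in> {1..T} \<Longrightarrow> nmem m ''origin'' t = origin P t"
    "\<And>t. t \<in> {1..T} \<Longrightarrow> nmem m ''destination'' t = destination P t"
    "rmem m ''dual'' = rmem m0 ''dual''" "rmem m ''demand'' 0 = demand P" "rmem m ''penalty'' 0 = penalty P"
    using encoding(3-8) by simp_all
qed

lemma node_index:
  assumes "v \<in> V"
  obtains i where "i < card V" "v = node i"
proof -
  have "v \<in> node ` {..<card V}" using assms bij_betw_imp_surj_on[OF node_bij] by simp
  then show thesis using that by blast
qed

lemma run_reset_nodes:
  assumes m: "inputs_kept m"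
  shows "run reset_nodes m (card V * 30 + 20) (\<lambda>m'. \<forall>v\<in>V. rmem m' ''bp'' v = 0 \<and> nmem m' ''first'' v = 0)"
  unfolding reset_nodes_def
proof (rule run_For[where h = "card V" and k = 12 and I = "\<lambda>k m'. \<forall>i<k. rmem m' ''bp'' (node i) = 0 \<and> nmem m' ''first'' (node i) = 0"])
  fix m' assume "\<forall>i<card V. rmem m' ''bp'' (node i) = 0 \<and> nmem m' ''first'' (node i) = 0"
  then have *: "rmem m' ''bp'' (node i) = 0 \<and> nmem m' ''first'' (node i) = 0" if "i < card V" for i
    using that by blast
  show "\<forall>v\<in>V. rmem m' ''bp'' v = 0 \<and> nmem m' ''first'' v = 0"
  proof
    fix v assume "v \<in> V"
    then obtain i where "i < card V" "v = node i" by (rule node_index)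
    then show "rmem m' ''bp'' v = 0 \<and> nmem m' ''first'' v = 0" using * by simp
  qed
qed (auto intro!: run_RWrite_Then run_NWrite simp: frameD inputs[OF m] less_Suc_eq)

text \<open>
  All priorities are 0 at first, so any consistent choice of winners is a tournament; the left players
  win. The matches are filled in from the last to the first, each after its two predecessors.
\<close>

lemma run_setup_tree:
  assumes m: "inputs_kept m"
  shows "run setup_tree m (card V * 80 + 50) (\<lambda>m'. halves V (nmem m' ''half'') \<and>
    tournament V (nmem m' ''leaf'') (nmem m' ''win'') (\<lambda>_. 0))"
proof -
  let ?N = "card V"
  have inj: "node i = node k \<longleftrightarrow> i = k" if "i < ?N" "k < ?N" for i k
    using node_bij that by (auto simp: bij_betw_def inj_on_eq_iff)
  have node_V: "node i \<in> V" if "i < ?N" for i using node_bij that by (auto simp: bij_betw_def)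
  let ?I = "\<lambda>k m'. \<forall>i<k. nmem m' ''win'' (?N + i) = node i \<and> nmem m' ''leaf'' (node i) = ?N + i \<and>
    nmem m' ''half'' (i + i) = i \<and> nmem m' ''half'' (i + i + 1) = i"
  have "run (For ''k'' (NConst 0) (scalar ''num_nodes'') setup_node) m (?N * 60 + 20) (\<lambda>m'. ?I ?N m')"
  proof (rule run_For[where h = ?N and k = 40 and I = ?I])
    fix k m' assume k: "k < ?N" "nmem m' ''k'' 0 = k" and J: "?I k m'"
      and fr: "frame (For ''k'' (NConst 0) (scalar ''num_nodes'') setup_node) m m'"
    have in': "nmem m' ''num_nodes'' 0 = ?N" "nmem m' ''node'' = node"
      using inputs[OF m] by (simp_all add: frameD[OF fr] setup_node_def)
    have half_free: "k + k \<noteq> i + i" "k + k \<noteq> Suc (i + i)" "Suc (k + k) \<noteq> i + i" "Suc (k + k) \<noteq> Suc (i + i)"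
      if "i < k" for i using that by presburger+
    have "nmem m' ''win'' (?N + i) = node i \<and> nmem m' ''leaf'' (node i) = ?N + i \<and>
      nmem m' ''half'' (i + i) = i \<and> nmem m' ''half'' (Suc (i + i)) = i" "node i \<noteq> node k" if "i < k" for i
      using J that inj[of i k] k by simp_all
    then show "run setup_node m' 40 (\<lambda>m''. ?I (Suc k) (nwrite ''k'' 0 (Suc k) m''))"
      unfolding setup_node_def using k half_free
      by (intro run_NWrite_Then run_NWrite) (simp_all add: in' less_Suc_eq all_conj_distrib)
  qed (auto simp: frameD inputs[OF m] setup_node_def)
  then show ?thesis unfolding setup_tree_def
  proof (rule run_seq[where ?k2.0 = "?N * 20 + 20"])
    fix m1 assume J: "?I ?N m1"
      and fr: "frame (For ''k'' (NConst 0) (scalar ''num_nodes'') setup_node) m m1"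
    have N: "nmem m1 ''num_nodes'' 0 = ?N"
      using inputs(2)[OF m] by (simp add: frameD[OF fr] setup_node_def)
    have halves: "halves V (nmem m1 ''half'')"
      unfolding halves_def
    proof (intro allI impI)
      fix x assume "x < ?N + ?N"
      then have "x div 2 < ?N" "x = x div 2 + x div 2 \<or> x = x div 2 + x div 2 + 1" by linarith+
      then show "nmem m1 ''half'' x = x div 2" using J by metis
    qed
    have leaves: "leaves V (nmem m1 ''leaf'') (nmem m1 ''win'')"
      unfolding leaves_def
    proof (intro conjI ballI)
      fix v assume "v \<in> V"
      then obtain i where "i < ?N" "v = node i" by (rule node_index)
      then show "nmem m1 ''leaf'' v \<in> {?N..<?N + ?N}" "nmem m1 ''win'' (nmem m1 ''leaf'' v) = v"
        using J by simp_all
    next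
      fix x assume "x \<in> {?N..<?N + ?N}"
      then have x: "x - ?N < ?N" "x = ?N + (x - ?N)" by auto
      have "nmem m1 ''win'' x = node (x - ?N)" "nmem m1 ''leaf'' (node (x - ?N)) = x"
        using J x by metis+
      then show "nmem m1 ''win'' x \<in> V" "nmem m1 ''leaf'' (nmem m1 ''win'' x) = x"
        using node_V[OF x(1)] by simp_all
    qed
    let ?m2 = "nwrite ''x'' 0 (?N - 1) m1"
    let ?K = "\<lambda>x m'. nmem m' ''x'' 0 = x \<and> x < ?N \<and> leaves V (nmem m1 ''leaf'') (nmem m' ''win'') \<and>
      (\<forall>y\<in>{Suc x..<?N}. nmem m' ''win'' y = nmem m' ''win'' (y + y))"
    have "run (Loop (NLess (NConst 0) (scalar ''x'')) setup_match) ?m2 (?N * 20 + 10)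
      (\<lambda>m'. halves V (nmem m' ''half'') \<and> tournament V (nmem m' ''leaf'') (nmem m' ''win'') (\<lambda>_. 0))"
    proof (rule run_Loop[where I = ?K and g = "?N - 1" and \<phi> = "\<lambda>x. x * 20"])
      show "?K (?N - 1) ?m2" using leaves V_nonempty by auto
    next
      fix x m' assume K: "?K x m'" and fr2: "frame setup_match ?m2 m'" and "\<not> bval (NLess (NConst 0) (scalar ''x'')) m'"
      then have "x = 0" by simp
      with K have "\<forall>y\<in>{1..<?N}. played (nmem m' ''win'') (\<lambda>_. 0) y" unfolding played_def by simp
      with K halves show "halves V (nmem m' ''half'') \<and> tournament V (nmem m' ''leaf'') (nmem m' ''win'') (\<lambda>_. 0)"
        unfolding tournament_def by (simp add: frameD[OF fr2] setup_match_def)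
    next
      fix x m' assume K: "?K x m'" and "frame setup_match ?m2 m'" and b: "bval (NLess (NConst 0) (scalar ''x'')) m'"
      then obtain x' where x: "x = Suc x'" by (cases x) auto
      let ?w = "nmem m' ''win''"
      have "leaves V (nmem m1 ''leaf'') (?w(x := ?w (x + x)))"
        by (rule leaves_upd) (use K in auto)
      moreover have "(?w(x := ?w (x + x))) y = (?w(x := ?w (x + x))) (y + y)" if "y \<in> {x..<?N}" for y
        using K that x by (cases "y = x") simp_all
      ultimately have "run setup_match m' 15 (?K x')"
        unfolding setup_match_def using K x
        by (intro run_NWrite_Then run_NWrite) simp_all
      then show "\<exists>k. run setup_match m' k (\<lambda>m''. \<exists>x'. ?K x' m'' \<and> x' * 20 + k + 1 +
          bcost (NLess (NConst 0) (scalar ''x'')) \<le> x * 20)"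
        by (rule run_round[where I = ?K and g' = x']) (simp add: x)
    qed simp
    then show "run (Then (NWrite ''x'' (NConst 0) (NSub (scalar ''num_nodes'') (NConst 1)))
          (Loop (NLess (NConst 0) (scalar ''x'')) setup_match)) m1 (?N * 20 + 20)
      (\<lambda>m'. halves V (nmem m' ''half'') \<and> tournament V (nmem m' ''leaf'') (nmem m' ''win'') (\<lambda>_. 0))"
      by (intro run_NWrite_Then) (simp_all add: N run_mono)
  qed simp
qed

subsection \<open>The arcs common to an interval\<close>

text \<open>
  \<open>cnt e\<close> counts the time steps, starting with \<open>i\<close>, that have been scanned without finding that the
  arc \<open>e\<close> is missing. Hence \<open>e\<close> is common to the interval exactly if the count is maximal, and
  extending the interval by one time step only needs the arcs of that step.
\<close>

definition counted :: "nat \<Rightarrow> nat \<Rightarrow> nat \<Rightarrow> memory \<Rightarrow> bool" where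
  "counted i j e m \<longleftrightarrow>
     (if \<forall>t\<in>{i..<j}. e \<in> arcs_at P t
      then nmem m ''cnt'' e = j - i \<and> rmem m ''w'' e = (\<Sum>t\<in>{i..<j}. - (demand P * dual P t e))
      else nmem m ''cnt'' e < j - i)"

abbreviation used_arcs :: "nat set" where
  "used_arcs \<equiv> (\<Union>t\<in>{1..T}. arcs_at P t)"

lemma run_reset_arcs:
  assumes m: "inputs_kept m"
  shows "run reset_arcs m (T * num_arcs P * 40 + 30) (\<lambda>m'. \<forall>e\<in>used_arcs. counted i i e m')"
  unfolding reset_arcs_def
proof (rule run_For[where h = "ptr (Suc T)" and k = 12 and
      I = "\<lambda>k m'. \<forall>q<k. nmem m' ''cnt'' (arc_at q) = 0 \<and> rmem m' ''w'' (arc_at q) = 0"])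
  fix m' :: memory
  assume *: "\<forall>q<ptr (Suc T). nmem m' ''cnt'' (arc_at q) = 0 \<and> rmem m' ''w'' (arc_at q) = 0"
  show "\<forall>e\<in>used_arcs. counted i i e m'"
  proof
    fix e assume "e \<in> used_arcs"
    then obtain t where t: "t \<in> {1..T}" "e \<in> arcs_at P t" by blast
    then have "e \<in> arc_at ` {ptr t..<ptr (Suc t)}" using at_segment(3)[OF t(1)] by simp
    then obtain q where "q \<in> {ptr t..<ptr (Suc t)}" "e = arc_at q" by blast
    then show "counted i i e m'" using * ptr_mono[OF t(1)] unfolding counted_def by simp
  qed
next
  have "ptr (Suc T) * 26 \<le> T * num_arcs P * 26" using ptr_bound[of T] by simp
  then show "(ptr (Suc T) - nval (NConst 0) m) *
      (12 + 10 + ncost (NRead ''ptr'' (NAdd (scalar ''horizon'') (NConst 1)))) + 6 + ncost (NConst 0) +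
      ncost (NRead ''ptr'' (NAdd (scalar ''horizon'') (NConst 1))) \<le> T * num_arcs P * 40 + 30" by simp
qed (auto intro!: run_RWrite run_NWrite_Then simp: frameD inputs[OF m] less_Suc_eq)

lemma counted_cong:
  "nmem m' ''cnt'' e = nmem m ''cnt'' e \<Longrightarrow> rmem m' ''w'' e = rmem m ''w'' e \<Longrightarrow>
    counted i j e m' \<longleftrightarrow> counted i j e m"
  unfolding counted_def by simp

lemma counted_full:
  assumes "counted i j e m"
  shows "nmem m ''cnt'' e + i < j \<longleftrightarrow> \<not> (\<forall>t\<in>{i..<j}. e \<in> arcs_at P t)"
proof (cases "\<forall>t\<in>{i..<j}. e \<in> arcs_at P t")
  case True
  then have "nmem m ''cnt'' e = j - i" using assms unfolding counted_def by simp
  then show ?thesis using True by simp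
next
  case False
  then have "nmem m ''cnt'' e < j - i" using assms unfolding counted_def by (simp only: if_False)
  then show ?thesis using False by simp
qed

lemma counted_missing:
  assumes "counted i j e m" "i \<le> j" "\<not> (\<forall>t\<in>{i..<Suc j}. e \<in> arcs_at P t)"
  shows "counted i (Suc j) e m"
proof -
  have "nmem m ''cnt'' e \<le> j - i"
  proof (cases "\<forall>t\<in>{i..<j}. e \<in> arcs_at P t")
    case True
    then show ?thesis using assms(1) unfolding counted_def by simp
  next
    case False
    then show ?thesis using assms(1) unfolding counted_def by (simp only: if_False)
  qed
  then have "nmem m ''cnt'' e < Suc j - i" using assms(2) by simp
  then show ?thesis using assms(3) unfolding counted_def by (simp only: if_False)
qed

definition linked :: "nat set \<Rightarrow> memory \<Rightarrow> bool" where
  "linked A m \<longleftrightarrow> (\<forall>v\<in>V. \<exists>es. chain (nmem m ''next'') (nmem m ''first'' v) es \<and> distinct es \<and>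
     set es = {e \<in> A. head (net P) e = v})"

lemma linked_insert:
  assumes l: "linked A m" and e: "e \<notin> A"
    and m': "nmem m' ''next'' = (nmem m ''next'')(e := nmem m ''first'' (head (net P) e))"
      "nmem m' ''first'' = (nmem m ''first'')(head (net P) e := Suc e)"
  shows "linked (insert e A) m'"
  unfolding linked_def
proof
  fix v assume "v \<in> V"
  then obtain es where es: "chain (nmem m ''next'') (nmem m ''first'' v) es" "distinct es"
    "set es = {f \<in> A. head (net P) f = v}" using l unfolding linked_def by blast
  have e': "e \<notin> set es" using e es(3) by simp
  show "\<exists>es. chain (nmem m' ''next'') (nmem m' ''first'' v) es \<and> distinct es \<and>
     set es = {f \<in> insert e A. head (net P) f = v}"
  proof (cases "v = head (net P) e")
    case True
    have "chain (nmem m' ''next'') (nmem m' ''first'' v) (e # es)"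
      using es(1) e' True unfolding m' by (simp add: chain_upd)
    moreover have "set (e # es) = {f \<in> insert e A. head (net P) f = v}" using es(3) True by auto
    ultimately show ?thesis using es(2) e' by (intro exI[of _ "e # es"]) simp
  next
    case False
    have "chain (nmem m' ''next'') (nmem m' ''first'' v) es"
      using es(1) e' False unfolding m' by (simp add: chain_upd)
    moreover have "set es = {f \<in> insert e A. head (net P) f = v}" using es(3) False by auto
    ultimately show ?thesis using es(2) by blast
  qed
qed

lemma linked_cong:
  "linked A m \<Longrightarrow> nmem m' ''next'' = nmem m ''next'' \<Longrightarrow> nmem m' ''first'' = nmem m ''first'' \<Longrightarrow> linked A m'"
  unfolding linked_def by simp

text \<open>
  Only the arcs of time step \<open>j\<close> are touched, which keeps the work for one interval independent of its
  length.
\<close>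

lemma run_scan_arcs:
  assumes m: "inputs_kept m" and ij: "1 \<le> i" "i \<le> j" "j \<le> T"
    and mi: "nmem m ''i'' 0 = i" and mj: "nmem m ''j'' 0 = j"
    and cnt: "\<forall>e\<in>used_arcs. counted i j e m" and first: "\<forall>v\<in>V. nmem m ''first'' v = 0"
  shows "run scan_arcs m (num_arcs P * 80 + 30)
    (\<lambda>m'. (\<forall>e\<in>used_arcs. counted i (Suc j) e m') \<and> linked (common_arcs i j) m')"
proof -
  have jT: "j \<in> {1..T}" using ij by simp
  note seg = at_segment[OF jT]
  let ?Q = "\<lambda>q. arc_at ` {ptr j..<q}"
  define I where "I = (\<lambda>q m'. (\<forall>e\<in>used_arcs. counted i (if e \<in> ?Q q then Suc j else j) e m') \<and>
    linked (?Q q \<inter> common_arcs i j) m')"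
  let ?body = "Then (NWrite ''e'' (NConst 0) (NRead ''arc'' (scalar ''q'')))
     (Cond (NLess (NAdd (NRead ''cnt'' (scalar ''e'')) (scalar ''i'')) (scalar ''j'')) Skip extend_arc)"
  let ?for = "For ''q'' (NRead ''ptr'' (scalar ''j'')) (NRead ''ptr'' (NAdd (scalar ''j'') (NConst 1))) ?body"
  have I_cong: "I q m' \<Longrightarrow> I q (nwrite ''q'' 0 n m')" for q m' n
    unfolding I_def by (auto simp: counted_def linked_def)
  have "run ?for m (num_arcs P * 80 + 30) (I (ptr (Suc j)))"
  proof (rule run_For[where h = "ptr (Suc j)" and k = 60 and I = I])
    show "I (nval (NRead ''ptr'' (scalar ''j'')) m)
      (nwrite ''q'' 0 (nval (NRead ''ptr'' (scalar ''j'')) m) m)"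
    proof -
      have "linked {} m" unfolding linked_def using first by (auto intro!: exI[of _ "[]"])
      then show ?thesis
        using cnt by (intro I_cong) (simp add: I_def inputs[OF m] mj)
    qed
    show "nval (NRead ''ptr'' (scalar ''j'')) m \<le> ptr (Suc j)"
      using seg(1) by (simp add: inputs[OF m] mj)
    show "(ptr (Suc j) - nval (NRead ''ptr'' (scalar ''j'')) m) *
      (60 + 10 + ncost (NRead ''ptr'' (NAdd (scalar ''j'') (NConst 1)))) + 6 + ncost (NRead ''ptr'' (scalar ''j'')) +
      ncost (NRead ''ptr'' (NAdd (scalar ''j'') (NConst 1))) \<le> num_arcs P * 80 + 30"
      using mult_le_mono1[OF seg(5), of 75] by (simp add: inputs[OF m] mj)
  next
    fix q m' assume "frame ?for m m'"
    then show "nval (NRead ''ptr'' (NAdd (scalar ''j'') (NConst 1))) m' = ptr (Suc j)"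
      by (simp add: frameD extend_arc_def inputs[OF m] mj)
  next
    fix q m' assume q: "nval (NRead ''ptr'' (scalar ''j'')) m \<le> q" "q < ptr (Suc j)" "nmem m' ''q'' 0 = q"
      and J: "I q m'" and fr: "frame ?for m m'"
    let ?e = "arc_at q" and ?m1 = "nwrite ''e'' 0 (arc_at q) m'"
    have pq: "ptr j \<le> q" using q(1) by (simp add: inputs[OF m] mj)
    have eE: "?e \<in> arcs_at P j" using seg(3) pq q(2) by auto
    have eQ: "?e \<notin> ?Q q"
    proof
      assume "?e \<in> ?Q q"
      then obtain q' where q': "q' \<in> {ptr j..<q}" "arc_at q = arc_at q'" by (rule imageE) simp
      then have "q = q'" using inj_onD[OF seg(2) q'(2)] pq q(2) by simp
      with q'(1) show False by simp
    qed
    have Q: "?Q (Suc q) = insert ?e (?Q q)" using pq by (simp add: atLeastLessThanSuc)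
    have earc: "?e \<in> arcs (net P)" using eE at_step(1)[OF jT] by blast
    have eU: "?e \<in> used_arcs" using eE jT by blast
    have in': "nmem m' ''arc'' = arc_at" "nmem m' ''i'' 0 = i" "nmem m' ''j'' 0 = j"
      "nmem m' ''head'' ?e = head (net P) ?e" "rmem m' ''demand'' 0 = demand P"
      "rmem m' ''dual'' q = dual P j ?e"
      using inputs[OF m] mi mj earc seg(4)[OF pq q(2)] by (simp_all add: frameD[OF fr] extend_arc_def)
    have old: "counted i (if e \<in> ?Q q then Suc j else j) e m'" if "e \<in> used_arcs" for e
      using J that unfolding I_def by blast
    have ce: "counted i j ?e m'" using old[OF eU] unfolding if_not_P[OF eQ] .
    have other: "counted i (if e \<in> ?Q (Suc q) then Suc j else j) e m'" if "e \<in> used_arcs" "e \<noteq> ?e" for e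
    proof -
      have "e \<in> ?Q (Suc q) \<longleftrightarrow> e \<in> ?Q q" unfolding Q using that(2) by simp
      then show ?thesis using old[OF that(1)] by (simp only:)
    qed
    have self: "?e \<in> ?Q (Suc q)" unfolding Q by simp
    have lnk: "linked (?Q q \<inter> common_arcs i j) m'" using J unfolding I_def by blast
    have all_Suc: "(\<forall>t\<in>{i..<Suc j}. e \<in> arcs_at P t) \<longleftrightarrow> (\<forall>t\<in>{i..<j}. e \<in> arcs_at P t) \<and> e \<in> arcs_at P j" for e
      using ij(2) by (simp add: atLeastLessThanSuc conj_commute)
    have common: "e \<in> common_arcs i j \<longleftrightarrow> e \<in> arcs (net P) \<and> (\<forall>t\<in>{i..<Suc j}. e \<in> arcs_at P t)" for e
      unfolding common_arcs_def by (simp add: atLeastLessThanSuc_atLeastAtMost)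
    show "run ?body m' 60 (\<lambda>m''. I (Suc q) (nwrite ''q'' 0 (Suc q) m''))"
    proof (cases "\<forall>t\<in>{i..<j}. ?e \<in> arcs_at P t")
      case False
      then have notin: "?e \<notin> common_arcs i j" unfolding common all_Suc by blast
      have "counted i (if e \<in> ?Q (Suc q) then Suc j else j) e ?m1" if e: "e \<in> used_arcs" for e
      proof (cases "e = ?e")
        case True
        have "counted i (Suc j) ?e m'"
          by (rule counted_missing[OF ce ij(2)]) (use False all_Suc in blast)
        then show ?thesis unfolding True if_P[OF self] by (rule counted_cong[THEN iffD2, rotated 2]) simp_all
      next
        case False
        from other[OF e this] show ?thesis by (rule counted_cong[THEN iffD2, rotated 2]) simp_all
      qed
      moreover have eq: "?Q (Suc q) \<inter> common_arcs i j = ?Q q \<inter> common_arcs i j"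
        unfolding Q using notin by blast
      have "linked (?Q (Suc q) \<inter> common_arcs i j) ?m1"
        unfolding eq by (rule linked_cong[OF lnk]) simp_all
      ultimately have "I (Suc q) ?m1" unfolding I_def by blast
      moreover have "nmem m' ''cnt'' ?e + i < j" using counted_full[OF ce] False by blast
      ultimately show ?thesis
        by (intro run_NWrite_Then run_Cond[where k = 40] run_Skip) (simp_all add: q(3) in' I_cong)
    next
      case True
      then have com: "?e \<in> common_arcs i j" unfolding common all_Suc using eE earc by blast
      let ?m2 = "nwrite ''first'' (head (net P) ?e) (Suc ?e)
        (nwrite ''next'' ?e (nmem m' ''first'' (head (net P) ?e))
        (rwrite ''w'' ?e (rmem m' ''w'' ?e - demand P * dual P j ?e)
        (nwrite ''cnt'' ?e (Suc (nmem m' ''cnt'' ?e)) ?m1)))"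
      have "counted i (if e \<in> ?Q (Suc q) then Suc j else j) e ?m2" if e: "e \<in> used_arcs" for e
      proof (cases "e = ?e")
        case True
        have "nmem m' ''cnt'' ?e = j - i" "rmem m' ''w'' ?e = (\<Sum>t\<in>{i..<j}. - (demand P * dual P t ?e))"
          using ce \<open>\<forall>t\<in>{i..<j}. ?e \<in> arcs_at P t\<close> unfolding counted_def by simp_all
        moreover have "\<forall>t\<in>{i..<Suc j}. ?e \<in> arcs_at P t" using com unfolding common by blast
        ultimately have "counted i (Suc j) ?e ?m2" unfolding counted_def using ij(2) by (simp add: Suc_diff_le)
        then show ?thesis unfolding True if_P[OF self] .
      next
        case False
        from other[OF e this] show ?thesis
          by (rule counted_cong[THEN iffD2, rotated 2]) (use False in simp_all)
      qed
      moreover have "?Q (Suc q) \<inter> common_arcs i j = insert ?e (?Q q \<inter> common_arcs i j)"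
        unfolding Q using com by blast
      moreover have "linked (insert ?e (?Q q \<inter> common_arcs i j)) ?m2"
        by (rule linked_insert[OF lnk]) (use eQ in simp_all)
      ultimately have "I (Suc q) ?m2" unfolding I_def by simp
      moreover have "\<not> nmem m' ''cnt'' ?e + i < j" using counted_full[OF ce] True by blast
      ultimately show ?thesis
        unfolding extend_arc_def
        by (intro run_NWrite_Then run_Cond[where k = 45] run_NWrite run_RWrite_Then) (simp_all add: q(3) in' I_cong)
    qed
  qed (simp_all add: extend_arc_def)
  then show ?thesis
    unfolding scan_arcs_def
  proof (rule run_mono)
    fix m' assume J: "I (ptr (Suc j)) m'"
    have "counted i (Suc j) e m'" if e: "e \<in> used_arcs" for e
    proof -
      have c: "counted i (if e \<in> arcs_at P j then Suc j else j) e m'"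
        using J e unfolding I_def seg(3) by blast
      show ?thesis
      proof (cases "e \<in> arcs_at P j")
      case True
        then show ?thesis using c by simp
      next
        case False
        then have "counted i j e m'" using c by simp
        then show ?thesis by (rule counted_missing[OF _ ij(2)]) (use False ij(2) in auto)
      qed
    qed
    moreover have "arcs_at P j \<inter> common_arcs i j = common_arcs i j"
      using common_arcs_sub(2)[OF ij(2)] by blast
    ultimately show "(\<forall>e\<in>used_arcs. counted i (Suc j) e m') \<and> linked (common_arcs i j) m'"
      using J unfolding I_def seg(3) by simp
  qed simp
qed

end

section \<open>Recording the best interval\<close>

abbreviation NEq :: "nexp \<Rightarrow> nexp \<Rightarrow> bexp" where
  "NEq a b \<equiv> BAnd (BNot (NLess a b)) (BNot (NLess b a))"

text \<open>
  The best path for each start time is appended to the log \<open>pbuf\<close>, where \<open>pstart\<close> and \<open>pend\<close> delimit it;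
  replaced paths stay there as garbage. A two-dimensional table would need multiplication of addresses.
\<close>

definition copy_arc :: com where
  "copy_arc =
     Then (NWrite ''pbuf'' (scalar ''top'') (NRead ''succ'' (scalar ''v'')))
    (Then (NWrite ''top'' (NConst 0) (NAdd (scalar ''top'') (NConst 1)))
          (NWrite ''v'' (NConst 0) (NRead ''head'' (NRead ''succ'' (scalar ''v'')))))"

definition record_plan :: com where
  "record_plan =
     Then (RWrite ''g'' (scalar ''i'') (RRead ''cand'' (NConst 0)))
    (Then (NWrite ''last'' (scalar ''i'') (scalar ''j''))
    (Then (NWrite ''pstart'' (scalar ''i'') (scalar ''top''))
    (Then (NWrite ''v'' (NConst 0) (NRead ''origin'' (scalar ''i'')))
    (Then (Loop (BNot (NEq (scalar ''v'') (scalar ''D''))) copy_arc)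
          (NWrite ''pend'' (scalar ''i'') (scalar ''top''))))))"

definition try_interval :: com where
  "try_interval =
     Cond (BAnd (NLess (scalar ''broken'') (NConst 1))
                (RLess (RConst 0) (RRead ''bp'' (NRead ''origin'' (scalar ''i'')))))
       (Then (RWrite ''cand'' (NConst 0) (RAdd (RAdd (RRead ''dist'' (NRead ''origin'' (scalar ''i'')))
                (RRead ''penalty'' (NConst 0))) (RRead ''g'' (NAdd (scalar ''j'') (NConst 1)))))
         (Cond (BAnd (NLess (scalar ''i'') (scalar ''j''))
                     (BNot (RLess (RRead ''cand'' (NConst 0)) (RRead ''g'' (scalar ''i'')))))
           Skip record_plan))
       Skip"

lemma mod_try_interval [simp]:
  "nmod copy_arc = {''pbuf'', ''top'', ''v''}" "rmod copy_arc = {}"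
  "nmod try_interval = {''last'', ''pstart'', ''pend'', ''pbuf'', ''top'', ''v''}"
  "rmod try_interval = {''g'', ''cand''}"
  by (auto simp: try_interval_def record_plan_def copy_arc_def)

context encoded_pricing
begin

lemma run_copy:
  assumes m: "inputs_kept m" and ij: "1 \<le> i" "i \<le> j" "j \<le> T"
    and path: "pre_digraph.apath (interval_net i j) v es d"
    and succ: "\<forall>e\<in>set es. nmem m ''succ'' (tail (net P) e) = e"
    and mv: "nmem m ''v'' 0 = v" and md: "nmem m ''D'' 0 = d"
  defines "k \<equiv> nmem m ''top'' 0"
  shows "run (Loop (BNot (NEq (scalar ''v'') (scalar ''D''))) copy_arc) m (length es * 40 + 20)
    (\<lambda>m'. nmem m' ''top'' 0 = k + length es \<and> (\<forall>q<k. nmem m' ''pbuf'' q = nmem m ''pbuf'' q) \<and>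
      map (nmem m' ''pbuf'') [k..<k + length es] = es)"
proof -
  interpret H: wf_digraph "interval_net i j"
  proof -
    have "V \<noteq> {}" using V_nonempty by auto
    then obtain x where "x \<in> V" by blast
    then interpret shortest_paths "interval_net i j" "weight i j" x
      by (rule interval_shortest_paths[OF ij])
    show "wf_digraph (interval_net i j)" ..
  qed
  let ?b = "BNot (NEq (scalar ''v'') (scalar ''D''))"
  define I where "I = (\<lambda>es' (m'::memory). \<exists>done. es = done @ es' \<and>
    nmem m' ''top'' 0 = k + length done \<and> H.apath (nmem m' ''v'' 0) es' d \<and>
    (\<forall>q<k. nmem m' ''pbuf'' q = nmem m ''pbuf'' q) \<and> map (nmem m' ''pbuf'') [k..<k + length done] = done)"
  show ?thesis
  proof (rule run_Loop[where I = I and g = es and \<phi> = "\<lambda>es. length es * 40"])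
    show "I es m" unfolding I_def using path mv by (intro exI[of _ "[]"]) (simp add: k_def)
  next
    fix es' m' assume J: "I es' m'" and fr: "frame copy_arc m m'" and "\<not> bval ?b m'"
    then have "nmem m' ''v'' 0 = d" using md by (simp add: frameD[OF fr])
    moreover obtain "done" where d: "es = done @ es'"
      "nmem m' ''top'' 0 = k + length done" "H.apath (nmem m' ''v'' 0) es' d"
      "\<forall>q<k. nmem m' ''pbuf'' q = nmem m ''pbuf'' q" "map (nmem m' ''pbuf'') [k..<k + length done] = done"
      using J unfolding I_def by blast
    ultimately have "es' = []" using H.apath_nonempty_ends[OF d(3)] by blast
    with d show "nmem m' ''top'' 0 = k + length es \<and> (\<forall>q<k. nmem m' ''pbuf'' q = nmem m ''pbuf'' q) \<and>
      map (nmem m' ''pbuf'') [k..<k + length es] = es" by simp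
  next
    fix es' m' assume J: "I es' m'" and fr: "frame copy_arc m m'" and b: "bval ?b m'"
    let ?v = "nmem m' ''v'' 0"
    have vd: "?v \<noteq> d" using b md by (auto simp: frameD[OF fr])
    obtain "done" where d: "es = done @ es'"
      "nmem m' ''top'' 0 = k + length done" "H.apath ?v es' d"
      "\<forall>q<k. nmem m' ''pbuf'' q = nmem m ''pbuf'' q" "map (nmem m' ''pbuf'') [k..<k + length done] = done"
      using J unfolding I_def by blast
    obtain e es'' where es': "es' = e # es''"
      using d(3) vd by (cases es') (simp_all add: H.apath_Nil_iff)
    have e: "e \<in> common_arcs i j" "tail (net P) e = ?v" "H.apath (head (net P) e) es'' d"
      using d(3) unfolding es' by (simp_all add: H.apath_Cons_iff)
    have s: "nmem m' ''succ'' ?v = e"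
      using succ d(1) es' e(2) by (simp add: frameD[OF fr])
    have h: "nmem m' ''head'' e = head (net P) e"
      using inputs(7)[OF m] e(1) common_arcs_sub(1) by (auto simp: frameD[OF fr])
    let ?m2 = "nwrite ''v'' 0 (head (net P) e) (nwrite ''top'' 0 (Suc (k + length done))
      (nwrite ''pbuf'' (k + length done) e m'))"
    have "I es'' ?m2"
      unfolding I_def
    proof (intro exI[of _ "done @ [e]"] conjI)
      have "map ((nmem m' ''pbuf'')(k + length done := e)) [k..<k + length done] = done"
        using d(5) by simp
      then show "map (nmem ?m2 ''pbuf'') [k..<k + length (done @ [e])] = done @ [e]" by simp
    qed (use d es' e in simp_all)
    then have r: "run copy_arc m' 22 (I es'')"
      unfolding copy_arc_def by (intro run_NWrite_Then run_NWrite) (simp_all add: d(2) s h)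
    show "\<exists>k. run copy_arc m' k (\<lambda>m''. \<exists>g. I g m'' \<and> length g * 40 + k + 1 + bcost ?b \<le> length es' * 40)"
      by (rule run_round[where I = I, OF r]) (simp add: es')
  qed simp
qed

lemma inputs_kept_nwrite [simp]:
  assumes "x \<notin> {''horizon'', ''num_nodes'', ''node'', ''tail'', ''head'', ''origin'', ''destination'', ''ptr'', ''arc''}"
  shows "inputs_kept (nwrite x a n m) \<longleftrightarrow> inputs_kept m"
proof -
  have "nmem (nwrite x a n m) y = nmem m y"
    if "y \<in> {''horizon'', ''num_nodes'', ''node'', ''tail'', ''head'', ''origin'', ''destination'', ''ptr'', ''arc''}" for y
  proof -
    have "y \<noteq> x" using assms that by blast
    then show ?thesis by (simp only: mem_simps if_False)
  qed
  then show ?thesis unfolding inputs_kept_def mem_simps(2) by (simp only: cong: ball_cong)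
qed

lemma inputs_kept_rwrite [simp]:
  assumes "x \<notin> {''dual'', ''demand'', ''penalty''}"
  shows "inputs_kept (rwrite x a r m) \<longleftrightarrow> inputs_kept m"
proof -
  have "rmem (rwrite x a r m) y = rmem m y" if "y \<in> {''dual'', ''demand'', ''penalty''}" for y
  proof -
    have "y \<noteq> x" using assms that by blast
    then show ?thesis by (simp only: mem_simps if_False)
  qed
  then show ?thesis unfolding inputs_kept_def mem_simps(3) by (simp only: cong: ball_cong)
qed

definition plan_path :: "memory \<Rightarrow> nat \<Rightarrow> path" where
  "plan_path m i = (origin P i, map (nmem m ''pbuf'') [nmem m ''pstart'' i..<nmem m ''pend'' i])"

text \<open>
  The penalty is charged for the first path, too. So \<open>g i\<close> exceeds the cost of the best sequence from
  time step \<open>i\<close> on by one penalty, and \<open>g (Suc T) = 0\<close>.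
\<close>

definition planned :: "nat \<Rightarrow> memory \<Rightarrow> bool" where
  "planned i m \<longleftrightarrow>
     i \<le> nmem m ''last'' i \<and> nmem m ''last'' i \<le> T \<and>
     nmem m ''pstart'' i \<le> nmem m ''pend'' i \<and> nmem m ''pend'' i \<le> nmem m ''top'' 0 \<and>
     nmem m ''pend'' i - nmem m ''pstart'' i \<le> card V \<and>
     (\<forall>t\<in>{i..nmem m ''last'' i}. valid_path P t (plan_path m i)) \<and>
     rmem m ''g'' i = penalty P + (\<Sum>t = i..nmem m ''last'' i. path_cost P t (plan_path m i)) +
       rmem m ''g'' (Suc (nmem m ''last'' i))"

definition best_upto :: "nat \<Rightarrow> nat \<Rightarrow> (nat \<Rightarrow> real) \<Rightarrow> bool" where
  "best_upto i j g \<longleftrightarrow> (\<forall>j'\<in>{i..<j}. \<forall>p. (\<forall>t\<in>{i..j'}. valid_path P t p) \<longrightarrow>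
     g i \<le> penalty P + (\<Sum>t = i..j'. path_cost P t p) + g (Suc j'))"

definition later_done :: "nat \<Rightarrow> memory \<Rightarrow> bool" where
  "later_done i m \<longleftrightarrow>
     (\<forall>k\<in>{i<..T}. planned k m \<and> best_upto k (Suc T) (rmem m ''g'')) \<and> rmem m ''g'' (Suc T) = 0"

text \<open>
  Working on start time \<open>i\<close> changes nothing that the plans of later start times depend on.
\<close>

definition extends :: "nat \<Rightarrow> memory \<Rightarrow> memory \<Rightarrow> bool" where
  "extends i m m' \<longleftrightarrow>
     (\<forall>x>i. nmem m' ''last'' x = nmem m ''last'' x \<and> nmem m' ''pstart'' x = nmem m ''pstart'' x \<and>
        nmem m' ''pend'' x = nmem m ''pend'' x \<and> rmem m' ''g'' x = rmem m ''g'' x) \<and>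
     (\<forall>q<nmem m ''top'' 0. nmem m' ''pbuf'' q = nmem m ''pbuf'' q) \<and> nmem m ''top'' 0 \<le> nmem m' ''top'' 0"

lemma planned_extends:
  assumes "extends i m m'" "i < k" "planned k m"
  shows "planned k m'"
proof -
  have k: "nmem m' ''last'' k = nmem m ''last'' k" "nmem m' ''pstart'' k = nmem m ''pstart'' k"
    "nmem m' ''pend'' k = nmem m ''pend'' k" "rmem m' ''g'' k = rmem m ''g'' k"
    using assms(1,2) unfolding extends_def by simp_all
  have le: "k \<le> nmem m ''last'' k" "nmem m ''pend'' k \<le> nmem m ''top'' 0"
    using assms(3) unfolding planned_def by simp_all
  then have g: "rmem m' ''g'' (Suc (nmem m ''last'' k)) = rmem m ''g'' (Suc (nmem m ''last'' k))"
    using assms(1,2) unfolding extends_def by simp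
  have "map (nmem m' ''pbuf'') [nmem m ''pstart'' k..<nmem m ''pend'' k] =
      map (nmem m ''pbuf'') [nmem m ''pstart'' k..<nmem m ''pend'' k]"
    using assms(1) le(2) unfolding extends_def by simp
  then have p: "plan_path m' k = plan_path m k" unfolding plan_path_def k by simp
  have "nmem m ''top'' 0 \<le> nmem m' ''top'' 0" using assms(1) unfolding extends_def by simp
  then show ?thesis using assms(3) unfolding planned_def k g p by simp
qed

lemma later_done_extends:
  assumes "extends i m m'" "later_done i m" "i \<le> T"
  shows "later_done i m'"
proof -
  have g: "rmem m' ''g'' x = rmem m ''g'' x" if "i < x" for x
    using assms(1) that unfolding extends_def by simp
  have "best_upto k (Suc T) (rmem m' ''g'')" if "k \<in> {i<..T}" for k
  proof -
    have b: "best_upto k (Suc T) (rmem m ''g'')" using assms(2) that unfolding later_done_def by blast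
    show ?thesis unfolding best_upto_def
    proof (intro ballI allI impI)
      fix j' p assume j': "j' \<in> {k..<Suc T}" and p: "\<forall>t\<in>{k..j'}. valid_path P t p"
      have "i < k" "i < Suc j'" using that j' by auto
      then show "rmem m' ''g'' k \<le> penalty P + (\<Sum>t = k..j'. path_cost P t p) + rmem m' ''g'' (Suc j')"
        using b[unfolded best_upto_def, rule_format, OF j'] p by (simp add: g)
    qed
  qed
  moreover have "planned k m'" if "k \<in> {i<..T}" for k
  proof (rule planned_extends[OF assms(1)])
    show "i < k" using that by simp
    show "planned k m" using assms(2) that unfolding later_done_def by blast
  qed
  moreover have "rmem m' ''g'' (Suc T) = 0"
    using assms(2,3) unfolding later_done_def by (simp add: g)
  ultimately show ?thesis unfolding later_done_def by blast
qed

lemma run_record_plan: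
  assumes m: "inputs_kept m" and ij: "1 \<le> i" "i \<le> j" "j \<le> T"
    and mi: "nmem m ''i'' 0 = i" and mj: "nmem m ''j'' 0 = j" and md: "nmem m ''D'' 0 = destination P i"
    and path: "pre_digraph.apath (interval_net i j) (origin P i) es (destination P i)"
    and succ: "\<forall>e\<in>set es. nmem m ''succ'' (tail (net P) e) = e"
    and valid_es: "\<forall>t\<in>{i..j}. valid_path P t (origin P i, es)"
    and cand: "rmem m ''cand'' 0 =
      penalty P + (\<Sum>t = i..j. path_cost P t (origin P i, es)) + rmem m ''g'' (Suc j)"
  shows "run record_plan m (card V * 40 + 80)
    (\<lambda>m'. extends i m m' \<and> planned i m' \<and> rmem m' ''g'' = (rmem m ''g'')(i := rmem m ''cand'' 0))"
proof -
  let ?k = "nmem m ''top'' 0" and ?c = "rmem m ''cand'' 0"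
  let ?m2 = "nwrite ''v'' 0 (origin P i) (nwrite ''pstart'' i ?k (nwrite ''last'' i j (rwrite ''g'' i ?c m)))"
  have iT: "i \<in> {1..T}" using ij by simp
  interpret H: shortest_paths "interval_net i j" "weight i j" "destination P i"
    by (rule interval_shortest_paths[OF ij at_step(3)[OF iT]])
  have len: "length es \<le> card V" using H.length_apath[OF path] by simp
  have in2: "inputs_kept ?m2" using m by simp
  have "run (Loop (BNot (NEq (scalar ''v'') (scalar ''D''))) copy_arc) ?m2 (length es * 40 + 20)
    (\<lambda>m'. nmem m' ''top'' 0 = ?k + length es \<and> (\<forall>q<?k. nmem m' ''pbuf'' q = nmem m ''pbuf'' q) \<and>
      map (nmem m' ''pbuf'') [?k..<?k + length es] = es)"
    using run_copy[OF in2 ij path] succ md by simp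
  then have "run (Then (Loop (BNot (NEq (scalar ''v'') (scalar ''D''))) copy_arc)
      (NWrite ''pend'' (scalar ''i'') (scalar ''top''))) ?m2 (length es * 40 + 20 + 10)
    (\<lambda>m'. extends i m m' \<and> planned i m' \<and> rmem m' ''g'' = (rmem m ''g'')(i := ?c))"
  proof (rule run_seq[OF _ _ order_refl])
    fix m3 assume J: "nmem m3 ''top'' 0 = ?k + length es \<and> (\<forall>q<?k. nmem m3 ''pbuf'' q = nmem m ''pbuf'' q) \<and>
      map (nmem m3 ''pbuf'') [?k..<?k + length es] = es"
      and fr: "frame (Loop (BNot (NEq (scalar ''v'') (scalar ''D''))) copy_arc) ?m2 m3"
    let ?m4 = "nwrite ''pend'' i (?k + length es) m3"
    have mem: "nmem ?m4 ''last'' = (nmem m ''last'')(i := j)" "nmem ?m4 ''pstart'' = (nmem m ''pstart'')(i := ?k)"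
      "nmem ?m4 ''pend'' = (nmem m ''pend'')(i := ?k + length es)" "rmem ?m4 ''g'' = (rmem m ''g'')(i := ?c)"
      "nmem ?m4 ''pbuf'' = nmem m3 ''pbuf''" "nmem ?m4 ''top'' 0 = ?k + length es" "nmem m3 ''i'' 0 = i"
      using J mi by (simp_all add: frameD[OF fr])
    have pp: "plan_path ?m4 i = (origin P i, es)"
      using J unfolding plan_path_def mem by simp
    have "planned i ?m4"
      unfolding planned_def pp mem using ij len valid_es cand by simp
    moreover have "extends i m ?m4" unfolding extends_def mem using J by simp
    ultimately show "run (NWrite ''pend'' (scalar ''i'') (scalar ''top'')) m3 10
      (\<lambda>m'. extends i m m' \<and> planned i m' \<and> rmem m' ''g'' = (rmem m ''g'')(i := ?c))"
      using mem(4) J by (intro run_NWrite) (simp_all add: mem(7))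
  qed
  then show ?thesis
    unfolding record_plan_def using len
    by (intro run_NWrite_Then run_RWrite_Then)
      (simp_all add: mi mj inputs(8)[OF m iT] run_mono)
qed

end

section \<open>The search for one start time\<close>

definition check_ends :: com where
  "check_ends =
     Cond (BAnd (NEq (NRead ''origin'' (scalar ''j'')) (NRead ''origin'' (scalar ''i'')))
                (NEq (NRead ''destination'' (scalar ''j'')) (NRead ''destination'' (scalar ''i''))))
       Skip (NWrite ''broken'' (NConst 0) (NConst 1))"

definition extend_interval :: com where
  "extend_interval =
     Then check_ends (Then reset_nodes (Then scan_arcs (Then dijkstra try_interval)))"

definition plan_start :: com where
  "plan_start =
     Then (NWrite ''D'' (NConst 0) (NRead ''destination'' (scalar ''i'')))
    (Then (NWrite ''broken'' (NConst 0) (NConst 0))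
    (Then reset_arcs
    (Then (For ''j'' (scalar ''i'') (NAdd (scalar ''horizon'') (NConst 1)) extend_interval)
          (NWrite ''i'' (NConst 0) (NSub (scalar ''i'') (NConst 1))))))"

lemma mod_extend_interval [simp]:
  "nmod check_ends = {''broken''}" "rmod check_ends = {}"
  "nmod extend_interval = {''broken'', ''k'', ''first'', ''q'', ''e'', ''cnt'', ''next'', ''v'', ''u'', ''p'',
     ''succ'', ''x'', ''win'', ''last'', ''pstart'', ''pend'', ''pbuf'', ''top''}"
  "rmod extend_interval = {''bp'', ''w'', ''nd'', ''np'', ''dist'', ''pr'', ''g'', ''cand''}"
  by (auto simp: extend_interval_def check_ends_def)

context encoded_pricing
begin

text \<open>
  If the end points differ or the origin is not reached, no path is valid throughout the interval and
  there is nothing to compare with. Intervals of length one always have a path, so a plan exists after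
  the first round.
\<close>

lemma run_try_interval:
  assumes m: "inputs_kept m" and ij: "1 \<le> i" "i \<le> j" "j \<le> T"
    and mi: "nmem m ''i'' 0 = i" and mj: "nmem m ''j'' 0 = j" and md: "nmem m ''D'' 0 = destination P i"
    and state: "shortest_paths.dijkstra_state (interval_net i j) (weight i j) (destination P i) S S {} m"
    and broken: "nmem m ''broken'' 0 = 0 \<longleftrightarrow>
      (\<forall>t\<in>{i..j}. origin P t = origin P i \<and> destination P t = destination P i)"
    and later: "later_done i m" and plan: "i < j \<Longrightarrow> planned i m" and best: "best_upto i j (rmem m ''g'')"
  shows "run try_interval m (card V * 40 + 200)
    (\<lambda>m'. later_done i m' \<and> planned i m' \<and> best_upto i (Suc j) (rmem m' ''g''))"
proof -
  let ?O = "origin P i" and ?d = "rmem m ''dist''" and ?g = "rmem m ''g''"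
  let ?c = "?d ?O + penalty P + ?g (Suc j)"
  let ?Q = "\<lambda>m'. later_done i m' \<and> planned i m' \<and> best_upto i (Suc j) (rmem m' ''g'')"
  have iT: "i \<in> {1..T}" using ij by simp
  interpret H: shortest_paths "interval_net i j" "weight i j" "destination P i"
    by (rule interval_shortest_paths[OF ij at_step(3)[OF iT]])
  note R = H.dijkstra_result[OF state]
  have O: "?O \<in> V" by (rule at_step(2)[OF iT])
  have bp: "0 < rmem m ''bp'' ?O \<longleftrightarrow> ?O \<in> S" using R(2)[of ?O] O by simp
  have org: "nmem m ''origin'' i = ?O" by (rule inputs(8)[OF m iT])
  have lower: "nmem m ''broken'' 0 = 0 \<and> ?O \<in> S \<and> ?d ?O \<le> (\<Sum>t = i..j. path_cost P t p)"
    if p: "\<forall>t\<in>{i..j}. valid_path P t p" for p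
  proof -
    obtain u es where ues: "p = (u, es)" by (cases p)
    have *: "(\<forall>t\<in>{i..j}. origin P t = origin P i \<and> destination P t = destination P i) \<and> u = ?O \<and>
        H.apath ?O es (destination P i)"
      using p unfolding ues valid_on_interval[OF ij] .
    then have path: "H.apath ?O es (destination P i)" by blast
    have "?O \<in> S \<and> ?d ?O \<le> H.length_of es" by (rule R(5)[OF H.awalkI_apath[OF path]])
    moreover have "distinct es" by (rule apath_distinct_arcs[OF path])
    moreover have "nmem m ''broken'' 0 = 0" using * broken by blast
    ultimately show ?thesis using path_cost_interval[of es u i j] unfolding ues by simp
  qed
  have best_g: "best_upto i (Suc j) g" if g: "\<And>x. i < x \<Longrightarrow> g x = ?g x" "best_upto i j g"
      "\<And>p. \<forall>t\<in>{i..j}. valid_path P t p \<Longrightarrow> g i \<le> penalty P + (\<Sum>t = i..j. path_cost P t p) + ?g (Suc j)" for g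
    unfolding best_upto_def
  proof (intro ballI allI impI)
    fix j' p assume j': "j' \<in> {i..<Suc j}" and p: "\<forall>t\<in>{i..j'}. valid_path P t p"
    show "g i \<le> penalty P + (\<Sum>t = i..j'. path_cost P t p) + g (Suc j')"
    proof (cases "j' = j")
      case True
      then show ?thesis using g(3)[of p] p g(1)[of "Suc j"] ij by simp
    next
      case False
      then have "j' \<in> {i..<j}" using j' by simp
      then show ?thesis using g(2) p unfolding best_upto_def by blast
    qed
  qed
  show ?thesis
  proof (cases "nmem m ''broken'' 0 = 0 \<and> ?O \<in> S")
    case False
    then have none: "\<not> (\<forall>t\<in>{i..j}. valid_path P t p)" for p using lower by blast
    have "i < j"
    proof (rule ccontr)
      assume "\<not> i < j"
      then have "i = j" using ij by simp
      then show False using none at_step(4)[OF iT] by auto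
    qed
    moreover have "best_upto i (Suc j) ?g" by (rule best_g[OF refl best]) (use none in blast)
    ultimately have "?Q m" using later plan by blast
    then have "run Skip m (card V * 40 + 160) ?Q" by (intro run_Skip) simp_all
    then show ?thesis
      unfolding try_interval_def
      by (intro run_Cond[where k = "card V * 40 + 160"])
        (use False bp in \<open>auto simp: mi org\<close>)
  next
    case ok: True
    let ?m1 = "rwrite ''cand'' 0 ?c m"
    have in1: "inputs_kept ?m1" using m by simp
    have cond: "i < j \<and> \<not> ?c < ?g i \<Longrightarrow> ?Q ?m1"
    proof -
      assume c: "i < j \<and> \<not> ?c < ?g i"
      have ext: "extends i m ?m1" unfolding extends_def by simp
      have ext': "planned i ?m1 \<longleftrightarrow> planned i m" unfolding planned_def plan_path_def by simp
      have "best_upto i (Suc j) ?g"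
      proof (rule best_g[OF refl best])
        fix p assume "\<forall>t\<in>{i..j}. valid_path P t p"
        from lower[OF this] c show "?g i \<le> penalty P + (\<Sum>t = i..j. path_cost P t p) + ?g (Suc j)" by simp
      qed
      then show "?Q ?m1" using later_done_extends[OF ext later] iT plan c ext' by simp
    qed
    have rec: "run record_plan ?m1 (card V * 40 + 80) ?Q" if c: "\<not> i < j \<or> ?c < ?g i"
    proof -
      obtain es where es: "H.apath ?O es (destination P i)"
        "\<forall>e\<in>set es. nmem m ''succ'' (tail (net P) e) = e" "H.length_of es = ?d ?O"
        using R(4)[of ?O] ok by auto
      have v: "\<forall>t\<in>{i..j}. valid_path P t (?O, es)"
        unfolding valid_on_interval[OF ij] using ok broken es(1) by blast
      have cost: "(\<Sum>t = i..j. path_cost P t (?O, es)) = ?d ?O"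
        using path_cost_interval[OF apath_distinct_arcs[OF es(1)]] es(3) by simp
      have "run record_plan ?m1 (card V * 40 + 80)
        (\<lambda>m'. extends i ?m1 m' \<and> planned i m' \<and> rmem m' ''g'' = (rmem ?m1 ''g'')(i := rmem ?m1 ''cand'' 0))"
        by (rule run_record_plan[OF in1 ij _ _ _ es(1) _ v]) (use mi mj md es(2) cost in simp_all)
      then show ?thesis
      proof (rule run_mono)
        fix m' assume *: "extends i ?m1 m' \<and> planned i m' \<and> rmem m' ''g'' = (rmem ?m1 ''g'')(i := rmem ?m1 ''cand'' 0)"
        have ext: "extends i m m'" using * unfolding extends_def by simp
        have g: "rmem m' ''g'' = ?g(i := ?c)" using * by simp
        have "best_upto i (Suc j) (?g(i := ?c))"
        proof (rule best_g)
          show "best_upto i j (?g(i := ?c))"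
            unfolding best_upto_def
          proof (intro ballI allI impI)
            fix j' p assume j': "j' \<in> {i..<j}" and p: "\<forall>t\<in>{i..j'}. valid_path P t p"
            have "?g i \<le> penalty P + (\<Sum>t = i..j'. path_cost P t p) + ?g (Suc j')"
              using best j' p unfolding best_upto_def by blast
            moreover have "?c < ?g i" "Suc j' \<noteq> i" using c j' by auto
            ultimately show "(?g(i := ?c)) i \<le> penalty P + (\<Sum>t = i..j'. path_cost P t p) + (?g(i := ?c)) (Suc j')"
              by simp
          qed
        next
          fix p assume "\<forall>t\<in>{i..j}. valid_path P t p"
          from lower[OF this] show "(?g(i := ?c)) i \<le> penalty P + (\<Sum>t = i..j. path_cost P t p) + ?g (Suc j)" by simp
        qed simp
        moreover have "later_done i m'" by (rule later_done_extends[OF ext later]) (use iT in simp)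
        moreover have "planned i m'" using * by blast
        ultimately show "?Q m'" unfolding g by blast
      qed simp
    qed
    have "run (Cond (BAnd (NLess (scalar ''i'') (scalar ''j''))
                     (BNot (RLess (RRead ''cand'' (NConst 0)) (RRead ''g'' (scalar ''i'')))))
           Skip record_plan) ?m1 (card V * 40 + 120) ?Q"
      using cond rec by (intro run_Cond[where k = "card V * 40 + 80"] run_Skip) (simp_all add: mi mj)
    then have "run (Then (RWrite ''cand'' (NConst 0) (RAdd (RAdd (RRead ''dist'' (NRead ''origin'' (scalar ''i'')))
                (RRead ''penalty'' (NConst 0))) (RRead ''g'' (NAdd (scalar ''j'') (NConst 1)))))
         (Cond (BAnd (NLess (scalar ''i'') (scalar ''j''))
                     (BNot (RLess (RRead ''cand'' (NConst 0)) (RRead ''g'' (scalar ''i'')))))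
           Skip record_plan)) m (card V * 40 + 160) ?Q"
      by (intro run_RWrite_Then) (simp_all add: mi mj org inputs(12)[OF m] run_mono)
    then show ?thesis
      unfolding try_interval_def
      by (intro run_Cond[where k = "card V * 40 + 160"])
        (use ok bp in \<open>auto simp: mi org\<close>)
  qed
qed

text \<open>
  Dijkstra's algorithm ends with all priorities 0, the state in which the next run needs the tournament.
  It is set up only once.
\<close>

definition searching :: "nat \<Rightarrow> memory \<Rightarrow> bool" where
  "searching i m \<longleftrightarrow>
     inputs_kept m \<and> halves V (nmem m ''half'') \<and>
     tournament V (nmem m ''leaf'') (nmem m ''win'') (rmem m ''pr'') \<and>
     (\<forall>v\<in>V. rmem m ''pr'' v = 0) \<and> later_done i m"

definition same_ends :: "nat \<Rightarrow> nat \<Rightarrow> bool" where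
  "same_ends i j \<longleftrightarrow> (\<forall>t\<in>{i..<j}. origin P t = origin P i \<and> destination P t = destination P i)"

definition extending :: "nat \<Rightarrow> nat \<Rightarrow> memory \<Rightarrow> bool" where
  "extending i j m \<longleftrightarrow>
     searching i m \<and> nmem m ''i'' 0 = i \<and> nmem m ''D'' 0 = destination P i \<and>
     (\<forall>e\<in>used_arcs. counted i j e m) \<and> (nmem m ''broken'' 0 = 0 \<longleftrightarrow> same_ends i j) \<and>
     (i < j \<longrightarrow> planned i m) \<and> best_upto i j (rmem m ''g'')"

definition dijkstra_budget :: "nat \<Rightarrow> nat" where
  "dijkstra_budget L = 40 * L + 60 + card V * (40 * L + 100) + num_arcs P * (40 * L + 110)"

lemma later_done_cong:
  assumes "later_done i m" "i \<le> T"
    and "nmem m' ''last'' = nmem m ''last''" "nmem m' ''pstart'' = nmem m ''pstart''"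
    "nmem m' ''pend'' = nmem m ''pend''" "nmem m' ''pbuf'' = nmem m ''pbuf''" "nmem m' ''top'' = nmem m ''top''"
    "rmem m' ''g'' = rmem m ''g''"
  shows "later_done i m'"
proof (rule later_done_extends[OF _ assms(1,2)])
  show "extends i m m'" unfolding extends_def assms(3-8) by simp
qed

lemma planned_cong:
  assumes "nmem m' ''last'' = nmem m ''last''" "nmem m' ''pstart'' = nmem m ''pstart''"
    "nmem m' ''pend'' = nmem m ''pend''" "nmem m' ''pbuf'' = nmem m ''pbuf''" "nmem m' ''top'' = nmem m ''top''"
    "rmem m' ''g'' = rmem m ''g''"
  shows "planned i m' \<longleftrightarrow> planned i m"
  unfolding planned_def plan_path_def assms ..

lemma run_extend_interval:
  assumes ext: "extending i j m" and ij: "1 \<le> i" "i \<le> j" "j \<le> T" and mj: "nmem m ''j'' 0 = j"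
    and L: "card V + card V \<le> 2 ^ L"
  shows "run extend_interval m (card V * 70 + num_arcs P * 80 + dijkstra_budget L + 400)
    (extending i (Suc j))"
proof -
  have iT: "i \<in> {1..T}" and jT: "j \<in> {1..T}" using ij by simp_all
  have s: "searching i m" and mi: "nmem m ''i'' 0 = i" and mD: "nmem m ''D'' 0 = destination P i"
    and cnt: "\<forall>e\<in>used_arcs. counted i j e m" and brk: "nmem m ''broken'' 0 = 0 \<longleftrightarrow> same_ends i j"
    and plan: "i < j \<longrightarrow> planned i m" and best: "best_upto i j (rmem m ''g'')"
    using ext unfolding extending_def by - (elim conjE, assumption)+
  have m: "inputs_kept m" and half: "halves V (nmem m ''half'')"
    and tour: "tournament V (nmem m ''leaf'') (nmem m ''win'') (rmem m ''pr'')"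
    and pr0: "\<forall>v\<in>V. rmem m ''pr'' v = 0" and later: "later_done i m"
    using s unfolding searching_def by - (elim conjE, assumption)+
  interpret H: shortest_paths "interval_net i j" "weight i j" "destination P i"
    by (rule interval_shortest_paths[OF ij at_step(3)[OF iT]])
  have ends: "same_ends i (Suc j) \<longleftrightarrow>
      same_ends i j \<and> origin P j = origin P i \<and> destination P j = destination P i"
    using ij(2) unfolding same_ends_def by (simp add: atLeastLessThanSuc conj_commute)
  have check: "run check_ends m 60 (\<lambda>m1. nmem m1 ''broken'' 0 = 0 \<longleftrightarrow> same_ends i (Suc j))"
    unfolding check_ends_def
    by (intro run_Cond[where k = 10] run_Skip run_NWrite)
      (simp_all add: mi mj inputs(8,9)[OF m iT] inputs(8,9)[OF m jT] ends brk, auto)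
  let ?Q = "extending i (Suc j)"
  show ?thesis unfolding extend_interval_def
  proof (rule run_seq[OF check])
    fix m1 assume brk1: "nmem m1 ''broken'' 0 = 0 \<longleftrightarrow> same_ends i (Suc j)" and f1: "frame check_ends m m1"
    have k1: "inputs_kept m1" by (rule inputs_kept_frame[OF m f1]) simp_all
    show "run (Then reset_nodes (Then scan_arcs (Then dijkstra try_interval))) m1
      (card V * 30 + 20 + (num_arcs P * 80 + 30 + (dijkstra_budget L + (card V * 40 + 200)))) ?Q"
    proof (rule run_seq[OF run_reset_nodes[OF k1] _ order_refl])
      fix m2 assume z2: "\<forall>v\<in>V. rmem m2 ''bp'' v = 0 \<and> nmem m2 ''first'' v = 0" and f2: "frame reset_nodes m1 m2"
      have k2: "inputs_kept m2" by (rule inputs_kept_frame[OF k1 f2]) simp_all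
      have cnt2: "\<forall>e\<in>used_arcs. counted i j e m2"
        using cnt by (simp add: counted_def frameD[OF f1] frameD[OF f2])
      show "run (Then scan_arcs (Then dijkstra try_interval)) m2
        (num_arcs P * 80 + 30 + (dijkstra_budget L + (card V * 40 + 200))) ?Q"
      proof (rule run_seq[OF run_scan_arcs[OF k2 ij] _ order_refl])
        show "nmem m2 ''i'' 0 = i" "nmem m2 ''j'' 0 = j"
          using mi mj by (simp_all add: frameD[OF f1] frameD[OF f2])
        show "\<forall>e\<in>used_arcs. counted i j e m2" by (rule cnt2)
        show "\<forall>v\<in>V. nmem m2 ''first'' v = 0" using z2 by blast
      next
        fix m3 assume J3: "(\<forall>e\<in>used_arcs. counted i (Suc j) e m3) \<and> linked (common_arcs i j) m3"
          and f3: "frame scan_arcs m2 m3"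
        have k3: "inputs_kept m3" by (rule inputs_kept_frame[OF k2 f3]) simp_all
        note f123 = frameD[OF f1] frameD[OF f2] frameD[OF f3]
        have w3: "rmem m3 ''w'' e = weight i j e" if "e \<in> common_arcs i j" for e
        proof -
          have e: "\<forall>t\<in>{i..<Suc j}. e \<in> arcs_at P t" using that unfolding common_arcs_def by auto
          have "e \<in> arcs_at P j" by (rule bspec[OF e]) (use ij in simp)
          then have "e \<in> used_arcs" using jT by blast
          then have "counted i (Suc j) e m3" using J3 by blast
          from this[unfolded counted_def if_P[OF e], THEN conjunct2] show ?thesis
            unfolding weight_def atLeastLessThanSuc_atLeastAtMost .
        qed
        have net: "H.network m3"
          unfolding H.network_def interval_net_simps
        proof (intro conjI ballI)
          show "halves V (nmem m3 ''half'')" using half by (simp add: f123)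
        next
          fix e assume e: "e \<in> common_arcs i j"
          show "nmem m3 ''tail'' e = tail (net P) e"
            using inputs(6)[OF k3] e common_arcs_sub(1) by blast
          show "rmem m3 ''w'' e = weight i j e" by (rule w3[OF e])
        next
          fix v assume "v \<in> V"
          then show "\<exists>es. chain (nmem m3 ''next'') (nmem m3 ''first'' v) es \<and> distinct es \<and>
            set es = {e \<in> common_arcs i j. head (net P) e = v}"
            using J3 unfolding linked_def by blast
        qed
        have tour3: "tournament V (nmem m3 ''leaf'') (nmem m3 ''win'') (rmem m3 ''pr'')"
          using tour by (simp add: f123)
        have zero3: "rmem m3 ''bp'' v = 0 \<and> rmem m3 ''pr'' v = 0" if "v \<in> V" for v
          using z2 pr0 that by (simp add: f123)
        have D3: "nmem m3 ''D'' 0 = destination P i" using mD by (simp add: f123)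
        have dij: "run dijkstra m3 (dijkstra_budget L) (\<lambda>m'. \<exists>S. H.dijkstra_state S S {} m')"
        proof (rule run_mono[OF H.run_dijkstra[OF net]])
          show "40 * L + 60 + card (verts (interval_net i j)) * (40 * L + 100) +
              card (arcs (interval_net i j)) * (40 * L + 110) \<le> dijkstra_budget L"
            using mult_le_mono1[OF card_common_arcs[OF ij], of "40 * L + 110"]
            unfolding dijkstra_budget_def by simp
        qed (use L tour3 zero3 D3 in simp_all)
        show "run (Then dijkstra try_interval) m3 (dijkstra_budget L + (card V * 40 + 200)) ?Q"
        proof (rule run_seq[OF dij _ order_refl])
          fix m4 assume "\<exists>S. H.dijkstra_state S S {} m4" and f4: "frame dijkstra m3 m4"
          then obtain S where S: "H.dijkstra_state S S {} m4" by blast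
          have k4: "inputs_kept m4" by (rule inputs_kept_frame[OF k3 f4]) simp_all
          note f1234 = f123 frameD[OF f4]
          have later4: "later_done i m4"
            by (rule later_done_cong[OF later]) (use iT in \<open>simp_all add: f1234\<close>)
          have plan4: "planned i m4" if "i < j"
          proof -
            have "planned i m4 \<longleftrightarrow> planned i m" by (rule planned_cong) (simp_all add: f1234)
            with plan that show ?thesis by simp
          qed
          have best4: "best_upto i j (rmem m4 ''g'')" using best by (simp add: f1234)
          have b4: "nmem m4 ''broken'' = nmem m1 ''broken''"
            by (simp add: frameD[OF f2] frameD[OF f3] frameD[OF f4])
          have brk4: "nmem m4 ''broken'' 0 = 0 \<longleftrightarrow>
              (\<forall>t\<in>{i..j}. origin P t = origin P i \<and> destination P t = destination P i)"
            using brk1 unfolding same_ends_def atLeastLessThanSuc_atLeastAtMost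
            unfolding b4 .
          have "run try_interval m4 (card V * 40 + 200)
            (\<lambda>m'. later_done i m' \<and> planned i m' \<and> best_upto i (Suc j) (rmem m' ''g''))"
            by (rule run_try_interval[OF k4 ij _ _ _ S brk4 later4 plan4 best4])
              (use mi mj mD in \<open>simp_all add: f1234\<close>)
          then show "run try_interval m4 (card V * 40 + 200) ?Q"
          proof (rule run_frame)
            fix m5 assume J5: "later_done i m5 \<and> planned i m5 \<and> best_upto i (Suc j) (rmem m5 ''g'')"
              and f5: "frame try_interval m4 m5"
            have k5: "inputs_kept m5" by (rule inputs_kept_frame[OF k4 f5]) simp_all
            have "halves V (nmem m5 ''half'')" using half by (simp add: f1234 frameD[OF f5])
            moreover have "tournament V (nmem m5 ''leaf'') (nmem m5 ''win'') (rmem m5 ''pr'')"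
              using H.dijkstra_result(3)[OF S] by (simp add: frameD[OF f5])
            moreover have "\<forall>v\<in>V. rmem m5 ''pr'' v = 0"
              using H.dijkstra_result(1)[OF S] by (simp add: frameD[OF f5])
            ultimately have "searching i m5" using k5 J5 unfolding searching_def by blast
            moreover have "nmem m5 ''i'' 0 = i" "nmem m5 ''D'' 0 = destination P i"
              using mi mD by (simp_all add: f1234 frameD[OF f5])
            moreover have "\<forall>e\<in>used_arcs. counted i (Suc j) e m5"
            proof
              fix e assume "e \<in> used_arcs"
              then have "counted i (Suc j) e m3" using J3 by blast
              then show "counted i (Suc j) e m5"
                by (rule counted_cong[THEN iffD2, rotated 2]) (simp_all add: frameD[OF f4] frameD[OF f5])
            qed
            moreover have "nmem m5 ''broken'' 0 = nmem m1 ''broken'' 0"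
              by (simp add: frameD[OF f2] frameD[OF f3] frameD[OF f4] frameD[OF f5])
            ultimately show "extending i (Suc j) m5"
              unfolding extending_def using J5 brk1 by simp
          qed
        qed
      qed
    qed
  qed simp
qed

end

definition plan_all :: com where
  "plan_all =
     Then setup_tree
    (Then (NWrite ''i'' (NConst 0) (scalar ''horizon''))
          (Loop (NLess (NConst 0) (scalar ''i'')) plan_start))"

lemma mod_plan [simp]:
  "nmod plan_start = {''D'', ''i'', ''j'', ''broken'', ''k'', ''first'', ''q'', ''e'', ''cnt'', ''next'', ''v'', ''u'', ''p'',
     ''succ'', ''x'', ''win'', ''last'', ''pstart'', ''pend'', ''pbuf'', ''top''}"
  "rmod plan_start = {''bp'', ''w'', ''nd'', ''np'', ''dist'', ''pr'', ''g'', ''cand''}"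
  "nmod plan_all = {''D'', ''i'', ''j'', ''broken'', ''k'', ''first'', ''q'', ''e'', ''cnt'', ''next'', ''v'', ''u'', ''p'',
     ''succ'', ''x'', ''win'', ''leaf'', ''half'', ''last'', ''pstart'', ''pend'', ''pbuf'', ''top''}"
  "rmod plan_all = {''bp'', ''w'', ''nd'', ''np'', ''dist'', ''pr'', ''g'', ''cand''}"
  by (auto simp: plan_start_def plan_all_def)

context encoded_pricing
begin

definition extend_budget :: "nat \<Rightarrow> nat" where
  "extend_budget L = card V * 70 + num_arcs P * 80 + dijkstra_budget L + 400"

definition plan_budget :: "nat \<Rightarrow> nat" where
  "plan_budget L = T * num_arcs P * 40 + T * (extend_budget L + 20) + 100"

lemma searching_cong:
  assumes "searching i m" "i \<le> T" "inputs_kept m'"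
    and "nmem m' ''half'' = nmem m ''half''" "nmem m' ''leaf'' = nmem m ''leaf''"
    "nmem m' ''win'' = nmem m ''win''" "rmem m' ''pr'' = rmem m ''pr''"
    and mem: "nmem m' ''last'' = nmem m ''last''" "nmem m' ''pstart'' = nmem m ''pstart''"
    "nmem m' ''pend'' = nmem m ''pend''" "nmem m' ''pbuf'' = nmem m ''pbuf''" "nmem m' ''top'' = nmem m ''top''"
    "rmem m' ''g'' = rmem m ''g''"
  shows "searching i m'"
proof -
  have "later_done i m'"
    by (rule later_done_cong[OF _ assms(2) mem]) (use assms(1) in \<open>simp add: searching_def\<close>)
  then show ?thesis using assms(1,3) unfolding searching_def assms(4-7) by blast
qed

lemma later_done_pred:
  assumes "later_done (Suc i) m" "planned (Suc i) m" "best_upto (Suc i) (Suc T) (rmem m ''g'')"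
  shows "later_done i m"
  unfolding later_done_def
proof (intro conjI ballI)
  fix k assume "k \<in> {i<..T}"
  then have "k = Suc i \<or> k \<in> {Suc i<..T}" by auto
  then show "planned k m" "best_upto k (Suc T) (rmem m ''g'')"
    using assms unfolding later_done_def by blast+
qed (use assms(1) in \<open>simp add: later_done_def\<close>)

lemma run_plan_start:
  assumes s: "searching (Suc i) m" and mi: "nmem m ''i'' 0 = Suc i" and iT: "Suc i \<le> T"
    and L: "card V + card V \<le> 2 ^ L"
  shows "run plan_start m (plan_budget L) (\<lambda>m'. searching i m' \<and> nmem m' ''i'' 0 = i)"
proof -
  have m: "inputs_kept m" using s unfolding searching_def by blast
  have i1: "Suc i \<in> {1..T}" using iT by simp
  let ?Q = "\<lambda>m'. searching i m' \<and> nmem m' ''i'' 0 = i"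
  let ?m1 = "nwrite ''broken'' 0 0 (nwrite ''D'' 0 (destination P (Suc i)) m)"
  have s1: "searching (Suc i) ?m1"
    by (rule searching_cong[OF s iT]) (use m in simp_all)
  have in1: "inputs_kept ?m1" using m by simp
  let ?for = "For ''j'' (scalar ''i'') (NAdd (scalar ''horizon'') (NConst 1)) extend_interval"
  let ?dec = "NWrite ''i'' (NConst 0) (NSub (scalar ''i'') (NConst 1))"
  have "run (Then reset_arcs (Then ?for ?dec)) ?m1
    (T * num_arcs P * 40 + 30 + (T * (extend_budget L + 20) + 20 + 10)) ?Q"
  proof (rule run_seq[OF run_reset_arcs[OF in1, where i = "Suc i"] _ order_refl])
    fix m2 assume c2: "\<forall>e\<in>used_arcs. counted (Suc i) (Suc i) e m2" and f2: "frame reset_arcs ?m1 m2"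
    have in2: "inputs_kept m2" by (rule inputs_kept_frame[OF in1 f2]) simp_all
    have s2: "searching (Suc i) m2"
      by (rule searching_cong[OF s1 iT in2]) (simp_all add: frameD[OF f2])
    have i2: "nmem m2 ''i'' 0 = Suc i" using mi by (simp add: frameD[OF f2])
    let ?I = "\<lambda>j m'. extending (Suc i) j m'"
    have ext_j: "?I j (nwrite ''j'' 0 n m')" if "?I j m'" for j n m'
    proof -
      let ?m = "nwrite ''j'' 0 n m'"
      have s': "searching (Suc i) m'" using that unfolding extending_def by blast
      then have "inputs_kept ?m" unfolding searching_def by simp
      then have "searching (Suc i) ?m" by (intro searching_cong[OF s' iT]) simp_all
      moreover have "planned (Suc i) ?m \<longleftrightarrow> planned (Suc i) m'" by (rule planned_cong) simp_all
      moreover have "counted (Suc i) j e ?m \<longleftrightarrow> counted (Suc i) j e m'" for e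
        by (rule counted_cong) simp_all
      ultimately show ?thesis using that unfolding extending_def by simp
    qed
    have "run ?for m2 (T * (extend_budget L + 20) + 20) (?I (Suc T))"
    proof (rule run_For[where h = "Suc T" and k = "extend_budget L" and I = ?I])
      have "nmem m2 ''D'' 0 = destination P (Suc i)" "nmem m2 ''broken'' 0 = 0" by (simp_all add: frameD[OF f2])
      then have "?I (Suc i) m2"
        unfolding extending_def using s2 i2 c2 by (simp add: same_ends_def best_upto_def)
      then show "?I (nval (scalar ''i'') m2) (nwrite ''j'' 0 (nval (scalar ''i'') m2) m2)"
        using ext_j by (simp add: i2)
    next
      show "nval (scalar ''i'') m2 \<le> Suc T" using iT by (simp add: i2)
    next
      fix j m' assume "?I j m'"
      then have "inputs_kept m'" unfolding extending_def searching_def by blast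
      then show "nval (NAdd (scalar ''horizon'') (NConst 1)) m' = Suc T" by (simp add: inputs)
    next
      fix j m' assume j: "nval (scalar ''i'') m2 \<le> j" "j < Suc T" "nmem m' ''j'' 0 = j" and J: "?I j m'"
      have "run extend_interval m' (extend_budget L) (?I (Suc j))"
        unfolding extend_budget_def
        by (rule run_extend_interval[OF J _ _ _ j(3) L]) (use j in \<open>simp_all add: i2\<close>)
      then show "run extend_interval m' (extend_budget L) (\<lambda>m''. ?I (Suc j) (nwrite ''j'' 0 (Suc j) m''))"
        by (rule run_mono) (simp_all add: ext_j)
    next
      have "(Suc T - Suc i) * (14 + extend_budget L) \<le> T * (extend_budget L + 20)"
        by (intro mult_le_mono) simp_all
      then show "(Suc T - nval (scalar ''i'') m2) * (extend_budget L + 10 + ncost (NAdd (scalar ''horizon'') (NConst 1))) +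
        6 + ncost (scalar ''i'') + ncost (NAdd (scalar ''horizon'') (NConst 1)) \<le> T * (extend_budget L + 20) + 20"
        by (simp add: i2)
    qed simp_all
    then show "run (Then ?for ?dec) m2 (T * (extend_budget L + 20) + 20 + 10) ?Q"
    proof (rule run_seq[OF _ _ order_refl])
      fix m3 assume J: "?I (Suc T) m3"
      let ?m4 = "nwrite ''i'' 0 i m3"
      have s3: "searching (Suc i) m3" and i3: "nmem m3 ''i'' 0 = Suc i" and p3: "planned (Suc i) m3"
        and b3: "best_upto (Suc i) (Suc T) (rmem m3 ''g'')"
      proof -
        have *: "searching (Suc i) m3 \<and> nmem m3 ''i'' 0 = Suc i \<and> (Suc i < Suc T \<longrightarrow> planned (Suc i) m3) \<and>
            best_upto (Suc i) (Suc T) (rmem m3 ''g'')"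
          using J unfolding extending_def by blast
        moreover have "Suc i < Suc T" using iT by simp
        ultimately show "searching (Suc i) m3" "nmem m3 ''i'' 0 = Suc i" "planned (Suc i) m3"
          "best_upto (Suc i) (Suc T) (rmem m3 ''g'')" by blast+
      qed
      have "later_done (Suc i) m3" using s3 unfolding searching_def by blast
      from later_done_pred[OF this p3 b3] have s3': "searching i m3"
        using s3 unfolding searching_def by blast
      have "inputs_kept ?m4" using s3 unfolding searching_def by simp
      then have "searching i ?m4"
        by (intro searching_cong[OF s3']) (use iT in simp_all)
      then show "run ?dec m3 10 ?Q"
        by (intro run_NWrite) (simp_all add: i3)
    qed
  qed
  then show ?thesis
    unfolding plan_start_def plan_budget_def
    by (intro run_NWrite_Then) (simp_all add: mi inputs(9)[OF m i1] run_mono)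
qed

lemma run_plan_all:
  assumes L: "card V + card V \<le> 2 ^ L"
  shows "run plan_all m0 (card V * 80 + 50 + (T * (plan_budget L + 10) + 20)) (searching 0)"
proof -
  have kept: "inputs_kept m0" unfolding inputs_kept_def by (intro conjI ballI refl)
  have rzero: "rmem m0 x = (\<lambda>_. 0)" if "x \<notin> {''dual'', ''demand'', ''penalty''}" for x
    using scratch_zero(2)[THEN spec, THEN mp, OF that] .
  show ?thesis unfolding plan_all_def
  proof (rule run_seq[OF run_setup_tree[OF kept] _ order_refl])
    fix m1 assume J: "halves V (nmem m1 ''half'') \<and> tournament V (nmem m1 ''leaf'') (nmem m1 ''win'') (\<lambda>_. 0)"
      and f1: "frame setup_tree m0 m1"
    have k1: "inputs_kept m1" by (rule inputs_kept_frame[OF kept f1]) simp_all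
    have pr1: "rmem m1 ''pr'' = (\<lambda>_. 0)" using rzero[of "''pr''"] by (simp add: frameD[OF f1])
    have g1: "rmem m1 ''g'' = (\<lambda>_. 0)" using rzero[of "''g''"] by (simp add: frameD[OF f1])
    have s1: "searching T m1"
      unfolding searching_def later_done_def using k1 J by (simp add: pr1 g1)
    let ?m2 = "nwrite ''i'' 0 T m1"
    let ?I = "\<lambda>i m. searching i m \<and> nmem m ''i'' 0 = i \<and> i \<le> T"
    have "run (Loop (NLess (NConst 0) (scalar ''i'')) plan_start) ?m2 (T * (plan_budget L + 10) + 10) (searching 0)"
    proof (rule run_Loop[where I = ?I and g = T and \<phi> = "\<lambda>i. i * (plan_budget L + 10)"])
      have "searching T ?m2" by (rule searching_cong[OF s1]) (use k1 in simp_all)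
      then show "?I T ?m2" by simp
    next
      fix i m' assume "?I i m'" "\<not> bval (NLess (NConst 0) (scalar ''i'')) m'"
      then show "searching 0 m'" by simp
    next
      fix i m' assume J: "?I i m'" and b: "bval (NLess (NConst 0) (scalar ''i'')) m'"
      then obtain i' where i: "i = Suc i'" by (cases i) auto
      have "run plan_start m' (plan_budget L) (\<lambda>m'. searching i' m' \<and> nmem m' ''i'' 0 = i')"
        by (rule run_plan_start[OF _ _ _ L]) (use J i in simp_all)
      then have "run plan_start m' (plan_budget L) (?I i')"
        by (rule run_mono) (use J i in simp_all)
      then show "\<exists>k. run plan_start m' k (\<lambda>m''. \<exists>i'. ?I i' m'' \<and> i' * (plan_budget L + 10) + k + 1 +
          bcost (NLess (NConst 0) (scalar ''i'')) \<le> i * (plan_budget L + 10))"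
        by (rule run_round[where I = ?I and g' = i']) (simp add: i)
    qed simp
    then show "run (Then (NWrite ''i'' (NConst 0) (scalar ''horizon''))
          (Loop (NLess (NConst 0) (scalar ''i'')) plan_start)) m1 (T * (plan_budget L + 10) + 20) (searching 0)"
      by (intro run_NWrite_Then) (simp_all add: inputs(1)[OF k1] run_mono)
  qed
qed

end

section \<open>Writing the output\<close>

text \<open>
  The start of the interval containing \<open>t\<close>. The value at 0 is the start of the first interval, so that
  time step 1 needs no case of its own.
\<close>

primrec interval_start :: "(nat \<Rightarrow> nat) \<Rightarrow> nat \<Rightarrow> nat" where
  "interval_start l 0 = 1"
| "interval_start l (Suc t) = (if l (interval_start l t) < Suc t then Suc t else interval_start l t)"

lemma interval_start_bounds: "1 \<le> t \<Longrightarrow> 1 \<le> interval_start l t \<and> interval_start l t \<le> t"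
proof (induction t rule: dec_induct)
  case base
  show ?case by simp
next
  case (step t)
  then show ?case by simp
qed

definition output_arc :: com where
  "output_arc =
     Then (NWrite ''out_arc'' (scalar ''o'') (NRead ''pbuf'' (scalar ''q'')))
          (NWrite ''o'' (NConst 0) (NAdd (scalar ''o'') (NConst 1)))"

definition output_path :: com where
  "output_path =
     Then (Cond (NLess (NRead ''last'' (scalar ''cur'')) (scalar ''t'')) (NWrite ''cur'' (NConst 0) (scalar ''t'')) Skip)
    (Then (NWrite ''out_start'' (scalar ''t'') (NRead ''origin'' (scalar ''t'')))
    (Then (NWrite ''out_ptr'' (scalar ''t'') (scalar ''o''))
    (Then (For ''q'' (NRead ''pstart'' (scalar ''cur'')) (NRead ''pend'' (scalar ''cur'')) output_arc)
          (NWrite ''out_ptr'' (NAdd (scalar ''t'') (NConst 1)) (scalar ''o'')))))"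

definition output_all :: com where
  "output_all =
     Then (NWrite ''cur'' (NConst 0) (NConst 1))
          (For ''t'' (NConst 1) (NAdd (scalar ''horizon'') (NConst 1)) output_path)"

definition all_in_one_pricing :: com where
  "all_in_one_pricing = Then plan_all output_all"

lemma mod_output [simp]:
  "nmod output_arc = {''out_arc'', ''o''}" "rmod output_arc = {}"
  "nmod output_path = {''cur'', ''out_start'', ''out_ptr'', ''q'', ''out_arc'', ''o''}" "rmod output_path = {}"
  by (auto simp: output_path_def output_arc_def)

context encoded_pricing
begin

definition written :: "memory \<Rightarrow> nat \<Rightarrow> memory \<Rightarrow> bool" where
  "written m s m' \<longleftrightarrow>
     nmem m' ''out_start'' s = origin P s \<and> nmem m' ''out_ptr'' s \<le> nmem m' ''out_ptr'' (Suc s) \<and>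
     nmem m' ''out_ptr'' (Suc s) \<le> nmem m' ''o'' 0 \<and>
     segment (nmem m' ''out_arc'') (nmem m' ''out_ptr'') s =
       snd (plan_path m (interval_start (nmem m ''last'') s))"

text \<open>
  Each round writes the boundary pointer of its predecessor once more; the second conjunct ensures that
  this does not move it.
\<close>

definition writing :: "memory \<Rightarrow> nat \<Rightarrow> memory \<Rightarrow> bool" where
  "writing m t m' \<longleftrightarrow>
     nmem m' ''cur'' 0 = interval_start (nmem m ''last'') (t - 1) \<and>
     (1 < t \<longrightarrow> nmem m' ''out_ptr'' t = nmem m' ''o'' 0) \<and> (\<forall>s\<in>{1..<t}. written m s m')"

lemma run_output_path:
  assumes keep: "inputs_kept m'" "nmem m' ''last'' = nmem m ''last''" "nmem m' ''pstart'' = nmem m ''pstart''"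
      "nmem m' ''pend'' = nmem m ''pend''" "nmem m' ''pbuf'' = nmem m ''pbuf''"
    and t: "t \<in> {1..T}" and mt: "nmem m' ''t'' 0 = t" and w: "writing m t m'"
    and planned: "planned (interval_start (nmem m ''last'') t) m"
  shows "run output_path m' (card V * 40 + 100) (writing m (Suc t))"
proof -
  let ?l = "nmem m ''last''" let ?i = "interval_start ?l t"
  let ?ps = "nmem m ''pstart'' ?i" and ?pe = "nmem m ''pend'' ?i" and ?pbuf = "nmem m ''pbuf''"
  let ?o = "nmem m' ''o'' 0" and ?arc = "nmem m' ''out_arc''"
  have pl: "?ps \<le> ?pe" "?pe - ?ps \<le> card V" using planned unfolding planned_def by simp_all
  have cur: "nmem m' ''cur'' 0 = interval_start ?l (t - 1)" using w unfolding writing_def by blast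
  have next_i: "?i = (if ?l (nmem m' ''cur'' 0) < t then t else nmem m' ''cur'' 0)"
    using t unfolding cur by (cases t) simp_all
  let ?sel = "Cond (NLess (NRead ''last'' (scalar ''cur'')) (scalar ''t'')) (NWrite ''cur'' (NConst 0) (scalar ''t'')) Skip"
  have sel: "run ?sel m' 20 (\<lambda>m1. nmem m1 ''cur'' 0 = ?i)"
    by (intro run_Cond[where k = 10] run_NWrite run_Skip) (simp_all add: next_i keep mt)
  show ?thesis unfolding output_path_def
  proof (rule run_seq[OF sel])
    fix m1 assume c1: "nmem m1 ''cur'' 0 = ?i" and f1: "frame ?sel m' m1"
    let ?m2 = "nwrite ''out_ptr'' t ?o (nwrite ''out_start'' t (origin P t) m1)"
    let ?for = "For ''q'' (NRead ''pstart'' (scalar ''cur'')) (NRead ''pend'' (scalar ''cur'')) output_arc"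
    let ?I = "\<lambda>q m3. nmem m3 ''o'' 0 = ?o + (q - ?ps) \<and> (\<forall>x<?o. nmem m3 ''out_arc'' x = ?arc x) \<and>
      map (nmem m3 ''out_arc'') [?o..<?o + (q - ?ps)] = map ?pbuf [?ps..<q]"
    have o1: "nmem m1 ''o'' 0 = ?o" "nmem m1 ''t'' 0 = t" "nmem m1 ''origin'' t = origin P t"
      using inputs(8)[OF keep(1) t] by (simp_all add: frameD[OF f1] mt)
    have "run ?for ?m2 (card V * 40 + 30) (?I ?pe)"
    proof (rule run_For[where h = ?pe and k = 20 and I = ?I])
      fix q m3 assume q: "nval (NRead ''pstart'' (scalar ''cur'')) ?m2 \<le> q" "q < ?pe" "nmem m3 ''q'' 0 = q"
        and J: "?I q m3" and f3: "frame ?for ?m2 m3"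
      have q': "?ps \<le> q" using q(1) by (simp add: c1 frameD[OF f1] keep)
      have pb: "nmem m3 ''pbuf'' = ?pbuf" by (simp add: frameD[OF f3] frameD[OF f1] keep)
      have sq: "Suc q - ?ps = Suc (q - ?ps)" using q' by simp
      let ?n = "?o + (q - ?ps)"
      have o3: "nmem m3 ''o'' 0 = ?n" using J by blast
      have "?I (Suc q) (nwrite ''o'' 0 (Suc ?n) (nwrite ''out_arc'' ?n (?pbuf q) m3))"
      proof (intro conjI)
        show "nmem (nwrite ''o'' 0 (Suc ?n) (nwrite ''out_arc'' ?n (?pbuf q) m3)) ''o'' 0 = ?o + (Suc q - ?ps)"
          by (simp add: sq)
        show "\<forall>x<?o. nmem (nwrite ''o'' 0 (Suc ?n) (nwrite ''out_arc'' ?n (?pbuf q) m3)) ''out_arc'' x = ?arc x"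
          using J by simp
        show "map (nmem (nwrite ''o'' 0 (Suc ?n) (nwrite ''out_arc'' ?n (?pbuf q) m3)) ''out_arc'')
            [?o..<?o + (Suc q - ?ps)] = map ?pbuf [?ps..<Suc q]"
          using J q' unfolding sq by simp
      qed
      then show "run output_arc m3 20 (\<lambda>m''. ?I (Suc q) (nwrite ''q'' 0 (Suc q) m''))"
        unfolding output_arc_def by (intro run_NWrite_Then run_NWrite) (simp_all add: q(3) o3 pb)
    next
      have "(?pe - ?ps) * 34 \<le> card V * 40" using mult_le_mono[OF pl(2), of 34 40] by simp
      then show "(?pe - nval (NRead ''pstart'' (scalar ''cur'')) ?m2) * (20 + 10 + ncost (NRead ''pend'' (scalar ''cur''))) +
        6 + ncost (NRead ''pstart'' (scalar ''cur'')) + ncost (NRead ''pend'' (scalar ''cur'')) \<le> card V * 40 + 30"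
        by (simp add: c1 frameD[OF f1] keep)
    next
      fix q m3 assume "frame ?for ?m2 m3"
      then show "nval (NRead ''pend'' (scalar ''cur'')) m3 = ?pe"
        by (simp add: frameD c1 frameD[OF f1] keep)
    qed (use pl in \<open>simp_all add: c1 frameD[OF f1] keep mt\<close>)
    then have "run (Then ?for (NWrite ''out_ptr'' (NAdd (scalar ''t'') (NConst 1)) (scalar ''o''))) ?m2
      (card V * 40 + 30 + 10) (writing m (Suc t))"
    proof (rule run_seq[OF _ _ order_refl])
      fix m3 assume J: "?I ?pe m3" and f3: "frame ?for ?m2 m3"
      let ?o' = "?o + (?pe - ?ps)"
      let ?m4 = "nwrite ''out_ptr'' (Suc t) ?o' m3"
      have mem: "nmem ?m4 ''out_start'' = (nmem m' ''out_start'')(t := origin P t)"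
        "nmem ?m4 ''out_ptr'' = (nmem m' ''out_ptr'')(t := ?o, Suc t := ?o')"
        "nmem ?m4 ''cur'' 0 = ?i" "nmem ?m4 ''o'' 0 = ?o'"
        using J by (simp_all add: frameD[OF f3] frameD[OF f1] c1)
      have arcs4: "nmem ?m4 ''out_arc'' x = ?arc x" if "x < ?o" for x using J that by simp
      have "written m s ?m4" if s: "s \<in> {1..<Suc t}" for s
      proof (cases "s = t")
        case True
        have "segment (nmem ?m4 ''out_arc'') (nmem ?m4 ''out_ptr'') t = map ?pbuf [?ps..<?pe]"
          using J unfolding segment_def mem by simp
        then show ?thesis unfolding True written_def mem(1,2,4) plan_path_def by simp
      next
        case False
        then have st: "s \<in> {1..<t}" using s by simp
        then have old: "written m s m'" "1 < t" using w unfolding writing_def by auto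
        have op: "nmem ?m4 ''out_ptr'' s = nmem m' ''out_ptr'' s" using st unfolding mem by simp
        have "nmem m' ''out_ptr'' t = ?o" using w old(2) unfolding writing_def by blast
        then have op': "nmem ?m4 ''out_ptr'' (Suc s) = nmem m' ''out_ptr'' (Suc s)"
          using st unfolding mem by (cases "Suc s = t") simp_all
        have le: "nmem m' ''out_ptr'' (Suc s) \<le> ?o" using old unfolding written_def by blast
        have "segment (nmem ?m4 ''out_arc'') (nmem ?m4 ''out_ptr'') s = segment ?arc (nmem m' ''out_ptr'') s"
          unfolding segment_def op op' using le arcs4 by (intro map_cong) simp_all
        moreover have "nmem ?m4 ''out_start'' s = nmem m' ''out_start'' s" using False unfolding mem by simp
        ultimately show ?thesis using old(1) le unfolding written_def op op' mem(4) by simp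
      qed
      then have "writing m (Suc t) ?m4" unfolding writing_def mem by simp
      then show "run (NWrite ''out_ptr'' (NAdd (scalar ''t'') (NConst 1)) (scalar ''o'')) m3 10 (writing m (Suc t))"
        using J by (intro run_NWrite) (simp_all add: frameD[OF f3] o1)
    qed
    then show "run (Then (NWrite ''out_start'' (scalar ''t'') (NRead ''origin'' (scalar ''t'')))
      (Then (NWrite ''out_ptr'' (scalar ''t'') (scalar ''o''))
      (Then ?for (NWrite ''out_ptr'' (NAdd (scalar ''t'') (NConst 1)) (scalar ''o''))))) m1 (card V * 40 + 80)
      (writing m (Suc t))"
      by (intro run_NWrite_Then) (simp_all add: o1 run_mono)
  qed simp
qed

lemma written_optimal:
  assumes s: "searching 0 m" and w: "\<forall>t\<in>{1..T}. written m t m'"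
  shows "optimal_sequence P (returned m')"
proof -
  let ?l = "nmem m ''last''" and ?g = "rmem m ''g''" let ?cur = "interval_start ?l"
  have ready: "planned k m" "best_upto k (Suc T) ?g" if "1 \<le> k" "k \<le> T" for k
  proof -
    have "k \<in> {0<..T}" using that by simp
    then show "planned k m" "best_upto k (Suc T) ?g"
      using s unfolding searching_def later_done_def by blast+
  qed
  have opt: "optimal_sequence P (\<lambda>t. plan_path m (?cur t))"
  proof (rule dp_optimal[where g = ?g and last' = ?l])
    show "1 \<le> T" by (rule T_pos)
    show "0 \<le> penalty P" using penalty_pos by simp
    show "?g (Suc T) = 0" using s unfolding searching_def later_done_def by blast
    show "?cur 1 = 1" by simp
    show "?cur (Suc t) = (if ?l (?cur t) < Suc t then Suc t else ?cur t)" for t by simp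
  next
    fix i j p assume ij: "1 \<le> i" "i \<le> j" "j \<le> T" and p: "\<And>t. t \<in> {i..j} \<Longrightarrow> valid_path P t p"
    have "j \<in> {i..<Suc T}" "\<forall>t\<in>{i..j}. valid_path P t p" using ij p by auto
    moreover have "best_upto i (Suc T) ?g" by (rule ready(2)) (use ij in simp_all)
    ultimately show "?g i \<le> penalty P + (\<Sum>t = i..j. path_cost P t p) + ?g (Suc j)"
      unfolding best_upto_def by blast
  next
    fix i assume "1 \<le> i" "i \<le> T"
    from ready(1)[OF this] show "i \<le> ?l i \<and> ?l i \<le> T \<and> (\<forall>t\<in>{i..?l i}. valid_path P t (plan_path m i)) \<and>
      ?g i = penalty P + (\<Sum>t = i..?l i. path_cost P t (plan_path m i)) + ?g (Suc (?l i))"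
      unfolding planned_def by blast
  qed
  have eq: "returned m' t = plan_path m (?cur t)" if t: "t \<in> {1..T}" for t
  proof (rule prod_eqI)
    have "valid_path P t (plan_path m (?cur t))"
      using opt t unfolding optimal_sequence_def path_sequence_def by blast
    then have "fst (plan_path m (?cur t)) = origin P t" unfolding valid_path_def by blast
    moreover have "written m t m'" using w t by blast
    ultimately show "fst (returned m' t) = fst (plan_path m (?cur t))"
      "snd (returned m' t) = snd (plan_path m (?cur t))"
      unfolding returned_def written_def by simp_all
  qed
  have "optimal_sequence P (returned m') \<longleftrightarrow> optimal_sequence P (\<lambda>t. plan_path m (?cur t))"
    by (rule optimal_sequence_cong) (rule eq)
  with opt show ?thesis by blast
qed

lemma run_output_all:
  assumes s: "searching 0 m"
  shows "run output_all m (T * (card V * 40 + 120) + 30) (\<lambda>m'. optimal_sequence P (returned m'))"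
proof -
  have m: "inputs_kept m" using s unfolding searching_def by blast
  let ?m1 = "nwrite ''cur'' 0 1 m"
  let ?for = "For ''t'' (NConst 1) (NAdd (scalar ''horizon'') (NConst 1)) output_path"
  have I_t: "writing m t (nwrite ''t'' 0 n m')" if "writing m t m'" for t n m'
    using that unfolding writing_def written_def by simp
  have kept: "inputs_kept m'" if "frame ?for ?m1 m'" for m'
    by (rule inputs_kept_frame[OF _ that]) (use m in simp_all)
  have "run ?for ?m1 (T * (card V * 40 + 120) + 20) (\<lambda>m'. optimal_sequence P (returned m'))"
  proof (rule run_For[where h = "Suc T" and k = "card V * 40 + 100" and I = "writing m"])
    have "writing m 1 ?m1" unfolding writing_def by simp
    then show "writing m (nval (NConst 1) ?m1) (nwrite ''t'' 0 (nval (NConst 1) ?m1) ?m1)"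
      using I_t by simp
  next
    fix i m' assume "frame ?for ?m1 m'"
    from inputs(1)[OF kept[OF this]] show "nval (NAdd (scalar ''horizon'') (NConst 1)) m' = Suc T" by simp
  next
    fix t m' assume t: "nval (NConst 1) ?m1 \<le> t" "t < Suc T" "nmem m' ''t'' 0 = t" and w: "writing m t m'"
      and f: "frame ?for ?m1 m'"
    let ?i = "interval_start (nmem m ''last'') t"
    have "1 \<le> ?i" "?i \<le> t" using interval_start_bounds[of t "nmem m ''last''"] t by simp_all
    then have "?i \<in> {0<..T}" using t by simp
    then have "planned ?i m" using s unfolding searching_def later_done_def by blast
    then have "run output_path m' (card V * 40 + 100) (writing m (Suc t))"
      by (intro run_output_path[OF kept[OF f] _ _ _ _ _ t(3) w]) (use t in \<open>simp_all add: frameD[OF f]\<close>)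
    then show "run output_path m' (card V * 40 + 100) (\<lambda>m''. writing m (Suc t) (nwrite ''t'' 0 (Suc t) m''))"
      by (rule run_mono) (simp_all add: I_t)
  next
    fix m' assume "writing m (Suc T) m'"
    then have "\<forall>t\<in>{1..T}. written m t m'"
      unfolding writing_def atLeastLessThanSuc_atLeastAtMost by blast
    then show "optimal_sequence P (returned m')" by (rule written_optimal[OF s])
  qed (simp_all add: algebra_simps)
  then show ?thesis
    unfolding output_all_def by (intro run_NWrite_Then) (simp_all add: run_mono)
qed

section \<open>The time bound\<close>

lemma run_all_in_one:
  assumes L: "card V + card V \<le> 2 ^ L"
  shows "run all_in_one_pricing m0 (1600 * (T * T * ((card V + num_arcs P) * (L + 1))))
    (\<lambda>m'. optimal_sequence P (returned m'))"
proof -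
  let ?N = "card V" and ?M = "num_arcs P"
  \<comment> \<open>Every summand of the running time is at most a multiple of \<open>T * T * U\<close>.\<close>
  define U where "U = (?N + ?M) * (L + 1)"
  have U0: "?N \<le> U" "?M \<le> U" "?N * L \<le> U" "?M * L \<le> U" "1 \<le> U"
    using V_nonempty unfolding U_def by (simp_all add: algebra_simps)
  have "L \<le> ?N * L" using mult_le_mono1[OF V_nonempty, of L] by simp
  then have "L \<le> U" using U0(3) by (rule le_trans)
  note U = U0(1-4) this U0(5)
  have "extend_budget L \<le> 940 * U"
    using U unfolding extend_budget_def dijkstra_budget_def by (simp add: algebra_simps)
  then have "?M * 40 + (extend_budget L + 20) \<le> 1000 * U" using U(2,6) by linarith
  then have "T * (?M * 40 + (extend_budget L + 20)) \<le> T * (1000 * U)" by (rule mult_le_mono2)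
  moreover have "plan_budget L = T * (?M * 40 + (extend_budget L + 20)) + 100"
    unfolding plan_budget_def by (simp add: distrib_left)
  moreover have "T * (1000 * U) = 1000 * (T * U)" by (rule mult.left_commute)
  ultimately have "plan_budget L \<le> 1000 * (T * U) + 100" by (simp only: add_right_mono)
  moreover have "1 \<le> T * U" using T_pos U(6) by simp
  ultimately have plan: "plan_budget L + 10 \<le> 1110 * (T * U)" by linarith
  have TTU: "U \<le> T * T * U" "T * U \<le> T * T * U" using T_pos by simp_all
  have "T * (plan_budget L + 10) \<le> T * (1110 * (T * U))" using plan by (rule mult_le_mono2)
  moreover have "T * (1110 * (T * U)) = 1110 * (T * T * U)" by (simp only: mult.assoc mult.left_commute)
  moreover have "T * (?N * 40 + 120) \<le> T * (160 * U)" using U(1,6) by (intro mult_le_mono2) simp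
  moreover have "T * (160 * U) = 160 * (T * U)" by (rule mult.left_commute)
  ultimately have "?N * 80 + 50 + (T * (plan_budget L + 10) + 20) + (T * (?N * 40 + 120) + 30) \<le> 1600 * (T * T * U)"
    using U(1,6) TTU by linarith
  then show ?thesis
    unfolding all_in_one_pricing_def U_def[symmetric]
    by (intro run_seq[OF run_plan_all[OF L]]) (rule run_output_all, simp_all)
qed

end

lemma log_depth:
  assumes "1 \<le> n"
  obtains L :: nat where "n + n \<le> 2 ^ L" "real L \<le> log 2 (real n) + 2"
proof
  let ?L = "nat \<lceil>log 2 (real (n + n))\<rceil>"
  have pos: "0 \<le> log 2 (real (n + n))" using assms by simp
  have "real (n + n) = 2 powr log 2 (real (n + n))" using assms by simp
  also have "\<dots> \<le> 2 powr real ?L" by (intro powr_mono) linarith+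
  also have "\<dots> = 2 ^ ?L" by (simp add: powr_realpow)
  finally show "n + n \<le> 2 ^ ?L" by (metis numeral_power_le_of_nat_cancel_iff of_nat_le_iff of_nat_numeral of_nat_power)
  have "real ?L \<le> log 2 (real (n + n)) + 1" using pos by linarith
  moreover have "log 2 (real (n + n)) = log 2 (real n) + 1"
    using assms by (simp add: log_mult flip: mult_2)
  ultimately show "real ?L \<le> log 2 (real n) + 2" by linarith
qed

theorem mainTheorem3:
  shows "\<exists>prog. \<forall>c::real. \<exists>C::real. \<forall>P m.
    valid_pricing P \<longrightarrow> num_arcs P \<ge> 2 \<longrightarrow>
    real (card (verts (net P))) \<le> c * real (num_arcs P) \<longrightarrow>
    encodes P m \<longrightarrow>
    (\<exists>n m'. exec prog m n m' \<and> optimal_sequence P (returned m') \<and>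
      real n \<le> C * (real (horizon P))\<^sup>2 * real (num_arcs P) * ln (real (num_arcs P)))"
proof (intro exI[of _ all_in_one_pricing] allI)
  fix c :: real
  \<comment> \<open>\<open>log 2 b\<close> must be nonnegative, while \<open>c\<close> is arbitrary.\<close>
  define b where "b = max c 1"
  define C where "C = 1600 * (b + 1) * ((log 2 b + 4) / ln 2)"
  show "\<exists>C. \<forall>P m. valid_pricing P \<longrightarrow> num_arcs P \<ge> 2 \<longrightarrow>
    real (card (verts (net P))) \<le> c * real (num_arcs P) \<longrightarrow> encodes P m \<longrightarrow>
    (\<exists>n m'. exec all_in_one_pricing m n m' \<and> optimal_sequence P (returned m') \<and>
      real n \<le> C * (real (horizon P))\<^sup>2 * real (num_arcs P) * ln (real (num_arcs P)))"
  proof (intro exI[of _ C] allI impI)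
    fix P m
    assume valid: "valid_pricing P" and M2: "num_arcs P \<ge> 2"
      and sparse: "real (card (verts (net P))) \<le> c * real (num_arcs P)" and enc: "encodes P m"
    interpret encoded_pricing P m by standard (fact valid, fact enc)
    let ?N = "card V" and ?M = "num_arcs P"
    have b1: "1 \<le> b" unfolding b_def by simp
    have "c * real ?M \<le> b * real ?M" unfolding b_def by (intro mult_right_mono) simp_all
    with sparse have N: "real ?N \<le> b * real ?M" by simp
    obtain L :: nat where L: "?N + ?N \<le> 2 ^ L" "real L \<le> log 2 (real ?N) + 2"
      using log_depth[OF V_nonempty] by blast
    obtain n m' where run: "exec all_in_one_pricing m n m'" "optimal_sequence P (returned m')"
      and n: "n \<le> 1600 * (T * T * ((?N + ?M) * (L + 1)))"
      using run_all_in_one[OF L(1)] unfolding run_def by blast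
    have lnM: "ln 2 \<le> ln (real ?M)" using M2 by simp
    have ln2: "(0::real) < ln 2" by simp
    have "log 2 (real ?N) \<le> log 2 (b * real ?M)" using N V_nonempty M2 b1 by simp
    also have "\<dots> = log 2 b + ln (real ?M) / ln 2"
    proof -
      have "0 < b" "0 < real ?M" using b1 M2 by simp_all
      then show ?thesis by (simp add: log_def ln_mult add_divide_distrib)
    qed
    finally have "real (L + 1) \<le> log 2 b + 3 + ln (real ?M) / ln 2" using L(2) by simp
    also have "\<dots> \<le> (log 2 b + 3) * (ln (real ?M) / ln 2) + ln (real ?M) / ln 2"
    proof -
      have "1 \<le> ln (real ?M) / ln 2" using lnM ln2 by simp
      moreover have "0 \<le> log 2 b + 3" using b1 by simp
      ultimately have "(log 2 b + 3) * 1 \<le> (log 2 b + 3) * (ln (real ?M) / ln 2)" by (intro mult_left_mono)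
      then show ?thesis by simp
    qed
    also have "\<dots> = (log 2 b + 4) / ln 2 * ln (real ?M)" by (simp add: field_simps)
    finally have L1: "real (L + 1) \<le> (log 2 b + 4) / ln 2 * ln (real ?M)" .
    have NM: "real (?N + ?M) \<le> (b + 1) * real ?M" using N by (simp add: algebra_simps)
    have "real n \<le> real (1600 * (T * T * ((?N + ?M) * (L + 1))))" using n by (rule of_nat_mono)
    also have "\<dots> = 1600 * (real T)\<^sup>2 * (real (?N + ?M) * real (L + 1))"
      by (simp only: of_nat_mult of_nat_numeral power2_eq_square mult.assoc)
    also have "\<dots> \<le> 1600 * (real T)\<^sup>2 * ((b + 1) * real ?M * ((log 2 b + 4) / ln 2 * ln (real ?M)))"
      using b1 by (intro mult_left_mono mult_mono[OF NM L1]) simp_all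
    also have "\<dots> = C * (real T)\<^sup>2 * real ?M * ln (real ?M)" unfolding C_def by (simp only: mult_ac)
    finally show "\<exists>n m'. exec all_in_one_pricing m n m' \<and> optimal_sequence P (returned m') \<and>
      real n \<le> C * (real T)\<^sup>2 * real ?M * ln (real ?M)" using run by blast
  qed
qed

end
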